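(* Let $B>0$ be fixed and let $V\in C_0^\infty(\mathbb{R}^2)$ be real-valued. There exist $C>0$ and $N\in\mathbb{N}$ such that for all $n\geq N$, $$\sigma(H+V)\cap\Delta_n\subset(\Lambda_n-Cn^{-1/2},\,\Lambda_n+Cn^{-1/2}).$$ The constants $C$ and $N$ depend (for the fixed $B$) only on $\sup_{x\in\mathbb{R}^2}|V(x)|$ and on the diameter of $\operatorname{supp}V$.
   Context: $B>0$ is a fixed constant, and $H$ is the Landau Hamiltonian in $L^2(\mathbb{R}^2)$: $$H=\left(-i\frac{\partial}{\partial x_1}+\frac{B}{2}x_2\right)^2+\left(-i\frac{\partial}{\partial x_2}-\frac{B}{2}x_1\right)^2 .$$ Its spectrum consists of the eigenvalues (Landau levels) $\Lambda_n=B(2n+1)$, $n=0,1,2,\dots$, each of infinite multiplicity. $V$ acts as a multiplication operator, and $\sigma(\cdot)$ denotes the spectrum. The intervals $\Delta_n$ are $\Delta_0=[\inf\sigma(H+V),2B)$ and $\Delta_n=[\Lambda_n-B,\Lambda_n+B)$ for $n\in\mathbb{N}=\{1,2,\dots\}$. *)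

theory Defs
  imports "HOL-Analysis.Analysis"
begin

subsection \<open>Smooth compactly supported functions\<close>

definition pdiff :: "'n::finite \<Rightarrow> (real^'n \<Rightarrow> 'b::real_normed_vector) \<Rightarrow> real^'n \<Rightarrow> 'b" where
  "pdiff j f x = vector_derivative (\<lambda>t. f (x + t *\<^sub>R axis j 1)) (at 0)"

text \<open>Every iterated partial derivative is (totally) differentiable. As this includes all orders, all
  iterated partial derivatives are then continuous, so this is the usual class of infinitely
  differentiable functions.\<close>

definition smooth :: "(real^'n::finite \<Rightarrow> 'b::real_normed_vector) \<Rightarrow> bool" where
  "smooth f \<longleftrightarrow> (\<forall>js. foldr pdiff js f differentiable_on UNIV)"

definition supp :: "('a::topological_space \<Rightarrow> 'b::zero) \<Rightarrow> 'a set" where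
  "supp f = closure {x. f x \<noteq> 0}"

definition test_fun :: "(real^'n::finite \<Rightarrow> 'b::real_normed_vector) \<Rightarrow> bool" where
  "test_fun f \<longleftrightarrow> smooth f \<and> compact (supp f)"


subsection \<open>The Hilbert space of square integrable functions\<close>

text \<open>Elements are represented by functions; two functions that agree almost everywhere represent
  the same element.\<close>

definition L2 :: "(real^2 \<Rightarrow> complex) set" where
  "L2 = {u \<in> borel_measurable lborel. integrable lborel (\<lambda>x. (cmod (u x))\<^sup>2)}"

definition L2norm :: "(real^2 \<Rightarrow> complex) \<Rightarrow> real" where
  "L2norm u = sqrt (LINT x|lborel. (cmod (u x))\<^sup>2)"


subsection \<open>Unbounded operators and their spectra\<close>

text \<open>A linear operator is given by its graph, a set of pairs of representatives.\<close>

type_synonym L2_operator = "((real^2 \<Rightarrow> complex) \<times> (real^2 \<Rightarrow> complex)) set"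

text \<open>A number \<open>z\<close> is in the resolvent set of \<open>T\<close> if \<open>T - z\<close> maps the domain of \<open>T\<close> bijectively onto
  the whole space and the inverse is bounded. For linear \<open>T\<close> the estimate below expresses both that
  \<open>T - z\<close> is injective (modulo almost everywhere equality) and that its inverse is bounded.\<close>

definition resolvent_set :: "L2_operator \<Rightarrow> complex set" where
  "resolvent_set T =
    {z. (\<forall>g\<in>L2. \<exists>(u, f)\<in>T. AE x in lborel. f x - z * u x = g x) \<and>
        (\<exists>c. \<forall>(u, f)\<in>T. L2norm u \<le> c * L2norm (\<lambda>x. f x - z * u x))}"

definition spectrum :: "L2_operator \<Rightarrow> complex set" where
  "spectrum T = - resolvent_set T"


subsection \<open>The Landau Hamiltonian\<close>

definition momentum1 :: "real \<Rightarrow> (real^2 \<Rightarrow> complex) \<Rightarrow> real^2 \<Rightarrow> complex" where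
  "momentum1 B u x = - \<i> * pdiff 1 u x + complex_of_real (B / 2 * x $ 2) * u x"

definition momentum2 :: "real \<Rightarrow> (real^2 \<Rightarrow> complex) \<Rightarrow> real^2 \<Rightarrow> complex" where
  "momentum2 B u x = - \<i> * pdiff 2 u x - complex_of_real (B / 2 * x $ 1) * u x"

definition landau_expr :: "real \<Rightarrow> (real^2 \<Rightarrow> complex) \<Rightarrow> real^2 \<Rightarrow> complex" where
  "landau_expr B u x =
    momentum1 B (momentum1 B u) x + momentum2 B (momentum2 B u) x"

text \<open>The differential expression is essentially self-adjoint on the smooth compactly supported
  functions. The Landau Hamiltonian is the corresponding self-adjoint operator, that is, the closure
  in the graph norm.\<close>

definition landau_hamiltonian :: "real \<Rightarrow> L2_operator" where
  "landau_hamiltonian B =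
    {(u, f). u \<in> L2 \<and> f \<in> L2 \<and>
      (\<exists>\<phi>::nat \<Rightarrow> real^2 \<Rightarrow> complex. (\<forall>k. test_fun (\<phi> k)) \<and>
        (\<lambda>k. L2norm (\<lambda>x. \<phi> k x - u x)) \<longlonglongrightarrow> 0 \<and>
        (\<lambda>k. L2norm (\<lambda>x. landau_expr B (\<phi> k) x - f x)) \<longlonglongrightarrow> 0)}"

text \<open>The sum with multiplication by \<open>V\<close>. As only bounded \<open>V\<close> are considered, the domain does not
  change.\<close>

definition add_potential :: "L2_operator \<Rightarrow> (real^2 \<Rightarrow> real) \<Rightarrow> L2_operator" where
  "add_potential T V = {(u, \<lambda>x. f x + complex_of_real (V x) * u x) | u f. (u, f) \<in> T}"

definition landau_level :: "real \<Rightarrow> nat \<Rightarrow> real" where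
  "landau_level B n = B * (2 * real n + 1)"

definition level_interval :: "real \<Rightarrow> (real^2 \<Rightarrow> real) \<Rightarrow> nat \<Rightarrow> real set" where
  "level_interval B V n =
    (if n = 0
     then {Inf {t. complex_of_real t \<in> spectrum (add_potential (landau_hamiltonian B) V)} ..< 2 * B}
     else {landau_level B n - B ..< landau_level B n + B})"

end

theory Submission
  imports Defs
begin

text \<open>No spectral projections are used. Let \<open>h = (H - E) u\<close> with \<open>E\<close> of order \<open>n\<close>. Commuting \<open>H\<close> with the
  symmetrisation of \<open>arctan (x\<^sub>j - p\<^sub>j) P\<^sub>j\<close>, where \<open>P\<^sub>j\<close> are the magnetic momenta, bounds
  \<open>P u\<close> near \<open>p\<close>, and hence \<open>E * \<parallel>u\<parallel>\<^sup>2\<close> on a fixed ball, by \<open>sqrt E * \<parallel>u\<parallel>\<^sup>2\<close> and terms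
  containing \<open>h\<close>: classically, a particle on a cyclotron orbit of radius of order \<open>sqrt n\<close> spends a fraction of order
  \<open>n\<^bsup>-1/2\<^esup>\<close> of its time in the ball. If \<open>Q\<close> is the indicator of \<open>supp V\<close> and
  \<open>E\<close> has distance \<open>\<delta>\<close> to the Landau levels, two applications of this estimate and duality give
  \<open>\<parallel>Q (H - E)\<^bsup>-1\<^esup> Q\<parallel> \<le> K / (sqrt E * \<delta>)\<close>, which is smaller than \<open>1 / (2 * sup \<bar>V\<bar>)\<close> when
  \<open>\<delta> \<ge> C * n\<^bsup>-1/2\<^esup>\<close>, and a contraction argument then inverts \<open>H + V - E\<close>.

  The resolvent of \<open>H\<close> itself comes from the functions \<open>z\<^bsup>j\<^esup> * cnj z\<^bsup>k\<^esup> * exp (- B * \<bar>x\<bar>\<^sup>2 / 4)\<close>, on which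
  \<open>H\<close> acts triangularly and whose span is dense.\<close>

subsection \<open>Calculus of smooth functions\<close>

text \<open>Why one application of the estimate is not enough: pairing a general \<open>h\<close>
  with a momentum costs \<open>sqrt E * \<parallel>h\<parallel> * \<parallel>u\<parallel>\<close>.
  With \<open>\<parallel>u\<parallel> \<le> \<parallel>h\<parallel> / \<delta>\<close> this bounds
  \<open>Q (H - E)^-1\<close> only by order \<open>E^(-1/4) / \<delta>\<close>, and duality gives
  the same bound for \<open>(H - E)^-1 Q\<close>. The estimate therefore keeps apart the part of
  \<open>h\<close> inside the ball. There the weighted momentum on the left absorbs the pairing, so
  for \<open>h = Q h\<close> the costly term disappears. What remains of order \<open>sqrt E\<close>
  is \<open>sqrt E * \<parallel>u\<parallel>\<^sup>2\<close>, and the bound already found for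
  \<open>u\<close> makes it of order \<open>(\<parallel>h\<parallel> / \<delta>)\<^sup>2\<close>.
  Division by \<open>E\<close> gives the exponent -1/2 for the compression, and hence the one in the
  theorem.

  The arctangent is bounded, so the error terms are at most linear in the momenta, and its
  derivative is positive, so the main term is a weighted square. The centre \<open>p\<close> enters
  by translation only. Hence the position of the support leaves no trace in the constants; its
  diameter does, as the radius of the ball.\<close>

lemma pdiff_eqI:
  assumes "(f has_derivative f') (at x)"
  shows "pdiff j f x = f' (axis j 1)"
proof -
  have l: "linear f'" using assms has_derivative_linear by blast
  have "((\<lambda>t. x + t *\<^sub>R axis j (1::real)) has_derivative (\<lambda>t. t *\<^sub>R axis j 1)) (at (0::real))"
    by (auto intro!: derivative_eq_intros)
  from diff_chain_at[OF this, of f f'] assms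
  have "((\<lambda>t. f (x + t *\<^sub>R axis j (1::real))) has_derivative (\<lambda>t. f' (t *\<^sub>R axis j 1))) (at 0)"
    by (simp add: o_def)
  then have "((\<lambda>t. f (x + t *\<^sub>R axis j (1::real))) has_vector_derivative f' (axis j 1)) (at 0)"
    by (simp add: has_vector_derivative_def linear_cmul[OF l])
  then show ?thesis
    unfolding pdiff_def by (rule vector_derivative_at)
qed

lemma pdiff_line:
  assumes "f differentiable (at (x + s *\<^sub>R axis j 1))"
  shows "((\<lambda>t. f (x + t *\<^sub>R axis j (1::real))) has_vector_derivative pdiff j f (x + s *\<^sub>R axis j 1)) (at s)"
proof -
  obtain f' where f': "(f has_derivative f') (at (x + s *\<^sub>R axis j 1))"
    using assms differentiable_def by blast
  have l: "linear f'" using f' has_derivative_linear by blast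
  have "((\<lambda>t. x + t *\<^sub>R axis j (1::real)) has_derivative (\<lambda>t. t *\<^sub>R axis j 1)) (at s)"
    by (auto intro!: derivative_eq_intros)
  from diff_chain_at[OF this, of f f'] f'
  show ?thesis
    by (simp add: o_def pdiff_eqI[OF f'] has_vector_derivative_def linear_cmul[OF l])
qed

lemma pdiff_const [simp]: "pdiff j (\<lambda>x. c) = (\<lambda>x. 0)"
  by (rule ext, subst pdiff_eqI) (auto intro: derivative_eq_intros)

lemma differentiable_bounded_linear:
  assumes "bounded_linear L" "f differentiable (at x)"
  shows "(\<lambda>x. L (f x)) differentiable (at x)"
  using assms(2) bounded_linear.has_derivative[OF assms(1)] unfolding differentiable_def by blast

lemma differentiable_bounded_bilinear:
  assumes "bounded_bilinear prd" "f differentiable (at x)" "g differentiable (at x)"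
  shows "(\<lambda>x. prd (f x) (g x)) differentiable (at x)"
  using assms(2,3) bounded_bilinear.FDERIV[OF assms(1)] unfolding differentiable_def by blast

lemma differentiable_compose_real:
  assumes "q differentiable (at x)" "(\<psi> has_vector_derivative d) (at (q x))"
  shows "(\<lambda>x. \<psi> (q x)) differentiable (at x)"
proof -
  have "\<psi> differentiable (at (q x))"
    using assms(2) by (auto simp: has_vector_derivative_def differentiable_def)
  from differentiable_chain_at[OF assms(1) this] show ?thesis by (simp add: o_def)
qed

lemma pdiff_linear:
  assumes "bounded_linear L" "f differentiable (at x)"
  shows "pdiff j (\<lambda>x. L (f x)) x = L (pdiff j f x)"
proof -
  obtain f' where f': "(f has_derivative f') (at x)" using assms(2) differentiable_def by blast
  from pdiff_eqI[OF bounded_linear.has_derivative[OF assms(1) f']] pdiff_eqI[OF f']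
  show ?thesis by simp
qed

lemma pdiff_add:
  assumes "f differentiable (at x)" "g differentiable (at x)"
  shows "pdiff j (\<lambda>x. f x + g x) x = pdiff j f x + pdiff j g x"
proof -
  obtain f' g' where *: "(f has_derivative f') (at x)" "(g has_derivative g') (at x)"
    using assms differentiable_def by metis
  show ?thesis
    by (simp add: pdiff_eqI[OF has_derivative_add[OF *]] pdiff_eqI[OF *(1)] pdiff_eqI[OF *(2)])
qed

lemma pdiff_diff:
  assumes "f differentiable (at x)" "g differentiable (at x)"
  shows "pdiff j (\<lambda>x. f x - g x) x = pdiff j f x - pdiff j g x"
proof -
  obtain f' g' where *: "(f has_derivative f') (at x)" "(g has_derivative g') (at x)"
    using assms differentiable_def by metis
  show ?thesis
    by (simp add: pdiff_eqI[OF has_derivative_diff[OF *]] pdiff_eqI[OF *(1)] pdiff_eqI[OF *(2)])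
qed

lemma pdiff_bilinear:
  assumes "bounded_bilinear prd" "f differentiable (at x)" "g differentiable (at x)"
  shows "pdiff j (\<lambda>x. prd (f x) (g x)) x = prd (f x) (pdiff j g x) + prd (pdiff j f x) (g x)"
proof -
  obtain f' g' where *: "(f has_derivative f') (at x)" "(g has_derivative g') (at x)"
    using assms differentiable_def by metis
  show ?thesis
    by (simp add: pdiff_eqI[OF bounded_bilinear.FDERIV[OF assms(1) *]]
        pdiff_eqI[OF *(1)] pdiff_eqI[OF *(2)])
qed

lemma pdiff_compose_real:
  assumes "q differentiable (at x)" "(\<psi> has_vector_derivative d) (at (q x))"
  shows "pdiff j (\<lambda>x. \<psi> (q x)) x = pdiff j q x *\<^sub>R d"
proof -
  obtain q' where *: "(q has_derivative q') (at x)"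
    using assms differentiable_def by metis
  have "((\<lambda>x. \<psi> (q x)) has_derivative (\<lambda>y. q' y *\<^sub>R d)) (at x)"
    using diff_chain_at[OF * assms(2)[unfolded has_vector_derivative_def]] by (simp add: o_def)
  from pdiff_eqI[OF this] pdiff_eqI[OF *] show ?thesis by simp
qed

lemma pdiff_nth [simp]: "pdiff j (\<lambda>x. x $ i) x = (if i = j then 1 else 0)"
proof -
  have "((\<lambda>x::real^'a. x $ i) has_derivative (\<lambda>x. x $ i)) (at x)"
    by (rule bounded_linear_imp_has_derivative[OF bounded_linear_vec_nth])
  from pdiff_eqI[OF this] show ?thesis by (simp add: axis_def)
qed

text \<open>Differentiability of all iterated partial derivatives of order at most \<open>n\<close>; unlike \<open>smooth\<close>
  it admits induction on \<open>n\<close>.\<close>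

primrec csm :: "nat \<Rightarrow> (real^'n::finite \<Rightarrow> 'b::real_normed_vector) \<Rightarrow> bool" where
  "csm 0 f \<longleftrightarrow> f differentiable_on UNIV"
| "csm (Suc n) f \<longleftrightarrow> f differentiable_on UNIV \<and> (\<forall>j. csm n (pdiff j f))"

lemma csm_iff: "csm n f \<longleftrightarrow> (\<forall>js. length js \<le> n \<longrightarrow> foldr pdiff js f differentiable_on UNIV)"
proof (induction n arbitrary: f)
  case (Suc n)
  show ?case
  proof (intro iffI allI impI)
    fix js :: "'a list" assume a: "csm (Suc n) f" "length js \<le> Suc n"
    \<comment> \<open>\<open>foldr\<close> applies the last list element first, and
      \<open>csm\<close> peels off exactly this innermost derivative.\<close>
    show "foldr pdiff js f differentiable_on UNIV"
      using a Suc.IH by (cases js rule: rev_cases) auto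
  next
    assume a: "\<forall>js. length js \<le> Suc n \<longrightarrow> foldr pdiff js f differentiable_on UNIV"
    have "foldr pdiff js (pdiff j f) differentiable_on UNIV" if "length js \<le> n" for js j
      using a[rule_format, of "js @ [j]"] that by simp
    then show "csm (Suc n) f" using Suc.IH a[rule_format, of "[]"] by auto
  qed
qed auto

lemma smooth_iff_csm: "smooth f \<longleftrightarrow> (\<forall>n. csm n f)"
  unfolding smooth_def csm_iff by auto

lemma csm_SucD: "csm (Suc n) f \<Longrightarrow> csm n f"
  by (induction n arbitrary: f) auto

lemma csm_differentiable: "csm n f \<Longrightarrow> f differentiable (at x)"
  by (cases n) (auto simp: differentiable_on_def)

lemma smooth_differentiable: "smooth f \<Longrightarrow> f differentiable (at x)"
  by (meson csm_differentiable smooth_iff_csm)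

lemma smooth_pdiff: "smooth f \<Longrightarrow> smooth (pdiff j f)"
  unfolding smooth_iff_csm using csm.simps(2) by blast

lemma smooth_continuous: "smooth f \<Longrightarrow> continuous_on S f"
  by (meson smooth_differentiable differentiable_imp_continuous_within continuous_at_imp_continuous_on)

lemma csm_SucI: "(\<And>x. f differentiable (at x)) \<Longrightarrow> (\<And>j. csm n (pdiff j f)) \<Longrightarrow> csm (Suc n) f"
  by (auto simp: differentiable_on_def differentiable_at_withinI)

lemma csm_0I: "(\<And>x. f differentiable (at x)) \<Longrightarrow> csm 0 f"
  by (auto simp: differentiable_on_def differentiable_at_withinI)

lemma csm_const: "csm n (\<lambda>x. c)"
  by (induction n arbitrary: c) auto

lemma csm_linear:
  assumes "bounded_linear L" "csm n f" shows "csm n (\<lambda>x. L (f x))"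
  using assms(2)
proof (induction n arbitrary: f)
  case 0
  then show ?case
    by (intro csm_0I differentiable_bounded_linear[OF assms(1)]) (rule csm_differentiable)
next
  case (Suc n)
  have "pdiff j (\<lambda>x. L (f x)) = (\<lambda>x. L (pdiff j f x))" for j
    using pdiff_linear[OF assms(1)] csm_differentiable[OF Suc.prems] by blast
  then show ?case
    using Suc assms(1) csm_differentiable[OF Suc.prems]
    by (intro csm_SucI) (auto intro: differentiable_bounded_linear)
qed

lemma csm_add:
  assumes "csm n f" "csm n g" shows "csm n (\<lambda>x. f x + g x)"
  using assms
proof (induction n arbitrary: f g)
  case 0
  then show ?case by (auto intro!: csm_0I dest: csm_differentiable)
next
  case (Suc n)
  note d = csm_differentiable[OF Suc.prems(1)] csm_differentiable[OF Suc.prems(2)]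
  have "pdiff j (\<lambda>x. f x + g x) = (\<lambda>x. pdiff j f x + pdiff j g x)" for j
    using pdiff_add d by blast
  then show ?case
    using Suc d by (intro csm_SucI) auto
qed

lemma csm_bilinear:
  assumes "bounded_bilinear prd" "csm n f" "csm n g" shows "csm n (\<lambda>x. prd (f x) (g x))"
  using assms(2,3)
proof (induction n arbitrary: f g)
  case 0
  then show ?case
    by (intro csm_0I differentiable_bounded_bilinear[OF assms(1)]) (rule csm_differentiable, assumption)+
next
  case (Suc n)
  note d = csm_differentiable[OF Suc.prems(1)] csm_differentiable[OF Suc.prems(2)]
  have "pdiff j (\<lambda>x. prd (f x) (g x)) = (\<lambda>x. prd (f x) (pdiff j g x) + prd (pdiff j f x) (g x))" for j
    using pdiff_bilinear[OF assms(1)] d by blast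
  moreover have "(\<lambda>x. prd (f x) (g x)) differentiable (at x)" for x
    using d by (intro differentiable_bounded_bilinear[OF assms(1)])
  ultimately show ?case
    using Suc d csm_SucD[OF Suc.prems(1)] csm_SucD[OF Suc.prems(2)]
    by (intro csm_SucI) (auto intro!: csm_add)
qed

lemma csm_nth: "csm n (\<lambda>x. x $ i)"
proof (cases n)
  case 0
  then show ?thesis
    by (auto simp: differentiable_on_def intro!: bounded_linear_imp_differentiable)
next
  case (Suc m)
  have "pdiff j (\<lambda>x::real^'a. x $ i) = (\<lambda>x. if i = j then 1 else 0)" for j by auto
  then show ?thesis using Suc csm_const
    by (auto simp: differentiable_on_def intro!: bounded_linear_imp_differentiable)
qed

lemma smooth_const [intro!, simp]: "smooth (\<lambda>x. c)"
  and smooth_nth [intro!, simp]: "smooth (\<lambda>x. x $ i)"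
  by (auto simp: smooth_iff_csm csm_const csm_nth)

lemma smooth_linear: "bounded_linear L \<Longrightarrow> smooth f \<Longrightarrow> smooth (\<lambda>x. L (f x))"
  by (simp add: smooth_iff_csm csm_linear)

lemma smooth_bilinear: "bounded_bilinear prd \<Longrightarrow> smooth f \<Longrightarrow> smooth g \<Longrightarrow> smooth (\<lambda>x. prd (f x) (g x))"
  by (simp add: smooth_iff_csm csm_bilinear)

lemma smooth_add [intro]: "smooth f \<Longrightarrow> smooth g \<Longrightarrow> smooth (\<lambda>x. f x + g x)"
  by (simp add: smooth_iff_csm csm_add)

lemma smooth_minus [intro]: "smooth f \<Longrightarrow> smooth (\<lambda>x. - f x)"
  by (rule smooth_linear[of uminus]) (auto simp: bounded_linear_minus)

lemma smooth_diff [intro]: "smooth f \<Longrightarrow> smooth g \<Longrightarrow> smooth (\<lambda>x. f x - g x)"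
  using smooth_add[OF _ smooth_minus, of f g] by simp

lemma smooth_scaleR [intro]: "smooth f \<Longrightarrow> smooth g \<Longrightarrow> smooth (\<lambda>x. f x *\<^sub>R g x)"
  by (rule smooth_bilinear[OF bounded_bilinear_scaleR])

lemma smooth_mult [intro]:
  fixes f g :: "real^'n::finite \<Rightarrow> 'b::real_normed_algebra"
  shows "smooth f \<Longrightarrow> smooth g \<Longrightarrow> smooth (\<lambda>x. f x * g x)"
  by (rule smooth_bilinear[OF bounded_bilinear_mult])

lemma smooth_inner [intro]: "smooth f \<Longrightarrow> smooth g \<Longrightarrow> smooth (\<lambda>x. f x \<bullet> g x)"
  by (rule smooth_bilinear[OF bounded_bilinear_inner])

lemma smooth_of_real [intro]:
  "smooth f \<Longrightarrow> smooth (\<lambda>x. of_real (f x) :: 'b::real_normed_algebra_1)"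
  by (rule smooth_linear[OF bounded_linear_of_real])

lemma smooth_power [intro]:
  fixes f :: "real^'n::finite \<Rightarrow> 'b::real_normed_algebra_1"
  shows "smooth f \<Longrightarrow> smooth (\<lambda>x. f x ^ k)"
  by (induction k) auto

text \<open>With all derivatives of the outer function given as one sequence \<open>\<psi>\<close>,
  the chain rule leads from index \<open>k\<close> to \<open>Suc k\<close>, and the induction needs
  no formula for higher derivatives of a composition.\<close>

lemma csm_compose_real:
  assumes "\<And>k t. (\<psi> k has_vector_derivative \<psi> (Suc k) t) (at t)" "smooth q"
  shows "csm n (\<lambda>x. \<psi> k (q x))"
proof (induction n arbitrary: k)
  case 0
  show ?case
    using differentiable_compose_real[OF smooth_differentiable[OF assms(2)] assms(1)]
    by (intro csm_0I)
next
  case (Suc n)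
  have p: "pdiff j (\<lambda>x. \<psi> k (q x)) = (\<lambda>x. pdiff j q x *\<^sub>R \<psi> (Suc k) (q x))" for j
    using pdiff_compose_real assms smooth_differentiable by blast
  have "csm n (\<lambda>x. pdiff j q x *\<^sub>R \<psi> (Suc k) (q x))" for j
    using Suc smooth_pdiff[OF assms(2)]
    by (intro csm_bilinear[OF bounded_bilinear_scaleR]) (auto simp: smooth_iff_csm)
  moreover have "(\<lambda>x. \<psi> k (q x)) differentiable (at x)" for x
    using differentiable_compose_real[OF smooth_differentiable[OF assms(2)] assms(1)] .
  ultimately show ?case
    by (intro csm_SucI) (auto simp: p)
qed

lemma smooth_compose_real:
  assumes "\<And>k t. (\<psi> k has_vector_derivative \<psi> (Suc k) t) (at t)" "smooth q"
  shows "smooth (\<lambda>x. \<psi> k (q x))"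
  unfolding smooth_iff_csm using csm_compose_real[of \<psi>] assms by blast

lemma smooth_exp [intro]: "smooth q \<Longrightarrow> smooth (\<lambda>x. exp (q x :: real))"
  by (rule smooth_compose_real[of "\<lambda>_. exp" q 0])
    (simp_all add: has_real_derivative_iff_has_vector_derivative[symmetric])

lemma pdiff_inverse:
  fixes f :: "real^'n::finite \<Rightarrow> real"
  assumes "f x \<noteq> 0" "smooth f"
  shows "pdiff j (\<lambda>x. inverse (f x)) x = - (pdiff j f x * (inverse (f x))\<^sup>2)"
proof -
  have "(inverse has_vector_derivative - (inverse (f x) * inverse (f x))) (at (f x))"
    using DERIV_inverse[OF assms(1)]
    by (simp add: has_real_derivative_iff_has_vector_derivative power2_eq_square)
  from pdiff_compose_real[OF smooth_differentiable[OF assms(2)] this]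
  show ?thesis by (simp add: power2_eq_square)
qed

text \<open>The derivative of \<open>1 / f\<close> is a product of \<open>1 / f\<close> with itself
  and a smooth function, so its regularity lifts itself by one order at a time.\<close>

lemma csm_inverse:
  fixes f :: "real^'n::finite \<Rightarrow> real"
  assumes "\<And>x. f x \<noteq> 0" "smooth f"
  shows "csm n (\<lambda>x. inverse (f x))"
proof (induction n)
  case 0
  show ?case
    using assms smooth_differentiable by (intro csm_0I) (auto intro!: differentiable_inverse)
next
  case (Suc n)
  have p: "pdiff j (\<lambda>x. inverse (f x)) = (\<lambda>x. pdiff j f x * (- (inverse (f x) * inverse (f x))))" for j
    by (rule ext) (simp add: pdiff_inverse assms power2_eq_square)
  have "csm n (\<lambda>x. - (inverse (f x) * inverse (f x)))"
    by (intro csm_linear[OF bounded_linear_minus[OF bounded_linear_ident]] csm_bilinear[OF bounded_bilinear_mult] Suc)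
  then have "csm n (\<lambda>x. pdiff j f x * (- (inverse (f x) * inverse (f x))))" for j
    using smooth_pdiff[OF assms(2)]
    by (intro csm_bilinear[OF bounded_bilinear_mult]) (auto simp: smooth_iff_csm)
  moreover have "(\<lambda>x. inverse (f x)) differentiable (at x)" for x
    using assms smooth_differentiable by (auto intro!: differentiable_inverse)
  ultimately show ?case
    by (intro csm_SucI) (auto simp: p)
qed

lemma smooth_inverse: "(\<And>x. f x \<noteq> (0::real)) \<Longrightarrow> smooth f \<Longrightarrow> smooth (\<lambda>x. inverse (f x))"
  by (simp add: smooth_iff_csm csm_inverse)

lemma pdiff_arctan:
  assumes "smooth f"
  shows "pdiff j (\<lambda>x. arctan (f x)) x = pdiff j f x * inverse (1 + (f x)\<^sup>2)"
  using pdiff_compose_real[OF smooth_differentiable[OF assms]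
      DERIV_arctan[unfolded has_real_derivative_iff_has_vector_derivative]]
  by simp

lemma smooth_arctan [intro]:
  assumes "smooth f" shows "smooth (\<lambda>x. arctan (f x))"
proof -
  have "csm n (\<lambda>x. arctan (f x))" for n
  proof -
    have d: "(\<lambda>x. arctan (f x)) differentiable (at x)" for x
      using differentiable_compose_real[OF smooth_differentiable[OF assms]
          DERIV_arctan[unfolded has_real_derivative_iff_has_vector_derivative]] .
    have "1 + (f x)\<^sup>2 \<noteq> 0" for x
      by (smt (verit) zero_le_power2)
    \<comment> \<open>One differentiation removes the arctangent, so no induction on the order is
      needed.\<close>
    then have "smooth (\<lambda>x. pdiff j f x * inverse (1 + (f x)\<^sup>2))" for j
      using assms by (intro smooth_mult smooth_inverse smooth_pdiff smooth_add) auto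
    then have "csm m (pdiff j (\<lambda>x. arctan (f x)))" for j m
      unfolding pdiff_arctan[OF assms, abs_def] smooth_iff_csm by blast
    then show ?thesis
      using d by (cases n) (auto intro!: csm_SucI csm_0I simp del: csm.simps)
  qed
  then show ?thesis by (simp add: smooth_iff_csm)
qed

subsection \<open>Test functions\<close>

lemma second_difference_mvt:
  fixes f :: "real^'n::finite \<Rightarrow> real"
  assumes "smooth f" "0 < s"
  obtains \<xi> \<eta> where "0 < \<xi>" "\<xi> < s" "0 < \<eta>" "\<eta> < s"
    "f (x + s *\<^sub>R axis i 1 + s *\<^sub>R axis j 1) - f (x + s *\<^sub>R axis i 1) - f (x + s *\<^sub>R axis j 1) + f x
      = s\<^sup>2 * pdiff j (pdiff i f) (x + \<xi> *\<^sub>R axis i 1 + \<eta> *\<^sub>R axis j 1)"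
proof -
  \<comment> \<open>The increment in direction \<open>j\<close>, as a function along direction
    \<open>i\<close>; the order of these two choices fixes the order of the derivatives in the
    result.\<close>
  define g where "g t = f ((x + s *\<^sub>R axis j 1) + t *\<^sub>R axis i 1) - f (x + t *\<^sub>R axis i 1)" for t
  have "(g has_real_derivative
      pdiff i f ((x + s *\<^sub>R axis j 1) + t *\<^sub>R axis i 1) - pdiff i f (x + t *\<^sub>R axis i 1)) (at t)" for t
    unfolding g_def has_real_derivative_iff_has_vector_derivative
    by (intro has_vector_derivative_diff pdiff_line smooth_differentiable assms)
  from MVT2[OF \<open>0 < s\<close> this] obtain \<xi> where \<xi>: "0 < \<xi>" "\<xi> < s"
    "g s - g 0 = s * (pdiff i f ((x + s *\<^sub>R axis j 1) + \<xi> *\<^sub>R axis i 1) - pdiff i f (x + \<xi> *\<^sub>R axis i 1))"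
    by (metis diff_zero)
  have "((\<lambda>t. pdiff i f ((x + \<xi> *\<^sub>R axis i 1) + t *\<^sub>R axis j 1)) has_real_derivative
      pdiff j (pdiff i f) ((x + \<xi> *\<^sub>R axis i 1) + t *\<^sub>R axis j 1)) (at t)" for t
    unfolding has_real_derivative_iff_has_vector_derivative
    by (intro pdiff_line smooth_differentiable smooth_pdiff assms)
  from MVT2[OF \<open>0 < s\<close> this] obtain \<eta> where \<eta>: "0 < \<eta>" "\<eta> < s"
    "pdiff i f ((x + \<xi> *\<^sub>R axis i 1) + s *\<^sub>R axis j 1) - pdiff i f (x + \<xi> *\<^sub>R axis i 1)
      = s * pdiff j (pdiff i f) ((x + \<xi> *\<^sub>R axis i 1) + \<eta> *\<^sub>R axis j 1)"
    by auto
  show thesis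
    using \<xi> \<eta> by (intro that[of \<xi> \<eta>]) (simp_all add: g_def power2_eq_square algebra_simps)
qed

text \<open>The second difference over a square of side \<open>s\<close> is symmetric in
  \<open>i\<close> and \<open>j\<close>, yet by \<open>second_difference_mvt\<close> it is
  \<open>s\<^sup>2\<close> times either mixed derivative at some point near \<open>x\<close>.
  Continuity then identifies the two.\<close>

lemma pdiff_commute_real:
  fixes f :: "real^'n::finite \<Rightarrow> real"
  assumes "smooth f"
  shows "pdiff i (pdiff j f) x = pdiff j (pdiff i f) x"
proof -
  define h where "h y = pdiff i (pdiff j f) y" for y
  define k where "k y = pdiff j (pdiff i f) y" for y
  have "smooth h" "smooth k"
    unfolding h_def k_def by (intro smooth_pdiff assms)+
  then have c: "continuous (at x) h" "continuous (at x) k"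
    using smooth_continuous continuous_on_eq_continuous_at open_UNIV by blast+
  have "dist (h x) (k x) < e" if "e > 0" for e
  proof -
    obtain d1 where d1: "d1 > 0" "\<And>y. dist y x < d1 \<Longrightarrow> dist (h y) (h x) < e / 2"
      using c(1) \<open>e > 0\<close> unfolding continuous_at_eps_delta by (metis half_gt_zero)
    obtain d2 where d2: "d2 > 0" "\<And>y. dist y x < d2 \<Longrightarrow> dist (k y) (k x) < e / 2"
      using c(2) \<open>e > 0\<close> unfolding continuous_at_eps_delta by (metis half_gt_zero)
    \<comment> \<open>The intermediate points are reached from \<open>x\<close> by two steps shorter
      than \<open>s\<close>, hence the half.\<close>
    define s where "s = min d1 d2 / 2"
    have s: "0 < s" using d1 d2 by (simp add: s_def)
    have near: "dist (x + a *\<^sub>R axis l 1 + b *\<^sub>R axis m 1) x < min d1 d2"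
      if "0 < a" "a < s" "0 < b" "b < s" for a b and l m :: 'n
    proof -
      have "norm (a *\<^sub>R axis l (1::real) + b *\<^sub>R axis m 1) \<le> a + b"
        using norm_triangle_ineq[of "a *\<^sub>R axis l (1::real)" "b *\<^sub>R axis m 1"] that by simp
      also have "\<dots> < min d1 d2" using that by (simp add: s_def)
      finally show ?thesis by (simp add: dist_norm add.assoc)
    qed
    obtain a b where ab: "0 < a" "a < s" "0 < b" "b < s"
      "f (x + s *\<^sub>R axis i 1 + s *\<^sub>R axis j 1) - f (x + s *\<^sub>R axis i 1) - f (x + s *\<^sub>R axis j 1) + f x
        = s\<^sup>2 * k (x + a *\<^sub>R axis i 1 + b *\<^sub>R axis j 1)"
      using second_difference_mvt[OF assms s] unfolding k_def by metis
    obtain a' b' where ab': "0 < a'" "a' < s" "0 < b'" "b' < s"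
      "f (x + s *\<^sub>R axis j 1 + s *\<^sub>R axis i 1) - f (x + s *\<^sub>R axis j 1) - f (x + s *\<^sub>R axis i 1) + f x
        = s\<^sup>2 * h (x + a' *\<^sub>R axis j 1 + b' *\<^sub>R axis i 1)"
      using second_difference_mvt[OF assms s] unfolding h_def by metis
    have "x + s *\<^sub>R axis i 1 + s *\<^sub>R axis j 1 = x + s *\<^sub>R axis j 1 + s *\<^sub>R axis i 1"
      by (simp add: algebra_simps)
    note e = ab(5)[unfolded this]
    have "s\<^sup>2 * h (x + a' *\<^sub>R axis j 1 + b' *\<^sub>R axis i 1) = s\<^sup>2 * k (x + a *\<^sub>R axis i 1 + b *\<^sub>R axis j 1)"
      using e ab'(5) by linarith
    then have "h (x + a' *\<^sub>R axis j 1 + b' *\<^sub>R axis i 1) = k (x + a *\<^sub>R axis i 1 + b *\<^sub>R axis j 1)"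
      using s by (metis mult_left_cancel less_irrefl zero_eq_power2)
    moreover have "dist (h (x + a' *\<^sub>R axis j 1 + b' *\<^sub>R axis i 1)) (h x) < e / 2"
      using near[OF ab'(1-4)] d1(2) by simp
    moreover have "dist (k (x + a *\<^sub>R axis i 1 + b *\<^sub>R axis j 1)) (k x) < e / 2"
      using near[OF ab(1-4)] d2(2) by simp
    ultimately show ?thesis
      by (smt (verit) dist_commute dist_triangle_half_r)
  qed
  then have "h x = k x"
    by (metis dist_nz less_irrefl)
  then show ?thesis by (simp add: h_def k_def)
qed

lemma pdiff_commute:
  fixes f :: "real^'n::finite \<Rightarrow> 'b::real_inner"
  assumes "smooth f"
  shows "pdiff i (pdiff j f) x = pdiff j (pdiff i f) x"
proof -
  have *: "pdiff i (\<lambda>y. g y \<bullet> v) = (\<lambda>y. pdiff i g y \<bullet> v)" if "smooth g" for g :: "real^'n \<Rightarrow> 'b" and v i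
    using pdiff_linear[OF bounded_linear_inner_left smooth_differentiable[OF that]] by blast
  have "pdiff i (pdiff j f) x \<bullet> v = pdiff j (pdiff i f) x \<bullet> v" for v
    using pdiff_commute_real[of "\<lambda>y. f y \<bullet> v" i j x] assms
    by (simp add: * smooth_pdiff smooth_inner)
  then show ?thesis
    by (metis inner_commute vector_eq_rdot)
qed

text \<open>The family \<open>bump_fun p\<close> is closed under differentiation, so its members are smooth.\<close>

definition bump_fun :: "real poly \<Rightarrow> real \<Rightarrow> real" where
  "bump_fun p t = (if t > 0 then poly p (1 / t) * exp (- 1 / t) else 0)"

text \<open>In the variable \<open>y = 1 / t\<close>, whose derivative is
  \<open>- y\<^sup>2\<close>, this is the product rule for \<open>p y * exp (- y)\<close>. At 0 the
  exponential beats every polynomial in \<open>1 / t\<close>.\<close>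

lemma bump_fun_deriv:
  "(bump_fun p has_real_derivative bump_fun (monom 1 2 * (p - pderiv p)) t) (at t)"
proof -
  consider "t > 0" | "t < 0" | "t = 0" by linarith
  then show ?thesis
  proof cases
    case 1
    have d: "((\<lambda>t. poly p (1 / t) * exp (- 1 / t)) has_real_derivative
        bump_fun (monom 1 2 * (p - pderiv p)) t) (at t)"
      using 1
      by (auto intro!: derivative_eq_intros poly_DERIV[THEN DERIV_chain2]
          simp: bump_fun_def poly_monom field_simps power2_eq_square)
    show ?thesis
      by (rule has_field_derivative_transform_within_open[OF d, of "{0<..}"])
        (use 1 in \<open>auto simp: bump_fun_def\<close>)
  next
    case 2
    have d: "((\<lambda>t. 0) has_real_derivative bump_fun (monom 1 2 * (p - pderiv p)) t) (at t)"
      using 2 by (auto simp: bump_fun_def)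
    show ?thesis
      by (rule has_field_derivative_transform_within_open[OF d, of "{..<0}"])
        (use 2 in \<open>auto simp: bump_fun_def\<close>)
  next
    case 3
    have mon: "((\<lambda>x::real. x ^ k * exp (- x)) \<longlongrightarrow> 0) at_top" for k
      using tendsto_power_div_exp_0[of k] by (simp add: exp_minus divide_inverse)
    have "((\<lambda>x. poly q x * exp (- x)) \<longlongrightarrow> 0) at_top" for q :: "real poly"
    proof -
      have "((\<lambda>x. \<Sum>i\<le>degree q. coeff q i * (x ^ i * exp (- x))) \<longlongrightarrow> (\<Sum>i\<le>degree q. coeff q i * 0)) at_top"
        by (intro tendsto_sum tendsto_mult_left mon)
      then show ?thesis by (simp add: poly_altdef sum_distrib_right mult.assoc)
    qed
    \<comment> \<open>The difference quotient at 0 contributes one more factor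
      \<open>1 / h\<close>.\<close>
    from this[of "monom 1 1 * p"] have "((\<lambda>x. x * poly p x * exp (- x)) \<longlongrightarrow> 0) at_top"
      by (simp add: poly_monom)
    then have "((\<lambda>h. inverse h * poly p (inverse h) * exp (- inverse h)) \<longlongrightarrow> 0) (at_right 0)"
      by (rule filterlim_compose[OF _ filterlim_inverse_at_top_right])
    then have "((\<lambda>h. bump_fun p h / h) \<longlongrightarrow> 0) (at_right 0)"
      by (rule Lim_transform_eventually)
        (auto simp: bump_fun_def divide_inverse mult_ac
          intro!: eventually_mono[OF eventually_at_right_less])
    moreover have "((\<lambda>h. bump_fun p h / h) \<longlongrightarrow> 0) (at_left 0)"
      by (rule tendsto_eventually)
        (auto simp: bump_fun_def eventually_at_filter)
    ultimately have "((\<lambda>h. bump_fun p h / h) \<longlongrightarrow> 0) (at 0)"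
      using filterlim_split_at by blast
    then show ?thesis
      using 3 by (simp add: has_field_derivative_def DERIV_def[unfolded has_field_derivative_def] bump_fun_def DERIV_def)
  qed
qed

lemma smooth_bump_fun:
  assumes "smooth q" shows "smooth (\<lambda>x. bump_fun p (q x))"
proof -
  define \<psi> where "\<psi> k = bump_fun (((\<lambda>p. monom 1 2 * (p - pderiv p)) ^^ k) p)" for k
  have "(\<psi> k has_vector_derivative \<psi> (Suc k) t) (at t)" for k t
    using bump_fun_deriv by (simp add: \<psi>_def has_real_derivative_iff_has_vector_derivative[symmetric])
  from smooth_compose_real[of \<psi>, OF this assms, of 0]
  show ?thesis by (simp add: \<psi>_def)
qed

text \<open>The factor \<open>exp 1\<close> normalises the value at 0 to 1, so that the cutoffs
  \<open>bump (\<epsilon> *\<^sub>R x)\<close> tend to 1 as \<open>\<epsilon>\<close> tends to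
  0.\<close>

definition bump :: "real^'n::finite \<Rightarrow> real" where
  "bump x = exp 1 * bump_fun 1 (1 - x \<bullet> x)"

lemma smooth_id [intro!, simp]: "smooth (\<lambda>x. x)"
proof -
  have "csm n (\<lambda>x::real^'a. x)" for n
  proof (cases n)
    case (Suc m)
    have "pdiff j (\<lambda>x::real^'a. x) = (\<lambda>x. axis j 1)" for j
      by (rule ext, rule pdiff_eqI) (rule has_derivative_ident)
    with Suc show ?thesis by (simp add: csm_const)
  qed simp
  then show ?thesis by (simp add: smooth_iff_csm)
qed

lemma smooth_bump: "smooth bump"
  unfolding bump_def[abs_def] by (intro smooth_mult smooth_bump_fun smooth_diff smooth_inner) auto

lemma bump_0 [simp]: "bump 0 = 1"
  by (simp add: bump_def bump_fun_def exp_minus)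

lemma bump_eq_0: "norm x \<ge> 1 \<Longrightarrow> bump x = 0"
  using power_mono[of 1 "norm x" 2] by (simp add: bump_def bump_fun_def dot_square_norm not_less)

section \<open>Compactly supported functions\<close>

lemma pdiff_eq_0_outside:
  assumes "closed K" "\<And>x. x \<notin> K \<Longrightarrow> f x = 0" "x \<notin> K"
  shows "pdiff j f x = 0"
proof -
  have "eventually (\<lambda>y. f y = 0) (nhds x)"
    using assms by (intro eventually_mono[OF eventually_nhds_in_open[of "- K" x]]) auto
  then have "(f has_derivative (\<lambda>_. 0)) (at x)"
    using has_derivative_transform_eventually[of "\<lambda>_. 0" "\<lambda>_. 0" x UNIV f] assms
    by (auto simp: eventually_nhds_conv_at elim!: eventually_mono)
  from pdiff_eqI[OF this] show ?thesis .
qed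

lemma outside_supp: "x \<notin> supp f \<Longrightarrow> f x = 0"
  using closure_subset[of "{x. f x \<noteq> 0}"] by (auto simp: supp_def)

lemma test_funI:
  assumes "smooth f" "compact K" "\<And>x. x \<notin> K \<Longrightarrow> f x = 0"
  shows "test_fun f"
proof -
  have "supp f \<subseteq> K"
    unfolding supp_def
  proof (rule closure_minimal)
    show "{x. f x \<noteq> 0} \<subseteq> K"
    proof
      fix x assume "x \<in> {x. f x \<noteq> 0}"
      then show "x \<in> K" using assms(3)[of x] by auto
    qed
    show "closed K" using assms(2) by (rule compact_imp_closed)
  qed
  then have "compact (supp f)"
    using assms(2) compact_Int_closed[of K "supp f"] by (simp add: supp_def inf.absorb2)
  with assms(1) show ?thesis by (simp add: test_fun_def)
qed

lemma test_fun_compact: "test_fun f \<Longrightarrow> compact (supp f)"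
  by (simp add: test_fun_def)

lemma test_fun_smooth: "test_fun f \<Longrightarrow> smooth f"
  by (simp add: test_fun_def)

lemma test_fun_pdiff:
  assumes "test_fun f" shows "test_fun (pdiff j f)"
  by (rule test_funI[OF smooth_pdiff[OF test_fun_smooth[OF assms]] test_fun_compact[OF assms]])
    (rule pdiff_eq_0_outside[OF compact_imp_closed[OF test_fun_compact[OF assms]] outside_supp[of _ f]])

lemma test_fun_add:
  assumes "test_fun f" "test_fun g" shows "test_fun (\<lambda>x. f x + g x)"
proof (rule test_funI[of _ "supp f \<union> supp g"])
  show "smooth (\<lambda>x. f x + g x)"
    by (intro smooth_add test_fun_smooth assms)
  show "compact (supp f \<union> supp g)"
    by (intro compact_Un test_fun_compact assms)
  show "f x + g x = 0" if "x \<notin> supp f \<union> supp g" for x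
    using that outside_supp[of x f] outside_supp[of x g] by simp
qed

lemma test_fun_bilinear:
  assumes "bounded_bilinear prd" "smooth f" "test_fun g"
  shows "test_fun (\<lambda>x. prd (f x) (g x))"
  by (rule test_funI[OF smooth_bilinear[OF assms(1,2) test_fun_smooth[OF assms(3)]] test_fun_compact[OF assms(3)]])
    (simp add: outside_supp[of _ g] bounded_bilinear.zero_right[OF assms(1)])

lemma test_fun_mult:
  fixes f g :: "real^'n::finite \<Rightarrow> 'b::real_normed_algebra"
  shows "smooth f \<Longrightarrow> test_fun g \<Longrightarrow> test_fun (\<lambda>x. f x * g x)"
  by (rule test_fun_bilinear[OF bounded_bilinear_mult])

lemma test_fun_scaleR: "smooth f \<Longrightarrow> test_fun g \<Longrightarrow> test_fun (\<lambda>x. f x *\<^sub>R g x)"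
  by (rule test_fun_bilinear[OF bounded_bilinear_scaleR])

lemma test_fun_bounded:
  assumes "test_fun f" shows "\<exists>C. \<forall>x. norm (f x) \<le> C"
proof -
  define K where "K = supp f"
  have K: "compact K" "\<And>x. x \<notin> K \<Longrightarrow> f x = 0"
    using test_fun_compact[OF assms] outside_supp[of _ f] by (simp_all add: K_def)
  have "compact (f ` K)"
    using K assms by (intro compact_continuous_image smooth_continuous test_fun_smooth)
  then obtain C where C: "\<And>y. y \<in> f ` K \<Longrightarrow> norm y \<le> C"
    using compact_imp_bounded bounded_iff by metis
  have "norm (f x) \<le> max C 0" for x
    using C[of "f x"] K(2)[of x] by (cases "x \<in> K") auto
  then show ?thesis by blast
qed

lemma test_fun_integrable:
  fixes f :: "real^'n::finite \<Rightarrow> 'b::{banach, second_countable_topology}"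
  assumes "test_fun f" shows "integrable lborel f"
proof -
  define K where "K = supp f"
  have K: "compact K" "\<And>x. x \<notin> K \<Longrightarrow> f x = 0"
    using test_fun_compact[OF assms] outside_supp[of _ f] by (simp_all add: K_def)
  have "set_integrable lborel K f"
    unfolding set_integrable_def
    by (intro borel_integrable_compact K smooth_continuous test_fun_smooth assms)
  moreover have "(\<lambda>x. indicator K x *\<^sub>R f x) = f"
    using K by (auto simp: indicator_def)
  ultimately show ?thesis by (simp add: set_integrable_def)
qed

text \<open>By translation invariance all difference quotients have integral zero.\<close>

lemma integral_pdiff:
  fixes f :: "real^'n::finite \<Rightarrow> real"
  assumes "test_fun f" shows "(LINT x|lborel. pdiff j f x) = 0"
proof -
  note sm = test_fun_smooth[OF assms]
  obtain C where C: "\<And>x. norm (pdiff j f x) \<le> C"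
    using test_fun_bounded[OF test_fun_pdiff[OF assms]] by blast
  define K where "K = supp f"
  have K: "compact K" "\<And>x. x \<notin> K \<Longrightarrow> f x = 0"
    using test_fun_compact[OF assms] outside_supp[of _ f] by (simp_all add: K_def)
  obtain R where R: "\<And>x. x \<in> K \<Longrightarrow> norm x \<le> R"
    using compact_imp_bounded[OF K(1)] bounded_iff by metis
  have f: "continuous_on UNIV f" using sm by (rule smooth_continuous)
  define q where "q m x = real (Suc m) * (f (x + (1 / real (Suc m)) *\<^sub>R axis j 1) - f x)" for m x
  have fm [measurable]: "f \<in> borel_measurable borel" using f by (rule borel_measurable_continuous_onI)
  \<comment> \<open>The shift has length at most 1, so the quotients vanish beyond radius
    \<open>R + 1\<close>; elsewhere the mean value theorem makes them values of the
    derivative.\<close>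
  have qb: "norm (q m x) \<le> indicator (cball 0 (R + 1)) x * C" for m x
  proof (cases "norm x \<le> R + 1")
    case False
    have "norm (x + (1 / real (Suc m)) *\<^sub>R axis j 1) \<ge> norm x - norm ((1 / real (Suc m)) *\<^sub>R axis j (1::real))"
      by (rule norm_diff_ineq)
    moreover have "norm ((1 / real (Suc m)) *\<^sub>R axis j (1::real)) \<le> 1"
      by (simp add: divide_le_eq_1)
    ultimately have "norm (x + (1 / real (Suc m)) *\<^sub>R axis j 1) > R" "norm x > R"
      using False by linarith+
    then have "x + (1 / real (Suc m)) *\<^sub>R axis j 1 \<notin> K" "x \<notin> K"
      using R leD by blast+
    then have "q m x = 0"
      by (simp add: q_def K(2) del: of_nat_Suc)
    with False show ?thesis by simp
  next
    case True
    have d: "((\<lambda>t. f (x + t *\<^sub>R axis j 1)) has_real_derivative pdiff j f (x + t *\<^sub>R axis j 1)) (at t)" for t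
      unfolding has_real_derivative_iff_has_vector_derivative
      by (rule pdiff_line[OF smooth_differentiable[OF sm]])
    obtain t where "f (x + (1 / real (Suc m)) *\<^sub>R axis j 1) - f (x + 0 *\<^sub>R axis j 1)
        = (1 / real (Suc m) - 0) * pdiff j f (x + t *\<^sub>R axis j 1)"
      using MVT2[OF _ d, of 0 "1 / real (Suc m)"] by auto
    then have "q m x = pdiff j f (x + t *\<^sub>R axis j 1)"
      by (simp add: q_def)
    with True C show ?thesis by simp
  qed
  have qm: "q m \<in> borel_measurable lborel" for m
    unfolding q_def[abs_def] by measurable
  have lim: "(\<lambda>m. q m x) \<longlonglongrightarrow> pdiff j f x" for x
  proof -
    have "((\<lambda>t. f (x + t *\<^sub>R axis j 1)) has_real_derivative pdiff j f (x + 0 *\<^sub>R axis j 1)) (at 0)"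
      unfolding has_real_derivative_iff_has_vector_derivative
      by (rule pdiff_line[OF smooth_differentiable[OF sm]])
    then have "((\<lambda>h. (f (x + h *\<^sub>R axis j 1) - f x) / h) \<longlongrightarrow> pdiff j f x) (at 0)"
      by (simp add: DERIV_def)
    moreover have "filterlim (\<lambda>m. 1 / real (Suc m)) (at 0) sequentially"
      unfolding filterlim_at using LIMSEQ_inverse_real_of_nat by (auto simp: divide_inverse)
    ultimately have "(\<lambda>m. (f (x + (1 / real (Suc m)) *\<^sub>R axis j 1) - f x) / (1 / real (Suc m))) \<longlonglongrightarrow> pdiff j f x"
      by (rule filterlim_compose)
    then show ?thesis unfolding q_def by (simp add: mult.commute)
  qed
  have "(\<lambda>m. LINT x|lborel. q m x) \<longlonglongrightarrow> (LINT x|lborel. pdiff j f x)"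
  proof (rule integral_dominated_convergence[where w = "\<lambda>x. indicator (cball 0 (R + 1)) x * C"])
    show "pdiff j f \<in> borel_measurable lborel"
      using smooth_continuous[OF smooth_pdiff[OF sm]] by (simp add: borel_measurable_continuous_onI)
    show "integrable lborel (\<lambda>x::real^'n. indicator (cball 0 (R + 1)) x * C)"
      by (intro integrable_mult_left integrable_real_indicator) (use emeasure_bounded_finite[of "cball (0::real^'n) (R + 1)"] in \<open>auto simp: less_top\<close>)
    show "q m \<in> borel_measurable lborel" for m by (rule qm)
    show "AE x in lborel. norm (q m x) \<le> indicator (cball 0 (R + 1)) x * C" for m
      using qb by (intro AE_I2)
  qed (simp add: lim)
  moreover have "(LINT x|lborel. q m x) = 0" for m
  proof -
    define c :: "real^'n" where "c = (1 / real (Suc m)) *\<^sub>R axis j 1"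
    note fi = test_fun_integrable[OF assms]
    have "integrable (distr lborel borel ((+) c)) f"
      using fi by (simp only: lborel_distr_plus)
    then have "integrable lborel (\<lambda>x. f (c + x))"
      by (subst (asm) integrable_distr_eq) auto
    moreover have "(LINT x|lborel. f (c + x)) = (LINT x|distr lborel borel ((+) c). f x)"
      by (rule integral_distr[symmetric]) auto
    then have "(LINT x|lborel. f (c + x)) = (LINT x|lborel. f x)"
      by (simp only: lborel_distr_plus)
    ultimately show ?thesis
      using fi unfolding q_def c_def[symmetric] by (simp add: add.commute)
  qed
  ultimately show ?thesis by (simp add: LIMSEQ_const_iff)
qed

subsection \<open>The Hilbert space of square integrable functions\<close>

lemma L2_measurable: "u \<in> L2 \<Longrightarrow> u \<in> borel_measurable borel"
  and L2_integrable: "u \<in> L2 \<Longrightarrow> integrable lborel (\<lambda>x. (cmod (u x))\<^sup>2)"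
  by (auto simp: L2_def)

lemma L2_bound:
  assumes "u \<in> L2" "v \<in> borel_measurable borel" "\<And>x. cmod (v x) \<le> C * cmod (u x)"
  shows "v \<in> L2"
proof -
  have "integrable lborel (\<lambda>x. C\<^sup>2 * (cmod (u x))\<^sup>2)"
    using L2_integrable[OF assms(1)] by simp
  then have "integrable lborel (\<lambda>x. (cmod (v x))\<^sup>2)"
  proof (rule Bochner_Integration.integrable_bound)
    show "(\<lambda>x. (cmod (v x))\<^sup>2) \<in> borel_measurable lborel"
      using assms(2) by simp
    have "(cmod (v x))\<^sup>2 \<le> (C * cmod (u x))\<^sup>2" for x
      by (intro power_mono assms(3)) simp
    then show "AE x in lborel. norm ((cmod (v x))\<^sup>2) \<le> norm (C\<^sup>2 * (cmod (u x))\<^sup>2)"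
      by (simp add: power_mult_distrib)
  qed
  with assms(2) show ?thesis by (simp add: L2_def)
qed

lemma L2_add:
  assumes "u \<in> L2" "v \<in> L2" shows "(\<lambda>x. u x + v x) \<in> L2"
proof -
  note [measurable] = L2_measurable[OF assms(1)] L2_measurable[OF assms(2)]
  have "integrable lborel (\<lambda>x. 2 * (cmod (u x))\<^sup>2 + 2 * (cmod (v x))\<^sup>2)"
    using L2_integrable assms by simp
  then have "integrable lborel (\<lambda>x. (cmod (u x + v x))\<^sup>2)"
  proof (rule Bochner_Integration.integrable_bound)
    have "(cmod (u x + v x))\<^sup>2 \<le> 2 * (cmod (u x))\<^sup>2 + 2 * (cmod (v x))\<^sup>2" for x
    proof -
      have "(cmod (u x + v x))\<^sup>2 \<le> (cmod (u x) + cmod (v x))\<^sup>2"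
        by (intro power_mono norm_triangle_ineq) simp
      also have "\<dots> \<le> 2 * (cmod (u x))\<^sup>2 + 2 * (cmod (v x))\<^sup>2"
        using zero_le_power2[of "cmod (u x) - cmod (v x)"] by (simp add: power2_sum power2_diff)
      finally show ?thesis .
    qed
    then show "AE x in lborel. norm ((cmod (u x + v x))\<^sup>2) \<le> norm (2 * (cmod (u x))\<^sup>2 + 2 * (cmod (v x))\<^sup>2)"
      by simp
    show "(\<lambda>x. (cmod (u x + v x))\<^sup>2) \<in> borel_measurable lborel" by measurable
  qed
  then show ?thesis by (simp add: L2_def)
qed

lemma L2_zero: "(\<lambda>x. 0) \<in> L2"
  by (simp add: L2_def)

lemma L2_scaleR: "u \<in> L2 \<Longrightarrow> (\<lambda>x. c *\<^sub>R u x) \<in> L2"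
  by (rule L2_bound[of u _ "\<bar>c\<bar>"]) (auto dest: L2_measurable)

lemma L2_cmult: "u \<in> L2 \<Longrightarrow> (\<lambda>x. c * u x) \<in> L2"
  by (rule L2_bound[of u _ "cmod c"]) (auto dest: L2_measurable simp: norm_mult)

lemma L2_minus: "u \<in> L2 \<Longrightarrow> (\<lambda>x. - u x) \<in> L2"
  using L2_scaleR[of u "- 1"] by simp

lemma L2_diff: "u \<in> L2 \<Longrightarrow> v \<in> L2 \<Longrightarrow> (\<lambda>x. u x - v x) \<in> L2"
  using L2_add[OF _ L2_minus, of u v] by simp

lemma L2_inner_integrable:
  assumes "u \<in> L2" "v \<in> L2" shows "integrable lborel (\<lambda>x. u x \<bullet> v x)"
proof -
  note [measurable] = L2_measurable[OF assms(1)] L2_measurable[OF assms(2)]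
  have "integrable lborel (\<lambda>x. (cmod (u x))\<^sup>2 + (cmod (v x))\<^sup>2)"
    using L2_integrable assms by simp
  then show ?thesis
  proof (rule Bochner_Integration.integrable_bound)
    have "\<bar>u x \<bullet> v x\<bar> \<le> (cmod (u x))\<^sup>2 + (cmod (v x))\<^sup>2" for x
    proof -
      have "\<bar>u x \<bullet> v x\<bar> \<le> cmod (u x) * cmod (v x)" by (rule Cauchy_Schwarz_ineq2)
      also have "\<dots> \<le> (cmod (u x))\<^sup>2 + (cmod (v x))\<^sup>2"
        using zero_le_power2[of "cmod (u x) - cmod (v x)"]
          mult_nonneg_nonneg[OF norm_ge_zero norm_ge_zero, of "u x" "v x"] unfolding power2_diff by linarith
      finally show ?thesis .
    qed
    then show "AE x in lborel. norm (u x \<bullet> v x) \<le> norm ((cmod (u x))\<^sup>2 + (cmod (v x))\<^sup>2)"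
      by simp
    show "(\<lambda>x. u x \<bullet> v x) \<in> borel_measurable lborel" by measurable
  qed
qed

section \<open>Equivalence classes modulo almost everywhere equality\<close>

definition L2_eq :: "(real^2 \<Rightarrow> complex) \<Rightarrow> (real^2 \<Rightarrow> complex) \<Rightarrow> bool" where
  "L2_eq u v \<longleftrightarrow> u \<in> L2 \<and> v \<in> L2 \<and> (AE x in lborel. u x = v x)"

text \<open>Only real spectral parameters occur below, so it suffices to use the real part of the complex inner
  product.\<close>

quotient_type l2 = "real^2 \<Rightarrow> complex" / partial: L2_eq
  morphisms rep_l2 cls
proof (rule part_equivpI)
  show "\<exists>u. L2_eq u u" using L2_zero by (auto simp: L2_eq_def)
  show "symp L2_eq" by (rule sympI) (auto simp: L2_eq_def)
  show "transp L2_eq" by (rule transpI) (auto simp: L2_eq_def)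
qed

instantiation l2 :: real_vector
begin

lift_definition zero_l2 :: l2 is "\<lambda>x. 0" by (simp add: L2_eq_def L2_zero)
lift_definition plus_l2 :: "l2 \<Rightarrow> l2 \<Rightarrow> l2" is "\<lambda>u v x. u x + v x"
  by (auto simp: L2_eq_def L2_add)
lift_definition minus_l2 :: "l2 \<Rightarrow> l2 \<Rightarrow> l2" is "\<lambda>u v x. u x - v x"
  by (auto simp: L2_eq_def L2_diff)
lift_definition uminus_l2 :: "l2 \<Rightarrow> l2" is "\<lambda>u x. - u x"
  by (auto simp: L2_eq_def L2_minus)
lift_definition scaleR_l2 :: "real \<Rightarrow> l2 \<Rightarrow> l2" is "\<lambda>c u x. c *\<^sub>R u x"
  by (auto simp: L2_eq_def L2_scaleR)

instance
  by standard (transfer; simp add: L2_eq_def L2_add L2_zero L2_minus L2_diff L2_scaleR algebra_simps)+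

end

instantiation l2 :: real_inner
begin

lift_definition inner_l2 :: "l2 \<Rightarrow> l2 \<Rightarrow> real" is "\<lambda>u v. LINT x|lborel. u x \<bullet> v x"
proof (rule integral_cong_AE)
  fix u u' v v' assume a: "L2_eq u u'" "L2_eq v v'"
  then have [measurable]: "u \<in> borel_measurable borel" "u' \<in> borel_measurable borel"
      "v \<in> borel_measurable borel" "v' \<in> borel_measurable borel"
    by (auto simp: L2_eq_def dest: L2_measurable)
  show "(\<lambda>x. u x \<bullet> v x) \<in> borel_measurable lborel" "(\<lambda>x. u' x \<bullet> v' x) \<in> borel_measurable lborel"
    by measurable
  show "AE x in lborel. u x \<bullet> v x = u' x \<bullet> v' x"
    using a by (auto simp: L2_eq_def)
qed

definition norm_l2 :: "l2 \<Rightarrow> real" where "norm_l2 x = sqrt (x \<bullet> x)"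
definition dist_l2 :: "l2 \<Rightarrow> l2 \<Rightarrow> real" where "dist_l2 x y = norm (x - y)"
definition sgn_l2 :: "l2 \<Rightarrow> l2" where "sgn_l2 x = x /\<^sub>R norm x"
definition uniformity_l2 :: "(l2 \<times> l2) filter"
  where "uniformity_l2 = (INF e\<in>{0<..}. principal {(x, y). dist x y < e})"
definition open_l2 :: "l2 set \<Rightarrow> bool"
  where "open_l2 U \<longleftrightarrow> (\<forall>x\<in>U. \<forall>\<^sub>F (x', y) in uniformity. x' = x \<longrightarrow> y \<in> U)"

instance
proof
  fix x y z :: l2 and a b :: real and U :: "l2 set"
  show "dist x y = norm (x - y)" "sgn x = x /\<^sub>R norm x" "norm x = sqrt (x \<bullet> x)"
    "uniformity = (INF e\<in>{0<..}. principal {(x::l2, y). dist x y < e})"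
    "open U \<longleftrightarrow> (\<forall>x\<in>U. \<forall>\<^sub>F (x', y) in uniformity. x' = x \<longrightarrow> y \<in> U)"
    by (simp_all only: dist_l2_def sgn_l2_def norm_l2_def uniformity_l2_def open_l2_def)
  show "x \<bullet> y = y \<bullet> x"
    by transfer (simp add: inner_commute)
  show "(x + y) \<bullet> z = x \<bullet> z + y \<bullet> z"
    by transfer (simp add: L2_eq_def inner_add_left L2_inner_integrable)
  show "(a *\<^sub>R x) \<bullet> y = a * (x \<bullet> y)"
    by transfer simp
  show "0 \<le> x \<bullet> x"
    by transfer simp
  show "x \<bullet> x = 0 \<longleftrightarrow> x = 0"
  proof transfer
    fix u assume "L2_eq u u"
    then have u: "u \<in> L2" by (simp add: L2_eq_def)
    have "(LINT x|lborel. u x \<bullet> u x) = 0 \<longleftrightarrow> (AE x in lborel. u x \<bullet> u x = 0)"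
      using L2_inner_integrable[OF u u] by (intro integral_nonneg_eq_0_iff_AE) auto
    then show "(LINT x|lborel. u x \<bullet> u x) = 0 \<longleftrightarrow> L2_eq u (\<lambda>x. 0)"
      using u L2_zero by (simp add: L2_eq_def)
  qed
qed

end

lemma cls_rep: "rep_l2 X \<in> L2" "cls (rep_l2 X) = X"
  using Quotient_rep_reflp[OF Quotient_l2, of X] Quotient_abs_rep[OF Quotient_l2, of X]
  by (auto simp: L2_eq_def)

lemma l2_cases [cases type: l2]: obtains u where "u \<in> L2" "X = cls u"
  using cls_rep[of X] by (rule_tac that[of "rep_l2 X"]) simp_all

lemma cls_eq_iff: "u \<in> L2 \<Longrightarrow> v \<in> L2 \<Longrightarrow> cls u = cls v \<longleftrightarrow> (AE x in lborel. u x = v x)"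
  using Quotient_rel[OF Quotient_l2, of u v] by (auto simp: L2_eq_def)

lemma
  assumes "u \<in> L2" "v \<in> L2"
  shows cls_add: "cls (\<lambda>x. u x + v x) = cls u + cls v"
    and cls_diff: "cls (\<lambda>x. u x - v x) = cls u - cls v"
    and inner_cls: "cls u \<bullet> cls v = (LINT x|lborel. u x \<bullet> v x)"
  using assms by (auto simp: plus_l2.abs_eq minus_l2.abs_eq inner_l2.abs_eq L2_eq_def)

lemma
  assumes "u \<in> L2"
  shows cls_scaleR: "cls (\<lambda>x. c *\<^sub>R u x) = c *\<^sub>R cls u"
    and cls_cmult_of_real: "cls (\<lambda>x. complex_of_real c * u x) = c *\<^sub>R cls u"
proof -
  have u: "L2_eq u u" using assms by (simp add: L2_eq_def)
  show "cls (\<lambda>x. c *\<^sub>R u x) = c *\<^sub>R cls u"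
    by (simp only: scaleR_l2.abs_eq[OF u])
  then show "cls (\<lambda>x. complex_of_real c * u x) = c *\<^sub>R cls u"
    by (simp only: scaleR_conv_of_real)
qed

lemma norm_cls: "u \<in> L2 \<Longrightarrow> norm (cls u) = L2norm u"
  by (simp only: norm_l2_def inner_cls L2norm_def power2_norm_eq_inner)

lemma cls_zero: "cls (\<lambda>x. 0) = 0"
  by (simp add: zero_l2.abs_eq)

lemma norm_cls_le:
  assumes "u \<in> L2" "v \<in> L2" "\<And>x. cmod (u x) \<le> cmod (v x)"
  shows "norm (cls u) \<le> norm (cls v)"
proof -
  have "(LINT x|lborel. (cmod (u x))\<^sup>2) \<le> (LINT x|lborel. (cmod (v x))\<^sup>2)"
    by (intro integral_mono L2_integrable assms(1,2) power_mono assms(3)) simp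
  then show ?thesis
    unfolding norm_cls[OF assms(1)] norm_cls[OF assms(2)] L2norm_def by simp
qed

lemma L2_cmod: "u \<in> L2 \<Longrightarrow> (\<lambda>x. complex_of_real (cmod (u x))) \<in> L2"
  by (rule L2_bound[of u _ 1]) (auto dest: L2_measurable)

lemma L2_sum: "(\<And>i. i \<in> I \<Longrightarrow> u i \<in> L2) \<Longrightarrow> (\<lambda>x. \<Sum>i\<in>I. u i x) \<in> L2"
  by (induction I rule: infinite_finite_induct) (auto simp: L2_zero L2_add)

lemma cls_sum: "(\<And>i. i \<in> I \<Longrightarrow> u i \<in> L2) \<Longrightarrow> cls (\<lambda>x. \<Sum>i\<in>I. u i x) = (\<Sum>i\<in>I. cls (u i))"
  by (induction I rule: infinite_finite_induct) (auto simp: cls_zero cls_add L2_sum)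

lemma nn_integral_L2: "u \<in> L2 \<Longrightarrow> (\<integral>\<^sup>+x. ennreal ((cmod (u x))\<^sup>2) \<partial>lborel) = ennreal ((norm (cls u))\<^sup>2)"
  by (subst nn_integral_eq_integral) (auto simp: L2_integrable norm_cls L2norm_def)

text \<open>Membership and norm bound come together, since a limit controlled by Fatou's lemma is
  not known beforehand to be square integrable.\<close>

lemma L2_nn_integral_le:
  assumes "u \<in> borel_measurable borel" "(\<integral>\<^sup>+x. ennreal ((cmod (u x))\<^sup>2) \<partial>lborel) \<le> ennreal (c\<^sup>2)" "0 \<le> c"
  shows "u \<in> L2" "norm (cls u) \<le> c"
proof -
  have "integrable lborel (\<lambda>x. (cmod (u x))\<^sup>2)"
  proof (rule integrableI_bounded)
    show "(\<lambda>x. (cmod (u x))\<^sup>2) \<in> borel_measurable lborel" using assms(1) by simp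
    show "(\<integral>\<^sup>+x. ennreal (norm ((cmod (u x))\<^sup>2)) \<partial>lborel) < \<infinity>"
      using le_less_trans[OF assms(2) ennreal_less_top] by simp
  qed
  with assms(1) show u: "u \<in> L2" by (simp add: L2_def)
  have "(norm (cls u))\<^sup>2 \<le> c\<^sup>2"
    using assms(2) unfolding nn_integral_L2[OF u] by (subst (asm) ennreal_le_iff) simp_all
  then show "norm (cls u) \<le> c"
    using assms(3) by (rule power2_le_imp_le)
qed

text \<open>Riesz-Fischer: along a fast subsequence the increments have summable norms, so the sum
  of their absolute values is square integrable and finite almost everywhere. Hence the subsequence
  converges pointwise almost everywhere, and Fatou's lemma shows that it converges to the same limit
  in norm.\<close>

instance l2 :: complete_space
proof
  fix X :: "nat \<Rightarrow> l2" assume C: "Cauchy X"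
  have "\<exists>M. \<forall>m\<ge>M. \<forall>n\<ge>M. dist (X m) (X n) < (1/2)^k" for k
    using C[unfolded Cauchy_def, rule_format, of "(1/2)^k"] by simp
  then obtain M where M: "\<And>k m n. m \<ge> M k \<Longrightarrow> n \<ge> M k \<Longrightarrow> dist (X m) (X n) < (1/2)^k"
    by metis
  \<comment> \<open>Adding \<open>k\<close> and all thresholds up to \<open>k\<close> makes
    \<open>r\<close> strictly increasing and at least \<open>M k\<close> at once.\<close>
  define r where "r k = k + (\<Sum>i\<le>k. M i)" for k
  have r: "strict_mono r" "M k \<le> r k" for k
  proof -
    show "strict_mono r" unfolding strict_mono_Suc_iff r_def by simp
    have "M k \<le> (\<Sum>i\<le>k. M i)" by (rule member_le_sum) auto
    then show "M k \<le> r k" by (simp add: r_def)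
  qed
  define u where "u k = rep_l2 (X (r k))" for k
  have u: "u k \<in> L2" "cls (u k) = X (r k)" for k
    by (simp_all add: u_def cls_rep)
  note [measurable] = L2_measurable[OF u(1)]
  have close: "norm (cls (\<lambda>x. u l x - u k x)) \<le> (1/2)^k" if "k \<le> l" for k l
    using M[of k "r l" "r k"] r(2)[of k] strict_mono_less_eq[OF r(1), of k l] that
    by (simp add: cls_diff u dist_norm)
  define S where "S K x = (\<Sum>k<K. cmod (u (Suc k) x - u k x))" for K x
  \<comment> \<open>The 4 is the square of the geometric sum 2.\<close>
  have S: "(\<integral>\<^sup>+x. ennreal ((S K x)\<^sup>2) \<partial>lborel) \<le> 4" for K
  proof -
    define d where "d k x = complex_of_real (cmod (u (Suc k) x - u k x))" for k x
    have d: "d k \<in> L2" for k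
      unfolding d_def by (intro L2_cmod L2_diff u)
    have "norm (cls (d k)) \<le> (1/2)^k" for k
    proof -
      have "norm (cls (d k)) \<le> norm (cls (\<lambda>x. u (Suc k) x - u k x))"
        by (rule norm_cls_le) (auto simp: d L2_diff u, simp add: d_def)
      with close[of k "Suc k"] show ?thesis by simp
    qed
    then have "norm (\<Sum>k<K. cls (d k)) \<le> (\<Sum>k<K. (1/2)^k)"
      by (intro sum_norm_le) auto
    also have "\<dots> \<le> (\<Sum>k. (1/2)^k)"
      by (intro sum_le_suminf) auto
    also have "\<dots> = (2::real)"
      by (simp add: suminf_geometric)
    finally have "norm (cls (\<lambda>x. \<Sum>k<K. d k x)) \<le> 2"
      by (simp add: cls_sum d)
    then have "ennreal ((norm (cls (\<lambda>x. \<Sum>k<K. d k x)))\<^sup>2) \<le> ennreal (2\<^sup>2)"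
      by (intro ennreal_leI power_mono) auto
    then have "(\<integral>\<^sup>+x. ennreal ((cmod (\<Sum>k<K. d k x))\<^sup>2) \<partial>lborel) \<le> 4"
      by (simp add: nn_integral_L2 L2_sum d)
    moreover have "cmod (\<Sum>k<K. d k x) = S K x" for x
    proof -
      have "(\<Sum>k<K. d k x) = complex_of_real (S K x)" by (simp add: d_def S_def)
      moreover have "S K x \<ge> 0" by (simp add: S_def sum_nonneg)
      ultimately show ?thesis by simp
    qed
    ultimately show ?thesis by simp
  qed
  have [measurable]: "S K \<in> borel_measurable borel" for K
    unfolding S_def by measurable
  have S_mono: "S K x \<le> S L x" if "K \<le> L" for K L x
    unfolding S_def using that by (intro sum_mono2) auto
  have S_nonneg: "0 \<le> S K x" for K x
    by (simp add: S_def sum_nonneg)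
  have "(\<integral>\<^sup>+x. (SUP K. ennreal ((S K x)\<^sup>2)) \<partial>lborel) = (SUP K. \<integral>\<^sup>+x. ennreal ((S K x)\<^sup>2) \<partial>lborel)"
    by (rule nn_integral_monotone_convergence_SUP)
      (auto simp: incseq_def le_fun_def intro!: ennreal_leI power_mono S_mono S_nonneg)
  also have "\<dots> \<le> 4"
    using S by (intro SUP_least)
  finally have "(\<integral>\<^sup>+x. (SUP K. ennreal ((S K x)\<^sup>2)) \<partial>lborel) \<noteq> \<infinity>"
    by (auto simp: top_unique)
  then have fin: "AE x in lborel. (SUP K. ennreal ((S K x)\<^sup>2)) \<noteq> \<infinity>"
    by (intro nn_integral_PInf_AE) auto
  \<comment> \<open>Where the sequence diverges the value of \<open>lim\<close> is immaterial: by
    \<open>conv\<close> this is a null set.\<close>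
  define w where "w x = lim (\<lambda>k. u k x)" for x
  have [measurable]: "w \<in> borel_measurable borel"
    unfolding w_def by measurable
  have conv: "AE x in lborel. (\<lambda>k. u k x) \<longlonglongrightarrow> w x"
    using fin
  proof eventually_elim
    case (elim x)
    then obtain c where c: "c \<ge> 0" "(SUP K. ennreal ((S K x)\<^sup>2)) = ennreal c"
      by (cases "SUP K. ennreal ((S K x)\<^sup>2)" rule: ennreal_cases) auto
    have "S K x \<le> max 1 c" for K
    proof -
      have "ennreal ((S K x)\<^sup>2) \<le> ennreal c"
        unfolding c(2)[symmetric] by (rule SUP_upper) auto
      then have "(S K x)\<^sup>2 \<le> c" using c(1) by (simp add: ennreal_le_iff)
      moreover have "S K x \<le> max 1 ((S K x)\<^sup>2)"
        using self_le_power[of "S K x" 2] by (cases "S K x \<le> 1") auto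
      ultimately show ?thesis by linarith
    qed
    then have "summable (\<lambda>k. cmod (u (Suc k) x - u k x))"
      unfolding S_def by (intro summableI_nonneg_bounded[where x = "max 1 c"]) auto
    then have "summable (\<lambda>k. u (Suc k) x - u k x)"
      by (rule summable_norm_cancel)
    then have "convergent (\<lambda>k. u k x)"
      unfolding summable_iff_convergent
      by (simp only: sum_lessThan_telescope[of "\<lambda>k. u k x"] convergent_diff_const_right_iff)
    then show ?case
      by (simp add: w_def convergent_LIMSEQ_iff)
  qed
  have wu: "(\<lambda>x. w x - u k x) \<in> L2 \<and> norm (cls (\<lambda>x. w x - u k x)) \<le> (1/2)^k" for k
  proof -
    have "(\<integral>\<^sup>+x. ennreal ((cmod (w x - u k x))\<^sup>2) \<partial>lborel)
        = (\<integral>\<^sup>+x. liminf (\<lambda>l. ennreal ((cmod (u l x - u k x))\<^sup>2)) \<partial>lborel)"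
    proof (rule nn_integral_cong_AE, use conv in eventually_elim)
      case (elim x)
      then have "(\<lambda>l. ennreal ((cmod (u l x - u k x))\<^sup>2)) \<longlonglongrightarrow> ennreal ((cmod (w x - u k x))\<^sup>2)"
        by (intro tendsto_intros tendsto_ennrealI)
      then show ?case by (intro lim_imp_Liminf[symmetric] trivial_limit_sequentially)
    qed
    also have "\<dots> \<le> liminf (\<lambda>l. \<integral>\<^sup>+x. ennreal ((cmod (u l x - u k x))\<^sup>2) \<partial>lborel)"
      by (rule nn_integral_liminf) measurable
    also have "\<dots> \<le> liminf (\<lambda>l. ennreal (((1/2)^k)\<^sup>2))"
    proof (rule Liminf_mono, rule eventually_sequentiallyI[of k])
      fix l assume "k \<le> l"
      then show "(\<integral>\<^sup>+x. ennreal ((cmod (u l x - u k x))\<^sup>2) \<partial>lborel) \<le> ennreal (((1/2)^k)\<^sup>2)"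
        using close[of k l] by (simp add: nn_integral_L2 L2_diff u ennreal_leI power_mono)
    qed
    also have "\<dots> = ennreal (((1/2)^k)\<^sup>2)"
      by (simp add: Liminf_const)
    finally show ?thesis
      using L2_nn_integral_le[of "\<lambda>x. w x - u k x" "(1/2)^k"] by simp
  qed
  have w: "w \<in> L2"
    using L2_add[OF conjunct1[OF wu[of 0]] u(1)[of 0]] by simp
  have "norm (X (r k) - cls w) \<le> (1/2)^k" for k
    using wu[of k] norm_minus_commute[of "X (r k)" "cls w"] by (simp add: cls_diff w u)
  then have "\<forall>\<^sub>F k in sequentially. norm (X (r k) - cls w) \<le> (1/2)^k"
    by (rule always_eventually[OF allI])
  moreover have "(\<lambda>k. (1/2::real)^k) \<longlonglongrightarrow> 0"
    by (rule LIMSEQ_realpow_zero) simp_all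
  ultimately have "(\<lambda>k. X (r k) - cls w) \<longlonglongrightarrow> 0"
    by (rule Lim_null_comparison)
  then have "(\<lambda>k. X (r k)) \<longlonglongrightarrow> cls w"
    by (simp add: LIM_zero_iff)
  then show "convergent X"
    using Cauchy_converges_subseq[OF C r(1), of "cls w"] by (auto simp: convergent_def o_def)
qed

subsection \<open>Momentum operators\<close>

lemma test_fun_L2:
  fixes u :: "real^2 \<Rightarrow> complex"
  assumes "test_fun u" shows "u \<in> L2"
proof -
  have "test_fun (\<lambda>x. u x \<bullet> u x)"
    by (rule test_fun_bilinear[OF bounded_bilinear_inner test_fun_smooth[OF assms] assms])
  from test_fun_integrable[OF this] have "integrable lborel (\<lambda>x. (cmod (u x))\<^sup>2)"
    by (simp add: dot_square_norm)
  moreover have "u \<in> borel_measurable borel"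
    by (rule borel_measurable_continuous_onI[OF smooth_continuous[OF test_fun_smooth[OF assms]]])
  ultimately show ?thesis by (simp add: L2_def)
qed

text \<open>The component \<open>a\<close> of the vector potential and the direction
  \<open>j\<close> are parameters, so that the commutator computation is done once and used a second
  time with the two momenta exchanged.\<close>

definition mom :: "(real^2 \<Rightarrow> real) \<Rightarrow> 2 \<Rightarrow> (real^2 \<Rightarrow> complex) \<Rightarrow> real^2 \<Rightarrow> complex" where
  "mom a j u x = - \<i> * pdiff j u x + complex_of_real (a x) * u x"

lemma momentum_eq_mom:
  "momentum1 B = mom (\<lambda>x. B / 2 * x $ 2) 1" "momentum2 B = mom (\<lambda>x. - (B / 2) * x $ 1) 2"
  by (intro ext, simp add: momentum1_def momentum2_def mom_def)+

lemma smooth_mom: "smooth a \<Longrightarrow> smooth u \<Longrightarrow> smooth (mom a j u)"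
  unfolding mom_def[abs_def] by (intro smooth_add smooth_mult smooth_of_real smooth_pdiff smooth_const)

lemma test_fun_mom: "smooth a \<Longrightarrow> test_fun u \<Longrightarrow> test_fun (mom a j u)"
  unfolding mom_def[abs_def]
  by (intro test_fun_add test_fun_mult smooth_of_real smooth_const test_fun_pdiff)

lemma mom_add:
  assumes "smooth u" "smooth v"
  shows "mom a j (\<lambda>x. u x + v x) = (\<lambda>x. mom a j u x + mom a j v x)"
  by (rule ext) (simp add: mom_def pdiff_add smooth_differentiable assms algebra_simps)

lemma pdiff_mult:
  fixes f g :: "real^'n::finite \<Rightarrow> 'b::real_normed_algebra"
  assumes "smooth f" "smooth g"
  shows "pdiff j (\<lambda>x. f x * g x) x = f x * pdiff j g x + pdiff j f x * g x"
  by (intro pdiff_bilinear bounded_bilinear_mult smooth_differentiable assms)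

lemma pdiff_scaleR:
  assumes "smooth f" "smooth g"
  shows "pdiff j (\<lambda>x. f x *\<^sub>R g x) x = f x *\<^sub>R pdiff j g x + pdiff j f x *\<^sub>R g x"
  by (intro pdiff_bilinear bounded_bilinear_scaleR smooth_differentiable assms)

lemma mom_cmult: "smooth u \<Longrightarrow> mom a j (\<lambda>x. c * u x) = (\<lambda>x. c * mom a j u x)"
  by (rule ext) (simp add: mom_def pdiff_mult algebra_simps)

lemma mom_scaleR:
  assumes "smooth \<phi>" "smooth u"
  shows "mom a j (\<lambda>x. \<phi> x *\<^sub>R u x) = (\<lambda>x. \<phi> x *\<^sub>R mom a j u x - pdiff j \<phi> x *\<^sub>R (\<i> * u x))"
  by (rule ext) (simp add: mom_def pdiff_scaleR assms algebra_simps)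

text \<open>The difference of the two integrands is the partial derivative of the compactly
  supported function \<open>(- \<i> * u x) \<bullet> v x\<close>, so its integral vanishes; the real
  potential \<open>a\<close> cancels pointwise.\<close>

lemma mom_symmetric:
  assumes "smooth a" "test_fun u" "test_fun v"
  shows "cls (mom a j u) \<bullet> cls v = cls u \<bullet> cls (mom a j v)"
proof -
  note su = test_fun_smooth[OF assms(2)] and sv = test_fun_smooth[OF assms(3)]
  define f where "f x = (- \<i> * u x) \<bullet> v x" for x
  have f: "test_fun f"
    unfolding f_def by (intro test_fun_bilinear[OF bounded_bilinear_inner] smooth_mult su assms smooth_const)
  have "pdiff j f x = mom a j u x \<bullet> v x - u x \<bullet> mom a j v x" for x
  proof -
    have "pdiff j f x = (- \<i> * u x) \<bullet> pdiff j v x + pdiff j (\<lambda>x. - \<i> * u x) x \<bullet> v x"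
      unfolding f_def
      by (intro pdiff_bilinear[OF bounded_bilinear_inner] smooth_differentiable smooth_mult su sv smooth_const)
    also have "pdiff j (\<lambda>x. - \<i> * u x) x = - \<i> * pdiff j u x"
      using pdiff_mult[of "\<lambda>_. - \<i>" u] su by simp
    finally show ?thesis
      by (simp add: mom_def inner_complex_def algebra_simps)
  qed
  then have eq: "pdiff j f = (\<lambda>x. mom a j u x \<bullet> v x - u x \<bullet> mom a j v x)" by blast
  have L: "u \<in> L2" "v \<in> L2" "mom a j u \<in> L2" "mom a j v \<in> L2"
    by (intro test_fun_L2 test_fun_mom assms)+
  have "(LINT x|lborel. mom a j u x \<bullet> v x - u x \<bullet> mom a j v x) = 0"
    using integral_pdiff[OF f, of j] unfolding eq .
  then show ?thesis
    using L by (simp add: inner_cls L2_inner_integrable)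
qed

subsection \<open>The commutator identity\<close>

lemma inner_cls_i:
  assumes "f \<in> L2" "g \<in> L2"
  shows "cls (\<lambda>x. \<i> * f x) \<bullet> cls g = - (cls f \<bullet> cls (\<lambda>x. \<i> * g x))"
proof -
  have "cls (\<lambda>x. \<i> * f x) \<bullet> cls g = (LINT x|lborel. (\<i> * f x) \<bullet> g x)"
    by (intro inner_cls L2_cmult assms)
  also have "\<dots> = (LINT x|lborel. - (f x \<bullet> (\<i> * g x)))"
    by (rule arg_cong[where f = "integral\<^sup>L lborel"]) (simp add: inner_complex_def fun_eq_iff)
  also have "\<dots> = - (cls f \<bullet> cls (\<lambda>x. \<i> * g x))"
    by (simp add: inner_cls L2_cmult assms)
  finally show ?thesis .
qed

lemma inner_cls_scaleR:
  assumes "f \<in> L2" "g \<in> L2" "(\<lambda>x. \<phi> x *\<^sub>R f x) \<in> L2" "(\<lambda>x. \<phi> x *\<^sub>R g x) \<in> L2"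
  shows "cls (\<lambda>x. \<phi> x *\<^sub>R f x) \<bullet> cls g = cls f \<bullet> cls (\<lambda>x. \<phi> x *\<^sub>R g x)"
  by (simp add: inner_cls assms)

text \<open>Second derivatives cancel by \<open>pdiff_commute\<close>; up to sign, what is left is
  the curl of the vector potential, the magnetic field.\<close>

lemma mom_commutator:
  assumes "smooth a" "smooth b" "smooth u"
  shows "mom a j (mom b k u) x - mom b k (mom a j u) x
    = \<i> * complex_of_real (pdiff k a x - pdiff j b x) * u x"
proof -
  have *: "pdiff j (mom b k u) x
      = - \<i> * pdiff j (pdiff k u) x + complex_of_real (b x) * pdiff j u x + complex_of_real (pdiff j b x) * u x"
    if "smooth b" for j b k
  proof -
    have "pdiff j (\<lambda>x. complex_of_real (b x)) x = complex_of_real (pdiff j b x)"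
      by (intro pdiff_linear bounded_linear_of_real smooth_differentiable that)
    moreover have "pdiff j (mom b k u) x
        = pdiff j (\<lambda>x. - \<i> * pdiff k u x) x + pdiff j (\<lambda>x. complex_of_real (b x) * u x) x"
      unfolding mom_def[abs_def]
      by (intro pdiff_add smooth_differentiable smooth_mult smooth_of_real smooth_pdiff smooth_const assms that)
    ultimately show ?thesis
      using that assms(3) pdiff_mult[of "\<lambda>_. - \<i>" "pdiff k u" j x] pdiff_mult[of "\<lambda>x. complex_of_real (b x)" u j x]
      by (simp add: smooth_pdiff smooth_of_real)
  qed
  show ?thesis
    using pdiff_commute[OF assms(3), of j k x]
    by (simp add: mom_def[of _ _ "mom _ _ u"] * assms(1,2)) (simp add: mom_def algebra_simps)
qed

lemma mom_i_scaleR: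
  assumes "smooth \<phi>" "smooth w"
  shows "mom a j (\<lambda>x. \<phi> x *\<^sub>R (\<i> * w x)) = (\<lambda>x. \<phi> x *\<^sub>R (\<i> * mom a j w x) + pdiff j \<phi> x *\<^sub>R w x)"
  using assms
  by (simp add: mom_cmult mom_scaleR smooth_mult algebra_simps fun_eq_iff)

lemma test_fun_i: "test_fun w \<Longrightarrow> test_fun (\<lambda>x. \<i> * w x)"
  by (intro test_fun_mult smooth_const)

text \<open>The two pairings are negatives of each other, because multiplication by
  \<open>\<i>\<close> is skew. Moving the symmetric momentum across \<open>\<phi>\<close> shows that
  they differ by the term with \<open>pdiff j \<phi>\<close>, so each is half of it up to
  sign.\<close>

lemma mom_multiplier:
  assumes "smooth a" "test_fun w" "smooth \<phi>"
  shows "2 * (cls (mom a j w) \<bullet> cls (\<lambda>x. \<phi> x *\<^sub>R (\<i> * w x))) = cls w \<bullet> cls (\<lambda>x. pdiff j \<phi> x *\<^sub>R w x)"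
    and "2 * (cls w \<bullet> cls (\<lambda>x. \<phi> x *\<^sub>R (\<i> * mom a j w x))) = - (cls w \<bullet> cls (\<lambda>x. pdiff j \<phi> x *\<^sub>R w x))"
proof -
  note t = test_fun_i test_fun_scaleR test_fun_mom smooth_pdiff assms
  have L: "w \<in> L2" "mom a j w \<in> L2" "(\<lambda>x. \<phi> x *\<^sub>R w x) \<in> L2" "(\<lambda>x. \<phi> x *\<^sub>R mom a j w x) \<in> L2"
      "(\<lambda>x. \<phi> x *\<^sub>R (\<i> * mom a j w x)) \<in> L2" "(\<lambda>x. pdiff j \<phi> x *\<^sub>R w x) \<in> L2"
    by (intro test_fun_L2 t)+
  have "cls (mom a j w) \<bullet> cls (\<lambda>x. \<phi> x *\<^sub>R (\<i> * w x))
      = cls w \<bullet> cls (mom a j (\<lambda>x. \<phi> x *\<^sub>R (\<i> * w x)))"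
    by (intro mom_symmetric t)
  also have "\<dots> = cls w \<bullet> cls (\<lambda>x. \<phi> x *\<^sub>R (\<i> * mom a j w x)) + cls w \<bullet> cls (\<lambda>x. pdiff j \<phi> x *\<^sub>R w x)"
    by (simp add: mom_i_scaleR assms(3) test_fun_smooth[OF assms(2)] cls_add L inner_add_right)
  finally have 1: "cls (mom a j w) \<bullet> cls (\<lambda>x. \<phi> x *\<^sub>R (\<i> * w x))
      = cls w \<bullet> cls (\<lambda>x. \<phi> x *\<^sub>R (\<i> * mom a j w x)) + cls w \<bullet> cls (\<lambda>x. pdiff j \<phi> x *\<^sub>R w x)" .
  have "cls w \<bullet> cls (\<lambda>x. \<phi> x *\<^sub>R (\<i> * mom a j w x)) = cls (\<lambda>x. \<phi> x *\<^sub>R w x) \<bullet> cls (\<lambda>x. \<i> * mom a j w x)"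
    by (intro inner_cls_scaleR[symmetric] test_fun_L2 t)
  also have "\<dots> = - (cls (\<lambda>x. \<i> * (\<phi> x *\<^sub>R w x)) \<bullet> cls (mom a j w))"
    using inner_cls_i[OF L(3) L(2)] by simp
  also have "(\<lambda>x. \<i> * (\<phi> x *\<^sub>R w x)) = (\<lambda>x. \<phi> x *\<^sub>R (\<i> * w x))"
    by simp
  finally have 2: "cls w \<bullet> cls (\<lambda>x. \<phi> x *\<^sub>R (\<i> * mom a j w x))
      = - (cls (mom a j w) \<bullet> cls (\<lambda>x. \<phi> x *\<^sub>R (\<i> * w x)))"
    by (simp only: inner_commute)
  show "2 * (cls (mom a j w) \<bullet> cls (\<lambda>x. \<phi> x *\<^sub>R (\<i> * w x))) = cls w \<bullet> cls (\<lambda>x. pdiff j \<phi> x *\<^sub>R w x)"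
    "2 * (cls w \<bullet> cls (\<lambda>x. \<phi> x *\<^sub>R (\<i> * mom a j w x))) = - (cls w \<bullet> cls (\<lambda>x. pdiff j \<phi> x *\<^sub>R w x))"
    using 1 2 by linarith+
qed

text \<open>The commutator of \<open>P\<^sup>2 + Q\<^sup>2\<close> with the symmetrised multiplier \<open>\<phi> P + P \<phi>\<close>, where
  \<open>P\<close> and \<open>Q\<close> are the two momenta; the eigenvalue parameter \<open>E\<close> drops out.\<close>

lemma commutator_identity:
  assumes a: "smooth a" and b: "smooth b" and u: "test_fun u" and \<phi>: "smooth \<phi>"
    and k: "\<And>x. pdiff k \<phi> x = 0" and c: "\<And>x. pdiff k a x - pdiff j b x = c"
    and h: "h \<in> L2"
      "\<And>x. mom a j (mom a j u) x + mom b k (mom b k u) x = complex_of_real E * u x + h x"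
  defines "P \<equiv> mom a j u" and "Q \<equiv> mom b k u"
  shows "2 * (cls P \<bullet> cls (\<lambda>x. pdiff j \<phi> x *\<^sub>R P x))
    = 2 * (cls h \<bullet> cls (\<lambda>x. \<phi> x *\<^sub>R (\<i> * P x))) + cls h \<bullet> cls (\<lambda>x. pdiff j \<phi> x *\<^sub>R u x)
      - 2 * c * (cls Q \<bullet> cls (\<lambda>x. \<phi> x *\<^sub>R u x))
      + cls P \<bullet> cls (\<lambda>x. pdiff j (pdiff j \<phi>) x *\<^sub>R (\<i> * u x))"
proof -
  have tP: "test_fun P" "test_fun Q"
    unfolding P_def Q_def by (intro test_fun_mom a b u)+
  note t = test_fun_i test_fun_scaleR test_fun_mom smooth_pdiff a b u \<phi> tP
  note L = test_fun_L2[OF u] test_fun_L2[OF tP(1)] test_fun_L2[OF tP(2)]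
  let ?H = "cls (mom a j P) + cls (mom b k Q)"
  have H: "?H = E *\<^sub>R cls u + cls h"
  proof -
    have "?H = cls (\<lambda>x. mom a j P x + mom b k Q x)"
      by (intro cls_add[symmetric] test_fun_L2 t)
    also have "\<dots> = cls (\<lambda>x. complex_of_real E * u x + h x)"
      using h(2) by (simp add: P_def Q_def)
    also have "\<dots> = E *\<^sub>R cls u + cls h"
      by (simp add: cls_add L2_cmult L h(1) cls_cmult_of_real)
    finally show ?thesis .
  qed
  \<comment> \<open>Since \<open>\<i> * P (\<phi> u) = \<phi> * \<i> * P u + \<phi>' u\<close>, the
    vector \<open>2 * ?M + ?N\<close> is \<open>\<i> (\<phi> P + P \<phi>) u\<close>.\<close>
  let ?M = "cls (\<lambda>x. \<phi> x *\<^sub>R (\<i> * P x))" and ?N = "cls (\<lambda>x. pdiff j \<phi> x *\<^sub>R u x)"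
  have 1: "2 * (cls (mom a j P) \<bullet> ?M) = cls P \<bullet> cls (\<lambda>x. pdiff j \<phi> x *\<^sub>R P x)"
    by (intro mom_multiplier t)
  \<comment> \<open>The first summand will be cancelled by \<open>4\<close>; the second records that
    the momenta commute only up to the field \<open>c\<close>.\<close>
  have 2: "2 * (cls (mom b k Q) \<bullet> ?M)
      = - (cls Q \<bullet> cls (\<lambda>x. pdiff j \<phi> x *\<^sub>R Q x)) + 2 * c * (cls Q \<bullet> cls (\<lambda>x. \<phi> x *\<^sub>R u x))"
  proof -
    have "cls (mom b k Q) \<bullet> ?M = cls Q \<bullet> cls (mom b k (\<lambda>x. \<phi> x *\<^sub>R (\<i> * P x)))"
      by (intro mom_symmetric t)
    also have "mom b k (\<lambda>x. \<phi> x *\<^sub>R (\<i> * P x)) = (\<lambda>x. \<phi> x *\<^sub>R (\<i> * mom a j Q x) + c *\<^sub>R (\<phi> x *\<^sub>R u x))"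
    proof
      fix x
      have eq: "mom b k P x = mom a j Q x - \<i> * complex_of_real c * u x"
        using mom_commutator[OF a b test_fun_smooth[OF u], of j k x] c[of x]
        unfolding P_def Q_def by (simp add: algebra_simps)
      show "mom b k (\<lambda>x. \<phi> x *\<^sub>R (\<i> * P x)) x = \<phi> x *\<^sub>R (\<i> * mom a j Q x) + c *\<^sub>R (\<phi> x *\<^sub>R u x)"
        unfolding mom_i_scaleR[OF \<phi> test_fun_smooth[OF tP(1)]] eq
        by (simp add: k scaleR_conv_of_real algebra_simps)
    qed
    also have "cls \<dots> = cls (\<lambda>x. \<phi> x *\<^sub>R (\<i> * mom a j Q x)) + c *\<^sub>R cls (\<lambda>x. \<phi> x *\<^sub>R u x)"
    proof -
      have L': "(\<lambda>x. \<phi> x *\<^sub>R (\<i> * mom a j Q x)) \<in> L2" "(\<lambda>x. \<phi> x *\<^sub>R u x) \<in> L2"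
        by (intro test_fun_L2 t)+
      show ?thesis
        unfolding cls_add[OF L'(1) L2_scaleR[OF L'(2)]] cls_scaleR[OF L'(2)] ..
    qed
    finally have "cls (mom b k Q) \<bullet> ?M
        = cls Q \<bullet> cls (\<lambda>x. \<phi> x *\<^sub>R (\<i> * mom a j Q x)) + c * (cls Q \<bullet> cls (\<lambda>x. \<phi> x *\<^sub>R u x))"
      by (simp only: inner_add_right inner_scaleR_right)
    then show ?thesis
      using mom_multiplier(2)[OF a tP(2) \<phi>, of j] by linarith
  qed
  have 3: "cls (mom a j P) \<bullet> ?N = cls P \<bullet> cls (\<lambda>x. pdiff j \<phi> x *\<^sub>R P x)
      - cls P \<bullet> cls (\<lambda>x. pdiff j (pdiff j \<phi>) x *\<^sub>R (\<i> * u x))"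
  proof -
    have "cls (mom a j P) \<bullet> ?N = cls P \<bullet> cls (mom a j (\<lambda>x. pdiff j \<phi> x *\<^sub>R u x))"
      by (intro mom_symmetric t)
    also have "mom a j (\<lambda>x. pdiff j \<phi> x *\<^sub>R u x)
        = (\<lambda>x. pdiff j \<phi> x *\<^sub>R P x - pdiff j (pdiff j \<phi>) x *\<^sub>R (\<i> * u x))"
      by (simp add: mom_scaleR smooth_pdiff \<phi> test_fun_smooth[OF u] P_def)
    also have "cls \<dots> = cls (\<lambda>x. pdiff j \<phi> x *\<^sub>R P x) - cls (\<lambda>x. pdiff j (pdiff j \<phi>) x *\<^sub>R (\<i> * u x))"
      by (intro cls_diff test_fun_L2 t)
    finally show ?thesis by (simp only: inner_diff_right)
  qed
  have 4: "cls (mom b k Q) \<bullet> ?N = cls Q \<bullet> cls (\<lambda>x. pdiff j \<phi> x *\<^sub>R Q x)"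
  proof -
    have "cls (mom b k Q) \<bullet> ?N = cls Q \<bullet> cls (mom b k (\<lambda>x. pdiff j \<phi> x *\<^sub>R u x))"
      by (intro mom_symmetric t)
    also have "pdiff k (pdiff j \<phi>) = (\<lambda>x. 0)"
    proof -
      have "pdiff k \<phi> = (\<lambda>x. 0)" using k by blast
      then show ?thesis using pdiff_commute_real[OF \<phi>, of k j] by (intro ext) simp
    qed
    then have "mom b k (\<lambda>x. pdiff j \<phi> x *\<^sub>R u x) = (\<lambda>x. pdiff j \<phi> x *\<^sub>R Q x)"
      by (simp add: mom_scaleR smooth_pdiff \<phi> test_fun_smooth[OF u] Q_def)
    finally show ?thesis .
  qed
  \<comment> \<open>\<open>\<i>\<close> times a symmetric operator is skew, so its form at
    \<open>u\<close> vanishes; this removes \<open>E\<close>.\<close>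
  have 5: "2 * (cls u \<bullet> ?M) = - (cls u \<bullet> ?N)"
    unfolding P_def by (intro mom_multiplier(2) t)
  have "2 * (?H \<bullet> ?M) + ?H \<bullet> ?N = 2 * (cls h \<bullet> ?M) + cls h \<bullet> ?N + E * (2 * (cls u \<bullet> ?M) + cls u \<bullet> ?N)"
    unfolding H by (simp add: inner_add_left algebra_simps)
  then show ?thesis
    using 1 2 3 4 5 by (simp add: inner_add_left)
qed

section \<open>Multiplication operators on classes\<close>

definition mult_l2 :: "(real^2 \<Rightarrow> real) \<Rightarrow> l2 \<Rightarrow> l2" where
  "mult_l2 m X = cls (\<lambda>x. m x *\<^sub>R rep_l2 X x)"

context
  fixes m :: "real^2 \<Rightarrow> real" and C :: real
  assumes m [measurable]: "m \<in> borel_measurable borel" and C: "\<And>x. \<bar>m x\<bar> \<le> C"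
begin

lemma L2_bounded_mult: "u \<in> L2 \<Longrightarrow> (\<lambda>x. m x *\<^sub>R u x) \<in> L2"
  using L2_measurable[of u]
  by (rule_tac L2_bound[of u _ C]) (auto intro!: mult_right_mono C)

lemma mult_l2_cls:
  assumes "u \<in> L2" shows "mult_l2 m (cls u) = cls (\<lambda>x. m x *\<^sub>R u x)"
proof -
  have "AE x in lborel. rep_l2 (cls u) x = u x"
    using cls_eq_iff[OF cls_rep(1) assms] cls_rep(2) by blast
  then show ?thesis
    unfolding mult_l2_def cls_eq_iff[OF L2_bounded_mult[OF cls_rep(1)] L2_bounded_mult[OF assms]]
    by eventually_elim simp
qed

lemma norm_mult_l2_le: "norm (mult_l2 m X) \<le> C * norm X"
proof (cases X)
  case (1 u)
  have "0 \<le> C" using C[of 0] by linarith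
  have "norm (cls (\<lambda>x. m x *\<^sub>R u x)) \<le> norm (cls (\<lambda>x. C *\<^sub>R u x))"
    using \<open>0 \<le> C\<close> by (intro norm_cls_le L2_bounded_mult L2_scaleR 1) (auto intro!: mult_right_mono C)
  then show ?thesis
    using 1 \<open>0 \<le> C\<close> by (simp add: mult_l2_cls cls_scaleR)
qed

lemma bounded_linear_mult_l2: "bounded_linear (mult_l2 m)"
proof (rule bounded_linear_intro[where K = C])
  fix X Y :: l2 and r :: real
  show "norm (mult_l2 m X) \<le> norm X * C"
    using norm_mult_l2_le by (simp add: mult.commute)
  obtain u v where "u \<in> L2" "X = cls u" "v \<in> L2" "Y = cls v"
    using l2_cases[of X] l2_cases[of Y] by metis
  then show "mult_l2 m (X + Y) = mult_l2 m X + mult_l2 m Y" "mult_l2 m (r *\<^sub>R X) = r *\<^sub>R mult_l2 m X"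
    by (simp_all add: mult_l2_cls L2_add L2_scaleR L2_bounded_mult scaleR_add_right
        mult.commute[of r] flip: cls_add cls_scaleR)
qed

end

subsection \<open>Localization estimates\<close>

lemma pdiff_power2:
  fixes f :: "real^'n::finite \<Rightarrow> real"
  assumes "smooth f" shows "pdiff j (\<lambda>x. (f x)\<^sup>2) x = 2 * f x * pdiff j f x"
  using pdiff_mult[OF assms assms] by (simp add: power2_eq_square)

lemma pdiff_add_smooth: "smooth f \<Longrightarrow> smooth g \<Longrightarrow> pdiff j (\<lambda>x. f x + g x) x = pdiff j f x + pdiff j g x"
  by (intro pdiff_add smooth_differentiable)

lemma pdiff_diff_smooth: "smooth f \<Longrightarrow> smooth g \<Longrightarrow> pdiff j (\<lambda>x. f x - g x) x = pdiff j f x - pdiff j g x"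
  by (intro pdiff_diff smooth_differentiable)

text \<open>Bounded, with derivatives bounded by 1, and increasing: the commutator produces the
  positive derivative as a weight in the main term.\<close>

definition multiplier :: "real^2 \<Rightarrow> 2 \<Rightarrow> real^2 \<Rightarrow> real" where
  "multiplier p j x = arctan (x $ j - p $ j)"

text \<open>A single minorant for the derivatives of both multipliers, bounded below on balls around
  \<open>p\<close>. Unlike the indicator of a ball it is smooth, so momenta can be moved across
  it.\<close>

definition weight :: "real^2 \<Rightarrow> real^2 \<Rightarrow> real" where
  "weight p x = inverse (1 + (x $ 1 - p $ 1)\<^sup>2 + (x $ 2 - p $ 2)\<^sup>2)"

lemma one_plus_squares_neq_0: "1 + (a::real)\<^sup>2 \<noteq> 0" "1 + a\<^sup>2 + b\<^sup>2 \<noteq> 0"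
  using zero_le_power2[of a] zero_le_power2[of b] by linarith+

lemma smooth_multiplier: "smooth (multiplier p j)"
  unfolding multiplier_def[abs_def] by (intro smooth_arctan smooth_diff smooth_nth smooth_const)

lemma smooth_weight: "smooth (weight p)"
  unfolding weight_def[abs_def]
  by (intro smooth_inverse smooth_add smooth_power smooth_diff smooth_nth smooth_const one_plus_squares_neq_0)

lemma pdiff_multiplier:
  "pdiff k (multiplier p j) = (\<lambda>x. if k = j then inverse (1 + (x $ j - p $ j)\<^sup>2) else 0)"
  unfolding multiplier_def[abs_def]
  by (intro ext) (simp add: pdiff_arctan pdiff_diff_smooth smooth_diff)

lemma abs_multiplier_le: "\<bar>multiplier p j x\<bar> \<le> 2"
  using arctan_bounded[of "x $ j - p $ j"] pi_less_4
  unfolding multiplier_def abs_le_iff by linarith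

lemma abs_pdiff_multiplier_le: "\<bar>pdiff j (multiplier p j) x\<bar> \<le> 1"
  by (simp add: pdiff_multiplier inverse_le_1_iff add_pos_nonneg abs_of_pos)

lemma abs_double_le: "2 * \<bar>t\<bar> \<le> 1 + (t::real)\<^sup>2"
  using zero_le_power2[of "\<bar>t\<bar> - 1"] by (simp add: power2_diff)

text \<open>Bounds the derivative of \<open>1 / s\<close> when that of \<open>s\<close> is
  \<open>2 * t\<close>, through \<open>2 * \<bar>t\<bar> \<le> 1 + t\<^sup>2 \<le> s \<le>
  s\<^sup>2\<close>; it serves both the second derivative of the multiplier and the gradient of the
  weight.\<close>

lemma derivative_of_inverse_le_1:
  assumes "1 + t\<^sup>2 \<le> s" shows "\<bar>- (2 * t * (inverse s)\<^sup>2)\<bar> \<le> (1::real)"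
proof -
  have s: "1 \<le> s" using assms zero_le_power2[of t] by linarith
  have "2 * \<bar>t\<bar> \<le> s" using abs_double_le[of t] assms by linarith
  also have "s \<le> s\<^sup>2" using self_le_power[OF s, of 2] by simp
  finally show ?thesis
    using s by (simp add: abs_mult power2_eq_square field_simps)
qed

lemma abs_pdiff2_multiplier_le: "\<bar>pdiff j (pdiff j (multiplier p j)) x\<bar> \<le> 1"
proof -
  let ?t = "x $ j - p $ j"
  have "smooth (\<lambda>x. 1 + (x $ j - p $ j)\<^sup>2)"
    by (intro smooth_add smooth_power smooth_diff smooth_nth smooth_const)
  moreover have "pdiff j (\<lambda>x. 1 + (x $ j - p $ j)\<^sup>2) x = 2 * ?t"
    by (simp add: pdiff_add_smooth pdiff_power2 pdiff_diff_smooth smooth_diff smooth_power)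
  ultimately have "pdiff j (pdiff j (multiplier p j)) x = - (2 * ?t * (inverse (1 + ?t\<^sup>2))\<^sup>2)"
    by (simp add: pdiff_multiplier pdiff_inverse one_plus_squares_neq_0)
  then show ?thesis
    using derivative_of_inverse_le_1[of ?t "1 + ?t\<^sup>2"] by simp
qed

lemma abs_pdiff_weight_le: "\<bar>pdiff j (weight p) x\<bar> \<le> 1"
proof -
  let ?q = "\<lambda>x::real^2. 1 + (x $ 1 - p $ 1)\<^sup>2 + (x $ 2 - p $ 2)\<^sup>2"
  have "smooth ?q"
    by (intro smooth_add smooth_power smooth_diff smooth_nth smooth_const)
  moreover have "pdiff j ?q x = 2 * (x $ j - p $ j)"
    using exhaust_2[of j]
    by (auto simp: pdiff_add_smooth pdiff_power2 pdiff_diff_smooth smooth_diff smooth_power smooth_add)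
  ultimately have "pdiff j (weight p) x = - (2 * (x $ j - p $ j) * (inverse (?q x))\<^sup>2)"
    unfolding weight_def[abs_def] by (simp add: pdiff_inverse one_plus_squares_neq_0)
  moreover have "1 + (x $ j - p $ j)\<^sup>2 \<le> ?q x"
    using exhaust_2[of j] by auto
  ultimately show ?thesis
    using derivative_of_inverse_le_1 by metis
qed

lemma weight_pos: "0 < weight p x" and weight_le_1: "weight p x \<le> 1"
  by (simp_all add: weight_def add_pos_nonneg inverse_le_1_iff)

lemma weight_le_pdiff_multiplier: "weight p x \<le> pdiff j (multiplier p j) x"
  using exhaust_2[of j] by (auto simp: weight_def pdiff_multiplier add_pos_nonneg)

lemma weight_lower_bound:
  assumes "dist x p \<le> d" shows "1 \<le> (1 + d\<^sup>2) * weight p x"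
proof -
  have "(x $ 1 - p $ 1)\<^sup>2 + (x $ 2 - p $ 2)\<^sup>2 = (dist x p)\<^sup>2"
    by (simp add: dist_norm norm_vec_def L2_set_def sum_2)
  also have "\<dots> \<le> d\<^sup>2"
    using assms by (intro power_mono) auto
  finally show ?thesis
    by (simp add: weight_def add_pos_nonneg pos_le_divide_eq flip: divide_inverse)
qed

lemma norm_cls_bound:
  assumes "f \<in> L2" "g \<in> L2" "0 \<le> C" "\<And>x. cmod (f x) \<le> C * cmod (g x)"
  shows "norm (cls f) \<le> C * norm (cls g)"
  using norm_cls_le[OF assms(1) L2_scaleR[OF assms(2)], of C] assms(3,4)
  by (simp add: cls_scaleR assms(2))

lemma inner_cls_mono:
  assumes "f \<in> L2" "g \<in> L2" "f' \<in> L2" "g' \<in> L2" "\<And>x. f x \<bullet> g x \<le> f' x \<bullet> g' x"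
  shows "cls f \<bullet> cls g \<le> cls f' \<bullet> cls g'"
  using assms by (auto simp: inner_cls intro!: integral_mono L2_inner_integrable)

text \<open>Young's inequality with weight \<open>g\<close>. On \<open>K\<close>, where
  \<open>1 \<le> k * g x\<close>, the contribution of \<open>P\<close> is at most a quarter of its
  weighted form and can be absorbed there, so the localized right-hand side costs no unweighted norm
  of \<open>P\<close>.\<close>

lemma inner_indicator_le:
  assumes h: "h \<in> L2" and P: "P \<in> L2" and M: "M \<in> L2"
    and K [measurable]: "K \<in> sets borel" and k: "0 < k" and g: "g \<in> borel_measurable borel"
    and g_bd: "\<And>x. 0 \<le> g x" "\<And>x. g x \<le> 1" and kK: "\<And>x. x \<in> K \<Longrightarrow> 1 \<le> k * g x"
    and MP: "\<And>x. cmod (M x) \<le> 2 * cmod (P x)"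
  shows "cls (\<lambda>x. indicator K x *\<^sub>R h x) \<bullet> cls M
    \<le> 4 * k * (norm (cls (\<lambda>x. indicator K x *\<^sub>R h x)))\<^sup>2 + (cls P \<bullet> cls (\<lambda>x. g x *\<^sub>R P x)) / 4"
proof -
  define hK where "hK x = indicator K x *\<^sub>R h x" for x
  have hK: "hK \<in> L2"
    unfolding hK_def by (rule L2_bounded_mult[where C = 1]) (auto simp: h indicator_def)
  have gP: "(\<lambda>x. g x *\<^sub>R P x) \<in> L2"
    by (rule L2_bounded_mult[where C = 1]) (auto simp: P g g_bd)
  have "hK x \<bullet> M x \<le> 4 * k * (hK x \<bullet> hK x) + (P x \<bullet> (g x *\<^sub>R P x)) / 4" for x
  proof (cases "x \<in> K")
    case True
    let ?a = "cmod (hK x)" and ?b = "cmod (P x)"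
    have "hK x \<bullet> M x \<le> ?a * cmod (M x)" by (rule norm_cauchy_schwarz)
    also have "\<dots> \<le> ?a * (2 * ?b)" by (intro mult_left_mono MP) simp
    also have "\<dots> \<le> 4 * k * ?a\<^sup>2 + g x * ?b\<^sup>2 / 4"
    proof -
      \<comment> \<open>This square is chosen so that the product \<open>8 * k * ?a * ?b\<close>,
        divided by \<open>4 * k\<close>, is the required \<open>2 * ?a * ?b\<close>.\<close>
      have "0 \<le> (4 * k * ?a - ?b)\<^sup>2" by simp
      also have "\<dots> = 16 * k\<^sup>2 * ?a\<^sup>2 - 8 * k * ?a * ?b + 1 * ?b\<^sup>2"
        by (simp add: power2_diff power_mult_distrib)
      also have "\<dots> \<le> 16 * k\<^sup>2 * ?a\<^sup>2 - 8 * k * ?a * ?b + (k * g x) * ?b\<^sup>2"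
        by (intro add_mono mult_right_mono kK True) simp_all
      also have "\<dots> = 4 * k * (4 * k * ?a\<^sup>2 + g x * ?b\<^sup>2 / 4 - ?a * (2 * ?b))"
        by (simp add: algebra_simps power2_eq_square)
      finally show ?thesis
        using k by (simp add: zero_le_mult_iff)
    qed
    finally show ?thesis by (simp add: dot_square_norm)
  next
    case False
    then show ?thesis
      using g_bd(1)[of x] by (simp add: hK_def)
  qed
  then have "cls hK \<bullet> cls M \<le> (LINT x|lborel. 4 * k * (hK x \<bullet> hK x) + (P x \<bullet> (g x *\<^sub>R P x)) / 4)"
    unfolding inner_cls[OF hK M]
    by (intro integral_mono L2_inner_integrable hK M Bochner_Integration.integrable_add
        integrable_mult_right integrable_divide P gP)
  also have "\<dots> = 4 * k * (cls hK \<bullet> cls hK) + (cls P \<bullet> cls (\<lambda>x. g x *\<^sub>R P x)) / 4"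
    unfolding inner_cls[OF hK hK] inner_cls[OF P gP]
    using L2_inner_integrable[OF hK hK] L2_inner_integrable[OF P gP]
    by (subst Bochner_Integration.integral_add) simp_all
  finally show ?thesis
    by (simp add: hK_def[abs_def] dot_square_norm)
qed

text \<open>The pairing of \<open>h\<close> with the multiplied momentum occurs twice, and on
  \<open>K\<close> each copy uses up a quarter of the weighted form; this turns the 2 of
  \<open>commutator_identity\<close> into \<open>3 / 2\<close>. Off \<open>K\<close> nothing is
  absorbed and the full norm of \<open>P\<close> is paid.\<close>

lemma commutator_estimate:
  assumes a: "smooth a" and b: "smooth b" and u: "test_fun u"
    and jk: "k \<noteq> j" and c: "\<And>x. pdiff k a x - pdiff j b x = c"
    and h: "h \<in> L2"
      "\<And>x. mom a j (mom a j u) x + mom b k (mom b k u) x = complex_of_real E * u x + h x"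
    and K: "K \<in> sets borel" "\<And>x. x \<in> K \<Longrightarrow> dist x p \<le> d"
  defines "P \<equiv> mom a j u" and "Q \<equiv> mom b k u"
    and "hK \<equiv> cls (\<lambda>x. indicator K x *\<^sub>R h x)"
  shows "3 / 2 * (cls P \<bullet> cls (\<lambda>x. weight p x *\<^sub>R P x))
    \<le> 8 * (1 + d\<^sup>2) * (norm hK)\<^sup>2 + 4 * norm (cls h - hK) * norm (cls P) + norm (cls h) * norm (cls u)
      + 4 * \<bar>c\<bar> * norm (cls Q) * norm (cls u) + norm (cls P) * norm (cls u)"
proof -
  let ?\<phi> = "multiplier p j"
  have tP: "test_fun P" "test_fun Q"
    unfolding P_def Q_def by (intro test_fun_mom a b u)+
  note t = test_fun_i test_fun_scaleR test_fun_mom smooth_pdiff a b u smooth_multiplier smooth_weight tP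
  let ?M = "\<lambda>x. ?\<phi> x *\<^sub>R (\<i> * P x)"
  have M: "?M \<in> L2" and P: "P \<in> L2" and u2: "u \<in> L2"
    by (intro test_fun_L2 t)+
  have meas: "weight p \<in> borel_measurable borel"
    by (intro borel_measurable_continuous_onI smooth_continuous t)
  have hK2: "(\<lambda>x. indicator K x *\<^sub>R h x) \<in> L2"
    using K(1) by (intro L2_bounded_mult[where C = 1]) (auto simp: h indicator_def)
  have pos: "0 < 1 + d\<^sup>2" by (simp add: add_pos_nonneg)
  have "2 * (cls P \<bullet> cls (\<lambda>x. pdiff j ?\<phi> x *\<^sub>R P x))
    = 2 * (cls h \<bullet> cls ?M) + cls h \<bullet> cls (\<lambda>x. pdiff j ?\<phi> x *\<^sub>R u x)
      - 2 * c * (cls Q \<bullet> cls (\<lambda>x. ?\<phi> x *\<^sub>R u x))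
      + cls P \<bullet> cls (\<lambda>x. pdiff j (pdiff j ?\<phi>) x *\<^sub>R (\<i> * u x))"
    unfolding P_def Q_def
    by (rule commutator_identity[OF a b u smooth_multiplier _ c h]) (simp add: pdiff_multiplier jk)
  moreover have "cls P \<bullet> cls (\<lambda>x. weight p x *\<^sub>R P x) \<le> cls P \<bullet> cls (\<lambda>x. pdiff j ?\<phi> x *\<^sub>R P x)"
    by (intro inner_cls_mono test_fun_L2 t)
      (simp add: mult_right_mono weight_le_pdiff_multiplier)
  moreover have "cls h \<bullet> cls ?M \<le> 4 * (1 + d\<^sup>2) * (norm hK)\<^sup>2 + (cls P \<bullet> cls (\<lambda>x. weight p x *\<^sub>R P x)) / 4
      + norm (cls h - hK) * (2 * norm (cls P))"
  proof -
    have "cls h \<bullet> cls ?M = hK \<bullet> cls ?M + (cls h - hK) \<bullet> cls ?M"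
      by (simp add: inner_diff_left)
    moreover have "hK \<bullet> cls ?M \<le> 4 * (1 + d\<^sup>2) * (norm hK)\<^sup>2 + (cls P \<bullet> cls (\<lambda>x. weight p x *\<^sub>R P x)) / 4"
      unfolding hK_def
      by (rule inner_indicator_le[OF h(1) P M K(1) pos meas])
        (auto simp: weight_le_1 less_imp_le[OF weight_pos] norm_mult intro!: mult_right_mono abs_multiplier_le
          weight_lower_bound K(2))
    moreover have "(cls h - hK) \<bullet> cls ?M \<le> norm (cls h - hK) * norm (cls ?M)"
      by (rule norm_cauchy_schwarz)
    moreover have "norm (cls ?M) \<le> 2 * norm (cls P)"
      by (rule norm_cls_bound[OF M P]) (auto simp: norm_mult intro!: mult_right_mono abs_multiplier_le)
    then have "norm (cls h - hK) * norm (cls ?M) \<le> norm (cls h - hK) * (2 * norm (cls P))"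
      by (rule mult_left_mono) simp
    ultimately show ?thesis by linarith
  qed
  moreover have "cls h \<bullet> cls (\<lambda>x. pdiff j ?\<phi> x *\<^sub>R u x) \<le> norm (cls h) * norm (cls u)"
  proof -
    have "norm (cls (\<lambda>x. pdiff j ?\<phi> x *\<^sub>R u x)) \<le> 1 * norm (cls u)"
      by (intro norm_cls_bound u2 test_fun_L2 t)
        (auto intro!: mult_left_le_one_le abs_pdiff_multiplier_le)
    then show ?thesis
      using norm_cauchy_schwarz[of "cls h" "cls (\<lambda>x. pdiff j ?\<phi> x *\<^sub>R u x)"]
      by (simp add: order_trans[OF _ mult_left_mono])
  qed
  moreover have "- 2 * c * (cls Q \<bullet> cls (\<lambda>x. ?\<phi> x *\<^sub>R u x)) \<le> 4 * \<bar>c\<bar> * norm (cls Q) * norm (cls u)"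
  proof -
    have "norm (cls (\<lambda>x. ?\<phi> x *\<^sub>R u x)) \<le> 2 * norm (cls u)"
      by (intro norm_cls_bound u2 test_fun_L2 t)
        (auto intro!: mult_right_mono abs_multiplier_le)
    then have "\<bar>cls Q \<bullet> cls (\<lambda>x. ?\<phi> x *\<^sub>R u x)\<bar> \<le> norm (cls Q) * (2 * norm (cls u))"
      using Cauchy_Schwarz_ineq2[of "cls Q" "cls (\<lambda>x. ?\<phi> x *\<^sub>R u x)"]
      by (simp add: order_trans[OF _ mult_left_mono])
    then have "\<bar>c\<bar> * \<bar>cls Q \<bullet> cls (\<lambda>x. ?\<phi> x *\<^sub>R u x)\<bar> \<le> \<bar>c\<bar> * (norm (cls Q) * (2 * norm (cls u)))"
      by (rule mult_left_mono) simp
    then show ?thesis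
      using abs_ge_minus_self[of "c * (cls Q \<bullet> cls (\<lambda>x. ?\<phi> x *\<^sub>R u x))"] by (simp add: abs_mult mult.assoc)
  qed
  moreover have "cls P \<bullet> cls (\<lambda>x. pdiff j (pdiff j ?\<phi>) x *\<^sub>R (\<i> * u x)) \<le> norm (cls P) * norm (cls u)"
  proof -
    have "norm (cls (\<lambda>x. pdiff j (pdiff j ?\<phi>) x *\<^sub>R (\<i> * u x))) \<le> 1 * norm (cls u)"
      by (intro norm_cls_bound u2 test_fun_L2 t)
        (auto simp: norm_mult intro!: mult_left_le_one_le abs_pdiff2_multiplier_le)
    then show ?thesis
      using norm_cauchy_schwarz[of "cls P" "cls (\<lambda>x. pdiff j (pdiff j ?\<phi>) x *\<^sub>R (\<i> * u x))"]
      by (simp add: order_trans[OF _ mult_left_mono])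
  qed
  ultimately show ?thesis by linarith
qed

subsection \<open>The graph of the Landau Hamiltonian\<close>

lemma landau_expr_eq_mom:
  "landau_expr B u = (\<lambda>x. mom (\<lambda>x. B / 2 * x $ 2) 1 (mom (\<lambda>x. B / 2 * x $ 2) 1 u) x
    + mom (\<lambda>x. - (B / 2) * x $ 1) 2 (mom (\<lambda>x. - (B / 2) * x $ 1) 2 u) x)"
  by (simp add: landau_expr_def momentum_eq_mom fun_eq_iff)

lemma smooth_gauge: "smooth (\<lambda>x::real^2. c * x $ j :: real)"
  by (intro smooth_mult smooth_const smooth_nth)

lemma pdiff_gauge: "pdiff k (\<lambda>x::real^2. c * x $ j) x = (if j = k then c else (0::real))"
  using pdiff_mult[of "\<lambda>_. c" "\<lambda>x::real^2. x $ j" k x] by simp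

lemma test_fun_landau_expr: "test_fun u \<Longrightarrow> test_fun (landau_expr B u)"
  unfolding landau_expr_eq_mom by (intro test_fun_add test_fun_mom smooth_gauge)

lemma landau_expr_add:
  assumes "smooth u" "smooth v"
  shows "landau_expr B (\<lambda>x. u x + v x) = (\<lambda>x. landau_expr B u x + landau_expr B v x)"
  unfolding landau_expr_eq_mom mom_add[OF assms]
    mom_add[OF smooth_mom[OF smooth_gauge assms(1)] smooth_mom[OF smooth_gauge assms(2)]]
  by (simp only: add_ac)

lemma landau_expr_cmult:
  assumes "smooth u"
  shows "landau_expr B (\<lambda>x. c * u x) = (\<lambda>x. c * landau_expr B u x)"
  unfolding landau_expr_eq_mom mom_cmult[OF assms] mom_cmult[OF smooth_mom[OF smooth_gauge assms]]
  by (simp only: distrib_left)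

text \<open>The operator is moved to classes, where closure, subspaces and completeness are
  available; \<open>landau_graph_iff\<close> leads back to representatives.\<close>

definition landau_core :: "real \<Rightarrow> (l2 \<times> l2) set" where
  "landau_core B = {(cls u, cls (landau_expr B u)) |u. test_fun u}"

definition landau_graph :: "real \<Rightarrow> (l2 \<times> l2) set" where
  "landau_graph B = closure (landau_core B)"

lemma tendsto_Pair_iff:
  "((\<lambda>k. (f k, g k)) \<longlongrightarrow> (a, b)) F \<longleftrightarrow> (f \<longlongrightarrow> a) F \<and> (g \<longlongrightarrow> b) F"
  using tendsto_fst[of "\<lambda>k. (f k, g k)" "(a, b)" F] tendsto_snd[of "\<lambda>k. (f k, g k)" "(a, b)" F]
  by (auto intro: tendsto_Pair)

lemma landau_graph_iff:
  assumes "u \<in> L2" "f \<in> L2"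
  shows "(u, f) \<in> landau_hamiltonian B \<longleftrightarrow> (cls u, cls f) \<in> landau_graph B"
proof -
  have lim: "((\<lambda>k. L2norm (\<lambda>x. v k x - w x)) \<longlonglongrightarrow> 0) = ((\<lambda>k. cls (v k)) \<longlonglongrightarrow> cls w)"
    if "\<And>k. v k \<in> L2" "w \<in> L2" for v :: "nat \<Rightarrow> real^2 \<Rightarrow> complex" and w
    unfolding norm_cls[symmetric, OF L2_diff[OF that]] cls_diff[OF that] tendsto_norm_zero_iff LIM_zero_iff ..
  have "(cls u, cls f) \<in> landau_graph B \<longleftrightarrow>
    (\<exists>X. (\<forall>k. X k \<in> landau_core B) \<and> X \<longlonglongrightarrow> (cls u, cls f))"
    by (simp add: landau_graph_def closure_sequential)
  also have "\<dots> \<longleftrightarrow> (\<exists>\<phi>. (\<forall>k. test_fun (\<phi> k)) \<and>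
      (\<lambda>k. (cls (\<phi> k), cls (landau_expr B (\<phi> k)))) \<longlonglongrightarrow> (cls u, cls f))"
  proof
    assume "\<exists>X. (\<forall>k. X k \<in> landau_core B) \<and> X \<longlonglongrightarrow> (cls u, cls f)"
    then obtain X where X: "\<And>k. X k \<in> landau_core B" "X \<longlonglongrightarrow> (cls u, cls f)" by blast
    from X(1) have "\<forall>k. \<exists>v. X k = (cls v, cls (landau_expr B v)) \<and> test_fun v"
      by (force simp: landau_core_def)
    then obtain \<phi> where \<phi>: "\<And>k. X k = (cls (\<phi> k), cls (landau_expr B (\<phi> k)))" "\<And>k. test_fun (\<phi> k)"
      by metis
    with X(2) show "\<exists>\<phi>. (\<forall>k. test_fun (\<phi> k)) \<and>
      (\<lambda>k. (cls (\<phi> k), cls (landau_expr B (\<phi> k)))) \<longlonglongrightarrow> (cls u, cls f)"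
      by (intro exI[of _ \<phi>]) (simp flip: \<phi>(1))
  qed (force simp: landau_core_def)
  also have "\<dots> \<longleftrightarrow> (\<exists>\<phi>. (\<forall>k. test_fun (\<phi> k)) \<and>
      (\<lambda>k. cls (\<phi> k)) \<longlonglongrightarrow> cls u \<and> (\<lambda>k. cls (landau_expr B (\<phi> k))) \<longlonglongrightarrow> cls f)"
    by (simp only: tendsto_Pair_iff)
  also have "\<dots> \<longleftrightarrow> (u, f) \<in> landau_hamiltonian B"
    unfolding landau_hamiltonian_def using assms
    by (auto simp: lim test_fun_L2 test_fun_landau_expr cong: conj_cong)
  finally show ?thesis by blast
qed

lemma subspace_landau_core: "subspace (landau_core B)"
  unfolding subspace_def
proof (intro conjI ballI allI)
  have "test_fun (\<lambda>x::real^2. 0 :: complex)"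
    by (rule test_funI[of _ "{}"]) auto
  moreover have "landau_expr B (\<lambda>x. 0) = (\<lambda>x. 0)"
    using landau_expr_cmult[of "\<lambda>x. 0" B 0] by simp
  ultimately show "0 \<in> landau_core B"
    by (force simp: landau_core_def cls_zero zero_prod_def)
next
  fix X Y assume "X \<in> landau_core B" "Y \<in> landau_core B"
  then obtain u v where uv: "test_fun u" "X = (cls u, cls (landau_expr B u))"
    "test_fun v" "Y = (cls v, cls (landau_expr B v))"
    by (auto simp: landau_core_def)
  then have "X + Y = (cls (\<lambda>x. u x + v x), cls (landau_expr B (\<lambda>x. u x + v x)))"
    by (simp add: landau_expr_add cls_add test_fun_L2 test_fun_landau_expr test_fun_smooth)
  then show "X + Y \<in> landau_core B"
    using uv test_fun_add by (force simp: landau_core_def)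
next
  fix X c assume "X \<in> landau_core B"
  then obtain u where u: "test_fun u" "X = (cls u, cls (landau_expr B u))"
    by (auto simp: landau_core_def)
  then have "c *\<^sub>R X = (cls (\<lambda>x. complex_of_real c * u x), cls (landau_expr B (\<lambda>x. complex_of_real c * u x)))"
    by (simp add: landau_expr_cmult cls_cmult_of_real test_fun_L2 test_fun_landau_expr test_fun_smooth)
  moreover have "test_fun (\<lambda>x. complex_of_real c * u x)"
    by (intro test_fun_mult smooth_const u)
  ultimately show "c *\<^sub>R X \<in> landau_core B"
    by (force simp: landau_core_def)
qed

lemma subspace_closure:
  fixes S :: "'a::real_normed_vector set"
  assumes "subspace S" shows "subspace (closure S)"
  unfolding subspace_def
proof (intro conjI ballI allI)
  show "0 \<in> closure S"
    using subspace_0[OF assms] closure_subset by blast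
  fix x y c assume x: "x \<in> closure S"
  then obtain X where X: "\<And>n. X n \<in> S" "X \<longlonglongrightarrow> x"
    by (auto simp: closure_sequential)
  show "c *\<^sub>R x \<in> closure S"
    unfolding closure_sequential
    using X subspace_scale[OF assms] by (intro exI[of _ "\<lambda>n. c *\<^sub>R X n"]) (auto intro!: tendsto_intros)
  assume "y \<in> closure S"
  then obtain Y where Y: "\<And>n. Y n \<in> S" "Y \<longlonglongrightarrow> y"
    by (auto simp: closure_sequential)
  show "x + y \<in> closure S"
    unfolding closure_sequential
    using X Y subspace_add[OF assms] by (intro exI[of _ "\<lambda>n. X n + Y n"]) (auto intro!: tendsto_intros)
qed

lemma subspace_landau_graph: "subspace (landau_graph B)"
  unfolding landau_graph_def by (intro subspace_closure subspace_landau_core)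

lemma closed_landau_graph: "closed (landau_graph B)"
  by (simp add: landau_graph_def)

lemma landau_core_symmetric:
  assumes "(X, Y) \<in> landau_core B" "(X', Y') \<in> landau_core B"
  shows "Y \<bullet> X' = X \<bullet> Y'"
proof -
  obtain u v where t: "test_fun u" "test_fun v" "X = cls u" "X' = cls v"
    "Y = cls (landau_expr B u)" "Y' = cls (landau_expr B v)"
    using assms by (auto simp: landau_core_def)
  have L: "mom (\<lambda>x. c * x $ i) j (mom (\<lambda>x. c * x $ i) j w) \<in> L2" if "test_fun w" for c i j w
    by (intro test_fun_L2 test_fun_mom smooth_gauge that)
  have s: "cls (mom (\<lambda>x. c * x $ i) j (mom (\<lambda>x. c * x $ i) j u)) \<bullet> cls v
      = cls u \<bullet> cls (mom (\<lambda>x. c * x $ i) j (mom (\<lambda>x. c * x $ i) j v))" for c i j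
    by (simp add: mom_symmetric smooth_gauge t test_fun_mom)
  show ?thesis
    unfolding t landau_expr_eq_mom cls_add[OF L[OF t(1)] L[OF t(1)]] cls_add[OF L[OF t(2)] L[OF t(2)]]
    by (simp only: inner_add_left inner_add_right s)
qed

text \<open>Both sides are continuous in the graph norm, so symmetry extends from the core to its
  closure, one argument at a time.\<close>

lemma landau_graph_symmetric:
  assumes "(X, Y) \<in> landau_graph B" "(X', Y') \<in> landau_graph B"
  shows "Y \<bullet> X' = X \<bullet> Y'"
proof -
  have "landau_graph B \<subseteq> {p. snd p \<bullet> fst q = fst p \<bullet> snd q}" if "q \<in> landau_core B" for q
    unfolding landau_graph_def
    using that landau_core_symmetric[of _ _ B "fst q" "snd q"]
    by (intro closure_minimal closed_Collect_eq continuous_intros) auto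
  then have "landau_core B \<subseteq> {q. Y \<bullet> fst q = X \<bullet> snd q}"
    using assms(1) by fastforce
  then have "landau_graph B \<subseteq> {q. Y \<bullet> fst q = X \<bullet> snd q}"
    unfolding landau_graph_def
    by (intro closure_minimal closed_Collect_eq continuous_intros)
  with assms(2) show ?thesis by fastforce
qed

section \<open>The localization estimate for the closed operator\<close>

lemma indicator_mult_l2:
  assumes "K \<in> sets borel" "u \<in> L2"
  shows "mult_l2 (indicator K) (cls u) = cls (\<lambda>x. indicator K x *\<^sub>R u x)"
  using assms by (intro mult_l2_cls[where C = 1]) (auto simp: indicator_def)

text \<open>Summing \<open>commutator_estimate\<close> over the two momenta controls their weighted
  forms. Moving one momentum across the weight shows that these forms dominate \<open>E\<close>
  times the weighted form of \<open>u\<close>, up to errors linear in the momenta and a term with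
  \<open>h\<close>. On \<open>K\<close> the weight is at least
  \<open>1 / (1 + d\<^sup>2)\<close>.\<close>

lemma landau_core_estimate:
  assumes "B > 0" "E \<ge> 0" and K: "K \<in> sets borel" "\<And>x. x \<in> K \<Longrightarrow> dist x p \<le> d"
    and "(U, F) \<in> landau_core B"
  defines "Q \<equiv> mult_l2 (indicator K)" and "h \<equiv> F - E *\<^sub>R U"
  shows "E * (norm (Q U))\<^sup>2 \<le> (1 + d\<^sup>2) * ((6 * B + 11) * ((1 + d\<^sup>2) * (norm (Q h))\<^sup>2
    + (norm (h - Q h) + norm U) * sqrt (E * (norm U)\<^sup>2 + norm h * norm U) + norm h * norm U))"
proof -
  define a b where "a = (\<lambda>x::real^2. B / 2 * x $ 2)" and "b = (\<lambda>x::real^2. - (B / 2) * x $ 1)"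
  have ab: "smooth a" "smooth b" unfolding a_def b_def by (intro smooth_gauge)+
  obtain u where u: "test_fun u" and U: "U = cls u" and F: "F = cls (landau_expr B u)"
    using assms(5) by (auto simp: landau_core_def)
  define w1 w2 where "w1 = mom a 1 u" and "w2 = mom b 2 u"
  define H where "H x = mom a 1 w1 x + mom b 2 w2 x" for x
  have Hl: "landau_expr B u = H"
    unfolding H_def[abs_def] w1_def w2_def a_def b_def by (rule landau_expr_eq_mom)
  define g where "g x = H x - complex_of_real E * u x" for x
  have w: "test_fun w1" "test_fun w2" unfolding w1_def w2_def by (intro test_fun_mom ab u)+
  note t = test_fun_i test_fun_scaleR test_fun_mom smooth_pdiff ab u smooth_weight w
  have tH: "test_fun H"
    using test_fun_landau_expr[OF u, of B] by (simp add: Hl)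
  have L: "u \<in> L2" "w1 \<in> L2" "w2 \<in> L2" "H \<in> L2"
    by (intro test_fun_L2 u w tH)+
  have gL: "g \<in> L2" unfolding g_def by (intro L2_diff L2_cmult L)
  have h: "h = cls g"
    unfolding h_def F U Hl g_def by (simp add: cls_diff L L2_cmult cls_cmult_of_real)
  have Qg: "Q (cls g) = cls (\<lambda>x. indicator K x *\<^sub>R g x)" and QU: "Q U = cls (\<lambda>x. indicator K x *\<^sub>R u x)"
    by (simp_all add: Q_def h U indicator_mult_l2 K gL L)
  \<comment> \<open>Energy bound for each momentum: the sum of their squared norms is the quadratic
    form of \<open>H\<close> at \<open>u\<close>.\<close>
  let ?p = "sqrt (E * (norm U)\<^sup>2 + norm h * norm U)"
  let ?W = "\<lambda>f. cls f \<bullet> cls (\<lambda>x. weight p x *\<^sub>R f x)"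
  have H_cls: "cls H = cls (mom a 1 w1) + cls (mom b 2 w2)"
    unfolding H_def[abs_def] by (intro cls_add test_fun_L2 t)
  have H_h: "cls H = E *\<^sub>R U + h"
    by (simp add: h_def F Hl)
  have "(norm (cls w1))\<^sup>2 + (norm (cls w2))\<^sup>2 = cls H \<bullet> U"
  proof -
    have "cls H \<bullet> U = cls w1 \<bullet> cls w1 + cls w2 \<bullet> cls w2"
      unfolding H_cls U inner_add_left
      by (simp add: mom_symmetric ab w u) (simp add: w1_def w2_def)
    then show ?thesis by (simp add: dot_square_norm)
  qed
  also have "\<dots> = E * (norm U)\<^sup>2 + h \<bullet> U"
    unfolding H_h by (simp add: inner_add_left dot_square_norm)
  also have "\<dots> \<le> E * (norm U)\<^sup>2 + norm h * norm U"
    by (simp add: norm_cauchy_schwarz)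
  finally have en: "(norm (cls w1))\<^sup>2 + (norm (cls w2))\<^sup>2 \<le> E * (norm U)\<^sup>2 + norm h * norm U" .
  then have p1: "norm (cls w1) \<le> ?p" and p2: "norm (cls w2) \<le> ?p"
    using zero_le_power2[of "norm (cls w1)"] zero_le_power2[of "norm (cls w2)"]
    by (intro real_le_rsqrt; linarith)+
  have p0: "0 \<le> ?p" using assms(2) by simp
  \<comment> \<open>Exchanging the momenta reverses the sign of the field; the estimate sees its
    modulus only.\<close>
  have c: "pdiff 2 a x - pdiff 1 b x = B" "pdiff 1 b x - pdiff 2 a x = - B" for x
    unfolding a_def b_def pdiff_gauge by simp_all
  have e1: "3 / 2 * ?W w1 \<le> 8 * (1 + d\<^sup>2) * (norm (Q h))\<^sup>2 + 4 * norm (h - Q h) * norm (cls w1)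
      + norm h * norm U + 4 * \<bar>B\<bar> * norm (cls w2) * norm U + norm (cls w1) * norm U"
    unfolding h U Qg w1_def w2_def
    by (rule commutator_estimate[OF ab u _ c(1) gL _ K]) (auto simp: g_def H_def w1_def w2_def)
  have e2: "3 / 2 * ?W w2 \<le> 8 * (1 + d\<^sup>2) * (norm (Q h))\<^sup>2 + 4 * norm (h - Q h) * norm (cls w2)
      + norm h * norm U + 4 * \<bar>- B\<bar> * norm (cls w1) * norm U + norm (cls w2) * norm U"
    unfolding h U Qg w1_def w2_def
    by (rule commutator_estimate[OF ab(2,1) u _ c(2) gL _ K]) (auto simp: g_def H_def w1_def w2_def)
  \<comment> \<open>The magnetic term of either estimate contains the other momentum, hence
    \<open>e2\<close> in the first and \<open>e1\<close> in the second.\<close>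
  have lin: "3 / 2 * (x1 + x2) \<le> 16 * a + 8 * b + 2 * c + 8 * e + 2 * f"
    if "b1 \<le> b" "b2 \<le> b" "f1 \<le> f" "f2 \<le> f" "e1 \<le> e" "e2 \<le> e"
      "3 / 2 * x1 \<le> 8 * a + 4 * b1 + c + 4 * e2 + f1" "3 / 2 * x2 \<le> 8 * a + 4 * b2 + c + 4 * e1 + f2"
    for x1 x2 a b b1 b2 c e e1 e2 f f1 f2 :: real
    using that by (simp add: algebra_simps)
  have "norm (h - Q h) * norm (cls w1) \<le> norm (h - Q h) * ?p"
    "norm (h - Q h) * norm (cls w2) \<le> norm (h - Q h) * ?p"
    by (intro mult_left_mono p1 p2 norm_ge_zero)+
  moreover have pU: "norm (cls w1) * norm U \<le> ?p * norm U" "norm (cls w2) * norm U \<le> ?p * norm U"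
    by (intro mult_right_mono p1 p2 norm_ge_zero)+
  moreover have "B * (norm (cls w1) * norm U) \<le> B * (?p * norm U)"
    "B * (norm (cls w2) * norm U) \<le> B * (?p * norm U)"
    using \<open>B > 0\<close> by (intro mult_left_mono pU; simp)+
  ultimately have X: "3 / 2 * (?W w1 + ?W w2) \<le> 16 * ((1 + d\<^sup>2) * (norm (Q h))\<^sup>2)
      + 8 * (norm (h - Q h) * ?p) + 2 * (norm h * norm U) + 8 * (B * (?p * norm U)) + 2 * (?p * norm U)"
    using e1 e2 unfolding abs_minus_cancel abs_of_pos[OF \<open>B > 0\<close>] mult.assoc by (rule lin)
  let ?N = "cls (\<lambda>x. weight p x *\<^sub>R u x)"
  have N: "norm ?N \<le> 1 * norm U"
    unfolding U by (intro norm_cls_bound L test_fun_L2 t)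
      (auto intro!: mult_left_le_one_le simp: weight_le_1 abs_of_pos[OF weight_pos] less_imp_le[OF weight_pos])
  have part: "cls (mom a' j w) \<bullet> ?N \<le> ?W w + norm (cls w) * norm U"
    if "smooth a'" "w = mom a' j u" for a' j w
  proof -
    have tw: "test_fun w" unfolding that(2) by (intro test_fun_mom that(1) u)
    have "cls (mom a' j w) \<bullet> ?N = cls w \<bullet> cls (mom a' j (\<lambda>x. weight p x *\<^sub>R u x))"
      by (intro mom_symmetric tw that t)
    also have "mom a' j (\<lambda>x. weight p x *\<^sub>R u x) = (\<lambda>x. weight p x *\<^sub>R w x - pdiff j (weight p) x *\<^sub>R (\<i> * u x))"
      unfolding that(2) by (intro mom_scaleR smooth_weight test_fun_smooth u)
    also have "cls \<dots> = cls (\<lambda>x. weight p x *\<^sub>R w x) - cls (\<lambda>x. pdiff j (weight p) x *\<^sub>R (\<i> * u x))"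
      by (intro cls_diff test_fun_L2 t tw)
    finally have "cls (mom a' j w) \<bullet> ?N = ?W w - cls w \<bullet> cls (\<lambda>x. pdiff j (weight p) x *\<^sub>R (\<i> * u x))"
      by (simp only: inner_diff_right)
    moreover have "\<bar>cls w \<bullet> cls (\<lambda>x. pdiff j (weight p) x *\<^sub>R (\<i> * u x))\<bar> \<le> norm (cls w) * norm U"
    proof -
      have "norm (cls (\<lambda>x. pdiff j (weight p) x *\<^sub>R (\<i> * u x))) \<le> 1 * norm U"
        unfolding U by (intro norm_cls_bound L test_fun_L2 t)
          (auto simp: norm_mult intro!: mult_left_le_one_le abs_pdiff_weight_le)
      then show ?thesis
        using Cauchy_Schwarz_ineq2[of "cls w" "cls (\<lambda>x. pdiff j (weight p) x *\<^sub>R (\<i> * u x))"]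
        by (simp add: order_trans[OF _ mult_left_mono])
    qed
    ultimately show ?thesis by linarith
  qed
  \<comment> \<open>The equation \<open>H u = E u + h\<close> is paired with the weighted
    \<open>u\<close>.\<close>
  have "E * ?W u = cls H \<bullet> ?N - h \<bullet> ?N"
    by (simp add: H_h inner_add_left U)
  also have "\<dots> \<le> ?W w1 + ?W w2 + norm (cls w1) * norm U + norm (cls w2) * norm U + norm h * norm U"
  proof -
    have "- (h \<bullet> ?N) \<le> norm h * norm ?N"
      using Cauchy_Schwarz_ineq2[of h ?N] by linarith
    also have "\<dots> \<le> norm h * norm U"
      using N by (intro mult_left_mono) simp_all
    finally show ?thesis
      using part[OF ab(1) w1_def] part[OF ab(2) w2_def] by (simp add: H_cls inner_add_left)
  qed
  also have "\<dots> \<le> ?W w1 + ?W w2 + 2 * (?p * norm U) + norm h * norm U"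
    using pU by linarith
  also have "\<dots> \<le> (6 * B + 11) * ((1 + d\<^sup>2) * (norm (Q h))\<^sup>2 + (norm (h - Q h) + norm U) * ?p + norm h * norm U)"
  proof -
    have nn: "0 \<le> (1 + d\<^sup>2) * (norm (Q h))\<^sup>2" "0 \<le> norm (h - Q h) * ?p" "0 \<le> ?p * norm U" "0 \<le> norm h * norm U"
      using p0 by simp_all
    \<comment> \<open>Origin of the constant: dividing by \<open>3 / 2\<close> gives
      \<open>a\<close> the coefficient 32/3, at most 11, and \<open>B * e\<close> the coefficient
      16/3, at most 6; the other coefficients are smaller than 11.\<close>
    have "x + 2 * e + c \<le> (6 * B + 11) * (a + (b + e) + c)"
      if "3 / 2 * x \<le> 16 * a + 8 * b + 2 * c + 8 * (B * e) + 2 * e" "0 \<le> a" "0 \<le> b" "0 \<le> e" "0 \<le> c"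
      for a b c e x
    proof -
      have "0 \<le> B * a" "0 \<le> B * b" "0 \<le> B * c" "0 \<le> B * e"
        using that \<open>B > 0\<close> by simp_all
      with that show ?thesis by (simp add: algebra_simps)
    qed
    moreover have "(norm (h - Q h) + norm U) * ?p = norm (h - Q h) * ?p + ?p * norm U"
      by (simp only: distrib_right mult.commute)
    ultimately show ?thesis
      using X nn by (simp only:)
  qed
  finally have Eu: "E * ?W u \<le> (6 * B + 11) * ((1 + d\<^sup>2) * (norm (Q h))\<^sup>2
    + (norm (h - Q h) + norm U) * ?p + norm h * norm U)" .
  have "(norm (Q U))\<^sup>2 \<le> (1 + d\<^sup>2) * ?W u"
  proof -
    have i: "(\<lambda>x. indicator K x *\<^sub>R u x) \<in> L2"
      using K(1) by (intro L2_bounded_mult[where C = 1]) (auto simp: L indicator_def)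
    have wu: "(\<lambda>x. weight p x *\<^sub>R u x) \<in> L2" by (intro test_fun_L2 t)
    have "Q U \<bullet> Q U \<le> cls u \<bullet> cls (\<lambda>x. (1 + d\<^sup>2) *\<^sub>R (weight p x *\<^sub>R u x))"
      unfolding QU
    proof (intro inner_cls_mono i L L2_scaleR wu)
      fix x
      show "indicator K x *\<^sub>R u x \<bullet> indicator K x *\<^sub>R u x \<le> u x \<bullet> (1 + d\<^sup>2) *\<^sub>R weight p x *\<^sub>R u x"
      proof (cases "x \<in> K")
        case True
        then show ?thesis
          using mult_right_mono[OF weight_lower_bound[OF K(2)[OF True]], of "u x \<bullet> u x"] by simp
      next
        case False
        have "0 \<le> (1 + d\<^sup>2) * (weight p x * (u x \<bullet> u x))"
          by (simp add: add_nonneg_nonneg less_imp_le[OF weight_pos])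
        with False show ?thesis by simp
      qed
    qed
    also have "\<dots> = (1 + d\<^sup>2) * ?W u"
      by (simp only: cls_scaleR[OF wu] inner_scaleR_right)
    finally show ?thesis by (simp add: dot_square_norm)
  qed
  then have "E * (norm (Q U))\<^sup>2 \<le> E * ((1 + d\<^sup>2) * ?W u)"
    by (rule mult_left_mono) (rule assms(2))
  also have "\<dots> = (1 + d\<^sup>2) * (E * ?W u)" by simp
  also have "\<dots> \<le> (1 + d\<^sup>2) * ((6 * B + 11) * ((1 + d\<^sup>2) * (norm (Q h))\<^sup>2
    + (norm (h - Q h) + norm U) * ?p + norm h * norm U))"
    by (rule mult_left_mono[OF Eu]) simp
  finally show ?thesis .
qed

text \<open>Both sides are continuous in the graph norm, so the inequality survives the
  closure.\<close>

lemma landau_graph_estimate: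
  assumes "B > 0" "E \<ge> 0" and K: "K \<in> sets borel" "\<And>x. x \<in> K \<Longrightarrow> dist x p \<le> d"
    and "(U, F) \<in> landau_graph B"
  defines "Q \<equiv> mult_l2 (indicator K)" and "h \<equiv> F - E *\<^sub>R U"
  shows "E * (norm (Q U))\<^sup>2 \<le> (1 + d\<^sup>2) * ((6 * B + 11) * ((1 + d\<^sup>2) * (norm (Q h))\<^sup>2
    + (norm (h - Q h) + norm U) * sqrt (E * (norm U)\<^sup>2 + norm h * norm U) + norm h * norm U))"
proof -
  have bl: "bounded_linear Q"
    unfolding Q_def using K(1) by (intro bounded_linear_mult_l2[where C = 1]) (auto simp: indicator_def)
  note cont = bounded_linear.continuous_on[OF bl]
  have "landau_graph B \<subseteq> {q. E * (norm (Q (fst q)))\<^sup>2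
    \<le> (1 + d\<^sup>2) * ((6 * B + 11) * ((1 + d\<^sup>2) * (norm (Q (snd q - E *\<^sub>R fst q)))\<^sup>2
      + (norm (snd q - E *\<^sub>R fst q - Q (snd q - E *\<^sub>R fst q)) + norm (fst q))
        * sqrt (E * (norm (fst q))\<^sup>2 + norm (snd q - E *\<^sub>R fst q) * norm (fst q))
      + norm (snd q - E *\<^sub>R fst q) * norm (fst q)))}" (is "_ \<subseteq> ?S")
    unfolding landau_graph_def
  proof (rule closure_minimal)
    show "closed ?S"
      by (intro closed_Collect_le continuous_intros cont)
    show "landau_core B \<subseteq> ?S"
      using landau_core_estimate[OF assms(1,2) K] unfolding Q_def by fastforce
  qed
  with assms(5) show ?thesis
    unfolding h_def by fastforce
qed

subsection \<open>Perturbation of a localized resolvent\<close>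

text \<open>Surjectivity and the bound make \<open>T - E\<close> invertible with inverse of norm at
  most \<open>1 / \<delta>\<close>. The condition \<open>\<delta> \<le> 1\<close> lets
  \<open>norm h\<close> be replaced by \<open>norm h / \<delta>\<close>, so that all terms can be
  compared in the same power of \<open>1 / \<delta>\<close>.\<close>

locale symmetric_resolvent =
  fixes T :: "('a::{real_inner, complete_space} \<times> 'a) set" and E \<delta> :: real
  assumes subspace_T: "subspace T"
    and symmetric_T: "\<And>u f v g. (u, f) \<in> T \<Longrightarrow> (v, g) \<in> T \<Longrightarrow> f \<bullet> v = u \<bullet> g"
    and surjective_T: "\<And>g. \<exists>u f. (u, f) \<in> T \<and> f - E *\<^sub>R u = g"
    and \<delta>: "0 < \<delta>" "\<delta> \<le> 1"
    and resolvent_bound: "\<And>u f. (u, f) \<in> T \<Longrightarrow> \<delta> * norm u \<le> norm (f - E *\<^sub>R u)"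
begin

lemma T_diff:
  assumes "(u, f) \<in> T" "(v, g) \<in> T" shows "(u - v, f - g) \<in> T"
  using subspace_diff[OF subspace_T assms] by simp

lemma T_unique:
  assumes "(u, f) \<in> T" "(v, g) \<in> T" "f - E *\<^sub>R u = g - E *\<^sub>R v"
  shows "u = v"
proof -
  have "(f - g) - E *\<^sub>R (u - v) = 0"
    using assms(3) by (simp add: algebra_simps)
  then have "\<delta> * norm (u - v) \<le> 0"
    using resolvent_bound[OF T_diff[OF assms(1,2)]] by simp
  then show ?thesis
    using \<delta> by (simp add: mult_le_0_iff)
qed

end

text \<open>\<open>local\<close> says that the compression of the resolvent by the projection \<open>Q\<close> is small when \<open>E\<close>
  is large; applied to an arbitrary right-hand side, to the adjoint, and once more to a right-hand side in the
  range of \<open>Q\<close>, it bounds \<open>Q R Q\<close> by a multiple of \<open>1 / (sqrt E * \<delta>)\<close>.\<close>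

locale localized_resolvent = symmetric_resolvent T E \<delta>
  for T :: "('a::{real_inner, complete_space} \<times> 'a) set" and E \<delta> +
  fixes Q :: "'a \<Rightarrow> 'a" and k c :: real
  assumes linear_Q: "linear Q" and idem_Q: "\<And>x. Q (Q x) = Q x" and sym_Q: "\<And>x y. Q x \<bullet> y = x \<bullet> Q y"
    and E: "1 \<le> E" and k: "1 \<le> k" and c: "1 \<le> c"
    and local: "\<And>u f. (u, f) \<in> T \<Longrightarrow> E * (norm (Q u))\<^sup>2 \<le> k * (c * (k * (norm (Q (f - E *\<^sub>R u)))\<^sup>2
      + (norm (f - E *\<^sub>R u - Q (f - E *\<^sub>R u)) + norm u)
          * sqrt (E * (norm u)\<^sup>2 + norm (f - E *\<^sub>R u) * norm u)
      + norm (f - E *\<^sub>R u) * norm u))"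
begin

lemma norm_Q: "norm (Q x) \<le> norm x" and norm_compl_Q: "norm (x - Q x) \<le> norm x"
proof -
  have o: "Q x \<bullet> (x - Q x) = 0"
    by (simp add: inner_diff_right sym_Q[of x "Q x"] idem_Q inner_commute)
  have "(norm x)\<^sup>2 = (norm (Q x + (x - Q x)))\<^sup>2" by simp
  also have "\<dots> = (norm (Q x))\<^sup>2 + (norm (x - Q x))\<^sup>2"
    by (rule norm_add_Pythagorean) (simp add: orthogonal_def o)
  finally have "(norm x)\<^sup>2 = (norm (Q x))\<^sup>2 + (norm (x - Q x))\<^sup>2" .
  then have "(norm (Q x))\<^sup>2 \<le> (norm x)\<^sup>2" "(norm (x - Q x))\<^sup>2 \<le> (norm x)\<^sup>2"
    by simp_all
  then show "norm (Q x) \<le> norm x" "norm (x - Q x) \<le> norm x"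
    by (auto intro: power2_le_imp_le[OF _ norm_ge_zero])
qed

text \<open>The three summands of \<open>local\<close> contribute \<open>k\<close>,
  \<open>2 * (3 / 2) = 3\<close> and 1 in the proof of \<open>norm_Q_solution\<close>.\<close>

definition A :: real where "A = k * c * (k + 4)"

lemma sqrtE: "1 \<le> sqrt E" "sqrt E * sqrt E = E"
  using E by simp_all

lemma A_nonneg: "0 \<le> A"
  using k c by (simp add: A_def)

text \<open>Every norm on the right of \<open>local\<close> is replaced by its resolvent bound. The
  middle summand then still contains \<open>sqrt E\<close>, so of the factor \<open>E\<close> on the
  left only its root is gained.\<close>

lemma norm_Q_solution:
  assumes uf: "(u, f) \<in> T" and h: "h = f - E *\<^sub>R u"
  shows "sqrt E * (\<delta>\<^sup>2 * (norm (Q u))\<^sup>2) \<le> A * (norm h)\<^sup>2"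
proof -
  define H N where "H = norm h" and "N = norm u"
  have HN: "0 \<le> H" "0 \<le> N" by (simp_all add: H_def N_def)
  have N: "N \<le> H / \<delta>"
    using resolvent_bound[OF uf] \<delta> by (simp add: H_def N_def h field_simps)
  have Hd: "H \<le> H / \<delta>"
    using \<delta> HN by (simp add: field_simps mult_left_le)
  have d2: "\<delta>\<^sup>2 \<le> 1" using \<delta> by (simp add: power_le_one)
  have Hd2: "H\<^sup>2 \<le> (H / \<delta>)\<^sup>2" using Hd HN by (intro power_mono)
  \<comment> \<open>Each summand is at most \<open>E * (H / \<delta>)\<^sup>2\<close>; their number
    2 is rounded up to the perfect square \<open>9 / 4\<close>.\<close>
  have EN: "E * N\<^sup>2 + H * N \<le> (3 / 2 * (sqrt E * (H / \<delta>)))\<^sup>2"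
  proof -
    have "H * N \<le> (H / \<delta>) * (H / \<delta>)"
      using Hd N HN by (intro mult_mono) auto
    also have "\<dots> \<le> E * (H / \<delta>)\<^sup>2"
      using mult_right_mono[OF E, of "(H / \<delta>)\<^sup>2"] by (simp add: power2_eq_square)
    finally have "H * N \<le> E * (H / \<delta>)\<^sup>2" .
    moreover have "E * N\<^sup>2 \<le> E * (H / \<delta>)\<^sup>2"
      using N HN E by (intro mult_left_mono power_mono) auto
    moreover have "0 \<le> E * (H / \<delta>)\<^sup>2" using E by simp
    ultimately have "E * N\<^sup>2 + H * N \<le> 9 / 4 * (E * (H / \<delta>)\<^sup>2)" by linarith
    also have "\<dots> = (3 / 2 * (sqrt E * (H / \<delta>)))\<^sup>2"
      using E by (simp add: power_mult_distrib power_divide)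
    finally show ?thesis .
  qed
  have sq: "sqrt (E * N\<^sup>2 + H * N) \<le> 3 / 2 * (sqrt E * (H / \<delta>))"
    using E HN \<delta> by (intro real_le_lsqrt EN) auto
  have main: "E * (norm (Q u))\<^sup>2 \<le> k * (c * (k * (norm (Q h))\<^sup>2
      + (norm (h - Q h) + N) * sqrt (E * N\<^sup>2 + H * N) + H * N))"
    using local[OF uf] by (simp add: H_def N_def h)
  also have "\<dots> \<le> k * (c * (k * (sqrt E * (H / \<delta>)\<^sup>2)
      + (2 * (H / \<delta>)) * (3 / 2 * (sqrt E * (H / \<delta>))) + sqrt E * (H / \<delta>)\<^sup>2))"
  proof -
    have s2: "x \<le> sqrt E * x" if "0 \<le> x" for x
      using mult_right_mono[OF sqrtE(1) that] by simp
    have "(norm (Q h))\<^sup>2 \<le> H\<^sup>2"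
      unfolding H_def by (intro power_mono norm_Q) simp
    also have "H\<^sup>2 \<le> sqrt E * (H / \<delta>)\<^sup>2" using Hd2 s2[of "(H / \<delta>)\<^sup>2"] by simp
    finally have 1: "(norm (Q h))\<^sup>2 \<le> sqrt E * (H / \<delta>)\<^sup>2" .
    have "H * N \<le> (H / \<delta>) * (H / \<delta>)"
      using Hd N HN by (intro mult_mono) auto
    then have 2: "H * N \<le> sqrt E * (H / \<delta>)\<^sup>2"
      using s2[of "(H / \<delta>)\<^sup>2"] by (simp add: power2_eq_square)
    have 3: "norm (h - Q h) + N \<le> 2 * (H / \<delta>)"
      using norm_compl_Q[of h] Hd N unfolding H_def by linarith
    have "k * (norm (Q h))\<^sup>2 \<le> k * (sqrt E * (H / \<delta>)\<^sup>2)"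
      using k by (intro mult_left_mono 1) simp
    moreover have "(norm (h - Q h) + N) * sqrt (E * N\<^sup>2 + H * N)
        \<le> (2 * (H / \<delta>)) * (3 / 2 * (sqrt E * (H / \<delta>)))"
      using HN \<delta> E by (intro mult_mono[OF 3 sq]) auto
    ultimately have "k * (norm (Q h))\<^sup>2 + (norm (h - Q h) + N) * sqrt (E * N\<^sup>2 + H * N) + H * N
        \<le> k * (sqrt E * (H / \<delta>)\<^sup>2) + (2 * (H / \<delta>)) * (3 / 2 * (sqrt E * (H / \<delta>))) + sqrt E * (H / \<delta>)\<^sup>2"
      by (intro add_mono 2)
    then show ?thesis
      using k c by (intro mult_left_mono) auto
  qed
  also have "\<dots> = sqrt E * (A * (H / \<delta>)\<^sup>2)"
    by (simp add: A_def power2_eq_square algebra_simps)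
  finally have "sqrt E * (sqrt E * (norm (Q u))\<^sup>2) \<le> sqrt E * (A * (H / \<delta>)\<^sup>2)"
    using sqrtE(2) by (simp flip: mult.assoc)
  then have "sqrt E * (norm (Q u))\<^sup>2 \<le> A * (H / \<delta>)\<^sup>2"
    using sqrtE(1) by simp
  then have "\<delta>\<^sup>2 * (sqrt E * (norm (Q u))\<^sup>2) \<le> \<delta>\<^sup>2 * (A * (H / \<delta>)\<^sup>2)"
    by (rule mult_left_mono) simp
  then show ?thesis
    using \<delta> by (simp add: H_def power_divide algebra_simps)
qed

text \<open>Duality: solve \<open>(T - E) v = u\<close>. By symmetry
  \<open>\<parallel>u\<parallel>\<^sup>2\<close> is the inner product of \<open>h\<close> and
  \<open>v\<close>, and as \<open>h = Q h\<close> only \<open>Q v\<close> matters, which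
  \<open>norm_Q_solution\<close> bounds in terms of \<open>u\<close>.\<close>

lemma norm_solution_localized:
  assumes uf: "(u, f) \<in> T" and h: "h = f - E *\<^sub>R u" and Qh: "Q h = h"
  shows "sqrt E * (\<delta>\<^sup>2 * (norm u)\<^sup>2) \<le> A * (norm h)\<^sup>2"
proof (cases "norm u = 0")
  case True
  then show ?thesis using A_nonneg by simp
next
  case False
  obtain v w where vw: "(v, w) \<in> T" "w - E *\<^sub>R v = u"
    using surjective_T by blast
  have "(norm u)\<^sup>2 = u \<bullet> (w - E *\<^sub>R v)"
    by (simp add: vw(2) dot_square_norm)
  also have "\<dots> = h \<bullet> v"
    by (simp add: h inner_diff_left inner_diff_right symmetric_T[OF uf vw(1)])
  also have "\<dots> = h \<bullet> Q v"
    using sym_Q[of h v] Qh by simp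
  also have "\<dots> \<le> norm h * norm (Q v)" by (rule norm_cauchy_schwarz)
  \<comment> \<open>Squared once more because \<open>norm_Q_solution\<close> is a bound for a
    square.\<close>
  finally have "((norm u)\<^sup>2)\<^sup>2 \<le> (norm h * norm (Q v))\<^sup>2"
    by (intro power_mono) auto
  then have "sqrt E * (\<delta>\<^sup>2 * ((norm u)\<^sup>2)\<^sup>2) \<le> sqrt E * (\<delta>\<^sup>2 * (norm h * norm (Q v))\<^sup>2)"
    using E by (intro mult_left_mono) auto
  also have "\<dots> = (norm h)\<^sup>2 * (sqrt E * (\<delta>\<^sup>2 * (norm (Q v))\<^sup>2))"
    by (simp add: power_mult_distrib)
  also have "\<dots> \<le> (norm h)\<^sup>2 * (A * (norm u)\<^sup>2)"
    using norm_Q_solution[OF vw(1) vw(2)[symmetric]] by (intro mult_left_mono) auto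
  finally have "(norm u)\<^sup>2 * (sqrt E * (\<delta>\<^sup>2 * (norm u)\<^sup>2)) \<le> (norm u)\<^sup>2 * (A * (norm h)\<^sup>2)"
    by (simp add: power2_eq_square mult_ac)
  moreover have "0 < (norm u)\<^sup>2" using False by simp
  ultimately show ?thesis
    by (metis mult_le_cancel_left_pos)
qed

text \<open>By \<open>2 * (H * N) \<le> H\<^sup>2 + N\<^sup>2\<close> the bracket in
  \<open>local\<close> becomes \<open>(k + 1) * H\<^sup>2 + 3 * (sqrt E * N\<^sup>2)\<close>, and
  \<open>norm_solution_localized\<close> replaces the last product by \<open>A * H\<^sup>2\<close>
  once \<open>\<delta>\<^sup>2\<close> is multiplied in.\<close>

definition K :: real where "K = k * c * (k + 1 + 3 * A)"

text \<open>As \<open>h - Q h = 0\<close>, the dominant term left is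
  \<open>sqrt E * (norm u)\<^sup>2\<close>, for which \<open>norm_solution_localized\<close> has
  already gained \<open>sqrt E\<close>; thus the whole factor \<open>E\<close> survives on the
  left.\<close>

lemma norm_Q_solution_localized:
  assumes uf: "(u, f) \<in> T" and h: "h = f - E *\<^sub>R u" and Qh: "Q h = h"
  shows "E * \<delta>\<^sup>2 * (norm (Q u))\<^sup>2 \<le> K * (norm h)\<^sup>2"
proof -
  define H N where "H = norm h" and "N = norm u"
  have HN: "0 \<le> H" "0 \<le> N" by (simp_all add: H_def N_def)
  have hn: "2 * (H * N) \<le> H\<^sup>2 + N\<^sup>2"
    using zero_le_power2[of "H - N"] by (simp add: power2_diff)
  have s2: "N\<^sup>2 \<le> sqrt E * N\<^sup>2"
    using mult_right_mono[OF sqrtE(1), of "N\<^sup>2"] by simp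
  have "E * (norm (Q u))\<^sup>2 \<le> k * (c * (k * H\<^sup>2 + N * sqrt (E * N\<^sup>2 + H * N) + H * N))"
    using local[OF uf] Qh unfolding h[symmetric] by (simp add: H_def N_def)
  also have "\<dots> \<le> k * (c * ((k + 1) * H\<^sup>2 + 3 * (sqrt E * N\<^sup>2)))"
  proof -
    \<comment> \<open>Subadditivity of the root, together with
      \<open>H * N \<le> (H + N)\<^sup>2\<close>.\<close>
    have "sqrt (E * N\<^sup>2 + H * N) \<le> sqrt E * N + (H + N)"
    proof (rule real_le_lsqrt)
      have "H * N \<le> (H + N)\<^sup>2"
        using HN by (simp add: power2_eq_square algebra_simps)
      moreover have "0 \<le> 2 * (sqrt E * N) * (H + N)" using HN E by simp
      moreover have "(sqrt E * N)\<^sup>2 = E * N\<^sup>2" using E by (simp add: power_mult_distrib)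
      ultimately show "E * N\<^sup>2 + H * N \<le> (sqrt E * N + (H + N))\<^sup>2"
        unfolding power2_sum[of "sqrt E * N"] by linarith
    qed (use HN E in auto)
    then have "N * sqrt (E * N\<^sup>2 + H * N) \<le> N * (sqrt E * N + (H + N))"
      using HN by (intro mult_left_mono) auto
    also have "\<dots> = sqrt E * N\<^sup>2 + H * N + N\<^sup>2"
      by (simp add: power2_eq_square algebra_simps)
    finally have "k * H\<^sup>2 + N * sqrt (E * N\<^sup>2 + H * N) + H * N \<le> (k + 1) * H\<^sup>2 + 3 * (sqrt E * N\<^sup>2)"
      using hn s2 by (simp add: distrib_right)
    then show ?thesis
      using k c by (intro mult_left_mono) auto
  qed
  finally have "\<delta>\<^sup>2 * (E * (norm (Q u))\<^sup>2) \<le> \<delta>\<^sup>2 * (k * (c * ((k + 1) * H\<^sup>2 + 3 * (sqrt E * N\<^sup>2))))"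
    by (rule mult_left_mono) simp
  also have "\<dots> = k * (c * ((k + 1) * (\<delta>\<^sup>2 * H\<^sup>2) + 3 * (sqrt E * (\<delta>\<^sup>2 * N\<^sup>2))))"
    by (simp add: algebra_simps)
  also have "\<dots> \<le> k * (c * ((k + 1) * H\<^sup>2 + 3 * (A * H\<^sup>2)))"
  proof -
    have "\<delta>\<^sup>2 * H\<^sup>2 \<le> H\<^sup>2"
      using \<delta> by (intro mult_left_le_one_le) (auto simp: power_le_one)
    moreover have "sqrt E * (\<delta>\<^sup>2 * N\<^sup>2) \<le> A * H\<^sup>2"
      unfolding N_def H_def by (rule norm_solution_localized[OF assms])
    ultimately show ?thesis
      using k c by (intro mult_left_mono add_mono) auto
  qed
  also have "\<dots> = K * H\<^sup>2"
    by (simp add: K_def algebra_simps)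
  finally show ?thesis by (simp add: H_def mult_ac)
qed

text \<open>Let \<open>R\<close> be the inverse of \<open>T - E\<close>. As \<open>V = V Q\<close>,
  solving the perturbed equation means finding \<open>w = Q u\<close> with
  \<open>w = Q R (g - V w)\<close>. The assumption on \<open>E * \<delta>\<^sup>2\<close> says that
  \<open>Q R Q\<close> has norm at most \<open>1 / (2 * s)\<close>, which makes this map a
  contraction with factor \<open>1 / 2\<close>.\<close>

lemma perturbation:
  fixes V :: "'a \<Rightarrow> 'a" and s :: real
  assumes V: "linear V" "\<And>x. V (Q x) = V x" "\<And>x. Q (V x) = V x" "\<And>x. norm (V x) \<le> s * norm x"
    and s: "0 < s" "4 * s\<^sup>2 * K \<le> E * \<delta>\<^sup>2"
  shows "\<exists>u f. (u, f) \<in> T \<and> f + V u - E *\<^sub>R u = g"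
    and "\<exists>C. \<forall>(u, f)\<in>T. norm u \<le> C * norm (f + V u - E *\<^sub>R u)"
proof -
  have half: "s * norm (Q u) \<le> norm h / 2"
    if "(u, f) \<in> T" "h = f - E *\<^sub>R u" "Q h = h" for u f h
  proof -
    have pos: "0 < E * \<delta>\<^sup>2" using E \<delta> by simp
    have "E * \<delta>\<^sup>2 * (4 * (s * norm (Q u))\<^sup>2) = 4 * s\<^sup>2 * (E * \<delta>\<^sup>2 * (norm (Q u))\<^sup>2)"
      by (simp add: power_mult_distrib mult_ac)
    also have "\<dots> \<le> 4 * s\<^sup>2 * (K * (norm h)\<^sup>2)"
      by (intro mult_left_mono norm_Q_solution_localized[OF that]) simp
    also have "\<dots> = 4 * s\<^sup>2 * K * (norm h)\<^sup>2" by simp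
    also have "\<dots> \<le> E * \<delta>\<^sup>2 * (norm h)\<^sup>2"
      by (intro mult_right_mono s) simp
    finally have "4 * (s * norm (Q u))\<^sup>2 \<le> (norm h)\<^sup>2"
      using pos by (simp only: mult_le_cancel_left_pos)
    then have "(s * norm (Q u))\<^sup>2 \<le> (norm h / 2)\<^sup>2"
      by (simp add: power_divide)
    then show ?thesis by (rule power2_le_imp_le) simp
  qed
  obtain R F where R: "\<And>g. (R g, F g) \<in> T" "\<And>g. F g - E *\<^sub>R R g = g"
    using surjective_T by metis
  \<comment> \<open>Choice gives no linearity; additivity follows from uniqueness of
    solutions.\<close>
  have R_diff: "R (x - y) = R x - R y" for x y
  proof (rule T_unique[OF R(1) T_diff[OF R(1) R(1)]])
    show "F (x - y) - E *\<^sub>R R (x - y) = F x - F y - E *\<^sub>R (R x - R y)"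
      using R(2)[of x] R(2)[of y] R(2)[of "x - y"] by (simp add: algebra_simps)
  qed
  have V_half: "norm (Q (R (V w))) \<le> norm w / 2" for w
  proof -
    have "s * norm (Q (R (V w))) \<le> norm (V w) / 2"
      by (rule half[OF R(1)]) (simp_all add: R(2) V(3))
    also have "\<dots> \<le> s * (norm w / 2)" using V(4)[of w] by simp
    finally show ?thesis using s(1) by simp
  qed
  show "\<exists>u f. (u, f) \<in> T \<and> f + V u - E *\<^sub>R u = g"
  proof -
    have "\<exists>!w. Q (R (g - V w)) = w"
    proof (rule banach_fix_type[of "1 / 2"])
      show "\<forall>x y. dist (Q (R (g - V x))) (Q (R (g - V y))) \<le> 1 / 2 * dist x y"
      proof (intro allI)
        fix x y
        have "Q (R (g - V x)) - Q (R (g - V y)) = Q (R (g - V x) - R (g - V y))"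
          by (rule linear_diff[OF linear_Q, symmetric])
        also have "R (g - V x) - R (g - V y) = R (V (y - x))"
          by (simp add: linear_diff[OF V(1)] flip: R_diff)
        finally show "dist (Q (R (g - V x))) (Q (R (g - V y))) \<le> 1 / 2 * dist x y"
          using V_half[of "y - x"] by (simp add: dist_norm norm_minus_commute)
      qed
    qed simp_all
    then obtain w where w: "Q (R (g - V w)) = w" by blast
    \<comment> \<open>\<open>V\<close> sees only the projected part of the solution, and this is the
      fixed point.\<close>
    have "V (R (g - V w)) = V w"
      using V(2)[of "R (g - V w)"] by (simp add: w)
    then have "F (g - V w) + V (R (g - V w)) - E *\<^sub>R R (g - V w) = g"
      using R(2)[of "g - V w"] by (simp add: algebra_simps)
    then show ?thesis
      using R(1)[of "g - V w"] by blast
  qed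
  show "\<exists>C. \<forall>(u, f)\<in>T. norm u \<le> C * norm (f + V u - E *\<^sub>R u)"
  proof (intro exI[of _ "(1 + s * (2 / \<delta>)) / \<delta>"] ballI, clarify)
    fix u f assume uf: "(u, f) \<in> T"
    define G where "G = f + V u - E *\<^sub>R u"
    have h: "f - E *\<^sub>R u = G - V (Q u)"
      by (simp add: G_def V(2))
    have u: "u = R G - R (V (Q u))"
    proof (rule T_unique[OF uf T_diff[OF R(1) R(1)]])
      show "f - E *\<^sub>R u = F G - F (V (Q u)) - E *\<^sub>R (R G - R (V (Q u)))"
        using R(2)[of G] R(2)[of "V (Q u)"] by (simp add: h algebra_simps)
    qed
    \<comment> \<open>The contraction bounds \<open>Q u\<close> first; the resolvent bound then
      recovers all of \<open>u\<close>, whence the nested form of the constant.\<close>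
    have "Q u = Q (R G) - Q (R (V (Q u)))"
      by (subst u) (rule linear_diff[OF linear_Q])
    then have "norm (Q u) \<le> norm (Q (R G)) + norm (Q (R (V (Q u))))"
      by (metis norm_triangle_ineq4)
    also have "\<dots> \<le> norm (R G) + norm (Q u) / 2"
      by (intro add_mono norm_Q V_half)
    finally have "norm (Q u) \<le> 2 * norm (R G)" by simp
    also have "\<dots> \<le> 2 / \<delta> * norm G"
      using resolvent_bound[OF R(1)[of G]] \<delta> by (simp add: R(2) field_simps)
    finally have Qu: "norm (Q u) \<le> 2 / \<delta> * norm G" .
    have "\<delta> * norm u \<le> norm (G - V (Q u))"
      using resolvent_bound[OF uf] by (simp add: h)
    also have "\<dots> \<le> norm G + s * norm (Q u)"
      using norm_triangle_ineq4[of G "V (Q u)"] V(4)[of "Q u"] by linarith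
    also have "\<dots> \<le> norm G + s * (2 / \<delta> * norm G)"
      using Qu s(1) by (intro add_left_mono mult_left_mono) auto
    also have "\<dots> = (1 + s * (2 / \<delta>)) * norm G"
      by (simp add: algebra_simps)
    finally have "norm u \<le> (1 + s * (2 / \<delta>)) * norm G / \<delta>"
      using \<delta> by (simp add: pos_le_divide_eq mult.commute)
    then show "norm u \<le> (1 + s * (2 / \<delta>)) / \<delta> * norm (f + V u - E *\<^sub>R u)"
      by (simp add: G_def)
  qed
qed

end

subsection \<open>Smooth functions in the domain\<close>

lemma L2_dominated_convergence:
  assumes v: "\<And>k. v k \<in> borel_measurable borel" and v': "v' \<in> borel_measurable borel" and w: "w \<in> L2"
    and dom: "\<And>k x. cmod (v k x) \<le> cmod (w x)" and lim: "\<And>x. (\<lambda>k. v k x) \<longlonglongrightarrow> v' x"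
  shows "v k \<in> L2" "v' \<in> L2" "(\<lambda>k. cls (v k)) \<longlonglongrightarrow> cls v'"
proof -
  have dom': "cmod (v' x) \<le> cmod (w x)" for x
    by (rule LIMSEQ_le_const2[OF tendsto_norm[OF lim]]) (use dom in blast)
  show vL: "v k \<in> L2" for k
    by (rule L2_bound[OF w v, of _ 1]) (simp add: dom)
  show vL': "v' \<in> L2"
    by (rule L2_bound[OF w v', of 1]) (simp add: dom')
  have "(\<lambda>k. LINT x|lborel. (cmod (v k x - v' x))\<^sup>2) \<longlonglongrightarrow> (LINT x|lborel. (\<lambda>x::real^2. 0::real) x)"
  proof (rule integral_dominated_convergence[where w = "\<lambda>x. 4 * (cmod (w x))\<^sup>2"])
    show "integrable lborel (\<lambda>x. 4 * (cmod (w x))\<^sup>2)"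
      using L2_integrable[OF w] by simp
    show "(\<lambda>x. (cmod (v k x - v' x))\<^sup>2) \<in> borel_measurable lborel" for k
      using v[of k] v' by simp
    show "AE x in lborel. (\<lambda>k. (cmod (v k x - v' x))\<^sup>2) \<longlonglongrightarrow> 0"
    proof (rule AE_I2)
      fix x
      have "(\<lambda>k. (cmod (v k x - v' x))\<^sup>2) \<longlonglongrightarrow> (cmod (v' x - v' x))\<^sup>2"
        by (intro tendsto_intros lim)
      then show "(\<lambda>k. (cmod (v k x - v' x))\<^sup>2) \<longlonglongrightarrow> 0" by simp
    qed
    show "AE x in lborel. norm ((cmod (v k x - v' x))\<^sup>2) \<le> 4 * (cmod (w x))\<^sup>2" for k
    proof (rule AE_I2)
      fix x
      have "cmod (v k x - v' x) \<le> 2 * cmod (w x)"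
        using norm_triangle_ineq4[of "v k x" "v' x"] dom[of k x] dom'[of x] by linarith
      then have "(cmod (v k x - v' x))\<^sup>2 \<le> (2 * cmod (w x))\<^sup>2"
        by (intro power_mono) auto
      then show "norm ((cmod (v k x - v' x))\<^sup>2) \<le> 4 * (cmod (w x))\<^sup>2"
        by (simp add: power_mult_distrib)
    qed
  qed simp
  then have "(\<lambda>k. sqrt (LINT x|lborel. (cmod (v k x - v' x))\<^sup>2)) \<longlonglongrightarrow> sqrt 0"
    by (intro tendsto_real_sqrt) simp
  then have "(\<lambda>k. norm (cls (v k) - cls v')) \<longlonglongrightarrow> 0"
    by (simp add: norm_cls L2norm_def L2_diff vL vL' flip: cls_diff)
  then show "(\<lambda>k. cls (v k)) \<longlonglongrightarrow> cls v'"
    by (simp add: tendsto_norm_zero_iff LIM_zero_iff)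
qed

lemma differentiable_scale:
  assumes "f differentiable (at (c *\<^sub>R x))"
  shows "(\<lambda>x. f (c *\<^sub>R x)) differentiable (at x)"
    and "pdiff j (\<lambda>x. f (c *\<^sub>R x)) x = c *\<^sub>R pdiff j f (c *\<^sub>R x)"
proof -
  obtain f' where f': "(f has_derivative f') (at (c *\<^sub>R x))"
    using assms differentiable_def by blast
  have "((\<lambda>x. c *\<^sub>R x) has_derivative (\<lambda>x. c *\<^sub>R x)) (at x)"
    by (intro derivative_eq_intros) auto
  from diff_chain_at[OF this f'] have d: "((\<lambda>x. f (c *\<^sub>R x)) has_derivative (\<lambda>x. f' (c *\<^sub>R x))) (at x)"
    by (simp add: o_def)
  then show "(\<lambda>x. f (c *\<^sub>R x)) differentiable (at x)"
    unfolding differentiable_def by blast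
  show "pdiff j (\<lambda>x. f (c *\<^sub>R x)) x = c *\<^sub>R pdiff j f (c *\<^sub>R x)"
    by (simp add: pdiff_eqI[OF d] pdiff_eqI[OF f'] linear_cmul[OF has_derivative_linear[OF f']])
qed

lemma pdiff_scale: "smooth f \<Longrightarrow> pdiff j (\<lambda>x. f (c *\<^sub>R x)) = (\<lambda>x. c *\<^sub>R pdiff j f (c *\<^sub>R x))"
  by (intro ext differentiable_scale smooth_differentiable)

lemma csm_scale: "csm n f \<Longrightarrow> csm n (\<lambda>x. f (c *\<^sub>R x))"
proof (induction n arbitrary: f)
  case 0
  then show ?case
    by (intro csm_0I differentiable_scale) (rule csm_differentiable)
next
  case (Suc n)
  have "pdiff j (\<lambda>x. f (c *\<^sub>R x)) = (\<lambda>x. c *\<^sub>R pdiff j f (c *\<^sub>R x))" for j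
    by (intro ext differentiable_scale csm_differentiable[OF Suc.prems])
  moreover have "csm n (\<lambda>x. c *\<^sub>R pdiff j f (c *\<^sub>R x))" for j
    using Suc by (intro csm_linear[OF bounded_linear_scaleR_right] Suc.IH) simp
  ultimately show ?case
    by (intro csm_SucI differentiable_scale csm_differentiable[OF Suc.prems]) simp
qed

lemma smooth_scale: "smooth f \<Longrightarrow> smooth (\<lambda>x. f (c *\<^sub>R x))"
  by (simp add: smooth_iff_csm csm_scale)

lemma test_fun_bump: "test_fun (bump :: real^'n::finite \<Rightarrow> real)"
  by (rule test_funI[OF smooth_bump, of "cball 0 1"]) (auto intro: bump_eq_0)

text \<open>Leibniz rule of second order: every term but the first carries a derivative of
  \<open>\<phi>\<close>, which is small when \<open>\<phi>\<close> is a slowly varying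
  cutoff.\<close>

lemma mom_mom_scaleR:
  assumes "smooth a" "smooth \<phi>" "smooth u"
  shows "mom a j (mom a j (\<lambda>x. \<phi> x *\<^sub>R u x))
    = (\<lambda>x. \<phi> x *\<^sub>R mom a j (mom a j u) x - 2 * \<i> * complex_of_real (pdiff j \<phi> x) * mom a j u x
      - complex_of_real (pdiff j (pdiff j \<phi>) x) * u x)"
proof (rule ext)
  fix x
  have s: "smooth (\<lambda>x. \<phi> x *\<^sub>R mom a j u x)" "smooth (\<lambda>x. pdiff j \<phi> x *\<^sub>R (\<i> * u x))"
    by (intro smooth_scaleR smooth_mom smooth_mult smooth_pdiff smooth_const assms)+
  have "mom a j (\<lambda>x. \<phi> x *\<^sub>R mom a j u x - pdiff j \<phi> x *\<^sub>R (\<i> * u x)) x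
      = mom a j (\<lambda>x. \<phi> x *\<^sub>R mom a j u x) x - mom a j (\<lambda>x. pdiff j \<phi> x *\<^sub>R (\<i> * u x)) x"
    using s by (simp add: mom_def pdiff_diff smooth_differentiable right_diff_distrib)
  also have "\<dots> = \<phi> x *\<^sub>R mom a j (mom a j u) x - pdiff j \<phi> x *\<^sub>R (\<i> * mom a j u x)
      - (pdiff j \<phi> x *\<^sub>R (\<i> * mom a j u x) + pdiff j (pdiff j \<phi>) x *\<^sub>R u x)"
    by (simp only: mom_i_scaleR[OF smooth_pdiff[OF assms(2)] assms(3)]
        mom_scaleR[OF assms(2) smooth_mom[OF assms(1,3)]])
  finally show "mom a j (mom a j (\<lambda>x. \<phi> x *\<^sub>R u x)) x
    = \<phi> x *\<^sub>R mom a j (mom a j u) x - 2 * \<i> * complex_of_real (pdiff j \<phi> x) * mom a j u x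
      - complex_of_real (pdiff j (pdiff j \<phi>) x) * u x"
    unfolding mom_scaleR[OF assms(2,3)] by (simp add: scaleR_conv_of_real)
qed

text \<open>The cutoffs \<open>bump (\<epsilon> *\<^sub>R x)\<close> turn \<open>u\<close> into test
  functions. The extra terms carry a factor \<open>\<epsilon>\<close> or
  \<open>\<epsilon>\<^sup>2\<close>, and what they multiply is square integrable by assumption, so
  dominated convergence applies.\<close>

lemma landau_graph_cutoff:
  assumes u: "smooth u" "u \<in> L2" "momentum1 B u \<in> L2" "momentum2 B u \<in> L2" "landau_expr B u \<in> L2"
  shows "(cls u, cls (landau_expr B u)) \<in> landau_graph B"
proof -
  define a b where "a = (\<lambda>x::real^2. B / 2 * x $ 2)" and "b = (\<lambda>x::real^2. - (B / 2) * x $ 1)"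
  have ab: "smooth a" "smooth b" unfolding a_def b_def by (intro smooth_gauge)+
  have m: "momentum1 B = mom a 1" "momentum2 B = mom b 2"
    by (simp_all add: momentum_eq_mom a_def b_def)
  have Lb: "landau_expr B v = (\<lambda>x. mom a 1 (mom a 1 v) x + mom b 2 (mom b 2 v) x)" for v
    unfolding landau_expr_eq_mom a_def b_def ..
  define \<epsilon> where "\<epsilon> n = 1 / real (Suc n)" for n
  have \<epsilon>: "0 < \<epsilon> n" "\<epsilon> n \<le> 1" "\<epsilon> \<longlonglongrightarrow> 0" for n
  proof -
    show "\<epsilon> \<longlonglongrightarrow> 0"
      using LIMSEQ_inverse_real_of_nat by (simp add: \<epsilon>_def[abs_def] divide_inverse)
  qed (auto simp: \<epsilon>_def)
  define g where "g n x = bump (\<epsilon> n *\<^sub>R x)" for n and x :: "real^2"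
  have g_smooth: "smooth (g n)" for n
    unfolding g_def by (intro smooth_scale smooth_bump)
  have g1: "pdiff j (g n) = (\<lambda>x. \<epsilon> n * pdiff j bump (\<epsilon> n *\<^sub>R x))" for j n
    unfolding g_def[abs_def] by (simp add: pdiff_scale smooth_bump)
  have g2: "pdiff j (pdiff j (g n)) = (\<lambda>x. (\<epsilon> n)\<^sup>2 * pdiff j (pdiff j bump) (\<epsilon> n *\<^sub>R x))" for j n
  proof
    fix x :: "real^2"
    have "pdiff j (\<lambda>x. \<epsilon> n * pdiff j bump (\<epsilon> n *\<^sub>R x)) x = \<epsilon> n * pdiff j (\<lambda>x. pdiff j bump (\<epsilon> n *\<^sub>R x)) x"
      by (intro pdiff_linear bounded_linear_mult_right smooth_differentiable smooth_scale smooth_pdiff smooth_bump)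
    then show "pdiff j (pdiff j (g n)) x = (\<epsilon> n)\<^sup>2 * pdiff j (pdiff j bump) (\<epsilon> n *\<^sub>R x)"
      by (simp add: g1 pdiff_scale smooth_pdiff smooth_bump power2_eq_square)
  qed
  obtain M where M: "0 \<le> M" "\<And>x::real^2. \<bar>bump x\<bar> \<le> M" "\<And>j. \<And>x::real^2. \<bar>pdiff j bump x\<bar> \<le> M"
    "\<And>j. \<And>x::real^2. \<bar>pdiff j (pdiff j bump) x\<bar> \<le> M"
  proof -
    have "\<exists>C. \<forall>x. \<bar>f x\<bar> \<le> C" if "test_fun f" for f :: "real^2 \<Rightarrow> real"
      using test_fun_bounded[OF that] by simp
    note bd = this[OF test_fun_bump] this[OF test_fun_pdiff[OF test_fun_bump]]
    have bd2: "\<exists>C. \<forall>x::real^2. \<bar>pdiff j (pdiff j bump) x\<bar> \<le> C" for j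
      by (rule test_fun_bounded[OF test_fun_pdiff[OF test_fun_pdiff[OF test_fun_bump]], unfolded real_norm_def])
    obtain C where C: "\<And>x::real^2. \<bar>bump x\<bar> \<le> C" using bd(1) by blast
    obtain C1 where C1: "\<And>j. \<And>x::real^2. \<bar>pdiff j bump x\<bar> \<le> C1 j" using bd(2) by metis
    obtain C2 where C2: "\<And>j. \<And>x::real^2. \<bar>pdiff j (pdiff j bump) x\<bar> \<le> C2 j" using bd2 by metis
    show thesis
    \<comment> \<open>A sum of nonnegative bounds serves both directions and all orders at
      once.\<close>
    proof (rule that[of "C + (C1 1 + C1 2) + (C2 1 + C2 2)"])
      have nn: "0 \<le> C" "0 \<le> C1 j" "0 \<le> C2 j" for j
        using C[of 0] C1[of j 0] C2[of j 0] by linarith+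
      show "0 \<le> C + (C1 1 + C1 2) + (C2 1 + C2 2)"
        using nn by (intro add_nonneg_nonneg)
      fix x :: "real^2" and j :: 2
      show "\<bar>bump x\<bar> \<le> C + (C1 1 + C1 2) + (C2 1 + C2 2)"
        using C[of x] nn(2)[of 1] nn(2)[of 2] nn(3)[of 1] nn(3)[of 2] by linarith
      have "C1 j \<le> C1 1 + C1 2" "C2 j \<le> C2 1 + C2 2"
        using exhaust_2[of j] nn(2)[of 1] nn(2)[of 2] nn(3)[of 1] nn(3)[of 2] by auto
      then show "\<bar>pdiff j bump x\<bar> \<le> C + (C1 1 + C1 2) + (C2 1 + C2 2)"
        "\<bar>pdiff j (pdiff j bump) x\<bar> \<le> C + (C1 1 + C1 2) + (C2 1 + C2 2)"
        using C1[of j x] C2[of j x] nn(1) nn(2)[of 1] nn(2)[of 2] nn(3)[of 1] nn(3)[of 2] by linarith+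
    qed
  qed
  have gM: "\<bar>g n x\<bar> \<le> M" "\<bar>pdiff j (g n) x\<bar> \<le> M" "\<bar>pdiff j (pdiff j (g n)) x\<bar> \<le> M" for n j x
  proof -
    have "\<bar>\<epsilon> n * pdiff j bump (\<epsilon> n *\<^sub>R x)\<bar> \<le> 1 * M"
      unfolding abs_mult using \<epsilon>(1,2)[of n] by (intro mult_mono M) auto
    moreover have "\<bar>(\<epsilon> n)\<^sup>2 * pdiff j (pdiff j bump) (\<epsilon> n *\<^sub>R x)\<bar> \<le> 1 * M"
      unfolding abs_mult using \<epsilon>(1,2)[of n] by (intro mult_mono M) (auto simp: power_le_one)
    ultimately show "\<bar>pdiff j (g n) x\<bar> \<le> M" "\<bar>pdiff j (pdiff j (g n)) x\<bar> \<le> M"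
      unfolding g2 unfolding g1 by simp_all
    show "\<bar>g n x\<bar> \<le> M" by (simp add: g_def M)
  qed
  have glim: "(\<lambda>n. g n x) \<longlonglongrightarrow> 1" "(\<lambda>n. pdiff j (g n) x) \<longlonglongrightarrow> 0"
      "(\<lambda>n. pdiff j (pdiff j (g n)) x) \<longlonglongrightarrow> 0" for j x
  proof -
    have "(\<lambda>n. \<epsilon> n *\<^sub>R x) \<longlonglongrightarrow> 0 *\<^sub>R x"
      by (intro tendsto_intros \<epsilon>)
    then have lim: "(\<lambda>n. \<epsilon> n *\<^sub>R x) \<longlonglongrightarrow> 0" by simp
    have "(\<lambda>n. f (\<epsilon> n *\<^sub>R x)) \<longlonglongrightarrow> f 0" if "smooth f" for f :: "real^2 \<Rightarrow> real"
      using smooth_continuous[OF that, of UNIV] lim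
      by (intro isCont_tendsto_compose[OF _ lim]) (simp add: continuous_on_eq_continuous_at)
    note * = this[OF smooth_bump] this[OF smooth_pdiff[OF smooth_bump]]
      this[OF smooth_pdiff[OF smooth_pdiff[OF smooth_bump]]]
    show "(\<lambda>n. g n x) \<longlonglongrightarrow> 1" using *(1) by (simp add: g_def)
    have "(\<lambda>n. \<epsilon> n * pdiff j bump (\<epsilon> n *\<^sub>R x)) \<longlonglongrightarrow> 0 * pdiff j bump (0::real^2)"
      by (intro tendsto_mult \<epsilon> *)
    then show "(\<lambda>n. pdiff j (g n) x) \<longlonglongrightarrow> 0" by (simp add: g1)
    have "(\<lambda>n. (\<epsilon> n)\<^sup>2 * pdiff j (pdiff j bump) (\<epsilon> n *\<^sub>R x)) \<longlonglongrightarrow> 0\<^sup>2 * pdiff j (pdiff j bump) (0::real^2)"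
      by (intro tendsto_mult tendsto_power \<epsilon> *)
    then show "(\<lambda>n. pdiff j (pdiff j (g n)) x) \<longlonglongrightarrow> 0" unfolding g2 by simp
  qed
  define \<phi> where "\<phi> n x = g n x *\<^sub>R u x" for n x
  have t\<phi>: "test_fun (\<phi> n)" for n
  proof (rule test_funI[of _ "cball 0 (real (Suc n))"])
    show "smooth (\<phi> n)" unfolding \<phi>_def by (intro smooth_scaleR g_smooth u)
    fix x :: "real^2" assume "x \<notin> cball 0 (real (Suc n))"
    then have "1 \<le> norm (\<epsilon> n *\<^sub>R x)" by (simp add: \<epsilon>_def field_simps)
    then show "\<phi> n x = 0" by (simp add: \<phi>_def g_def bump_eq_0)
  qed simp
  have meas: "f \<in> borel_measurable borel" if "smooth f" for f :: "real^2 \<Rightarrow> complex"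
    by (intro borel_measurable_continuous_onI smooth_continuous that)
  have 1: "(\<lambda>n. cls (\<phi> n)) \<longlonglongrightarrow> cls u"
  proof (rule L2_dominated_convergence(3)[where w = "\<lambda>x. M *\<^sub>R u x"])
    show "cmod (\<phi> n x) \<le> cmod (M *\<^sub>R u x)" for n x
      using gM(1)[of n x] M(1) by (simp add: \<phi>_def mult_right_mono)
    show "(\<lambda>n. \<phi> n x) \<longlonglongrightarrow> u x" for x
      using tendsto_scaleR[OF glim(1) tendsto_const, of x "u x"] by (simp add: \<phi>_def)
  qed (intro meas test_fun_smooth t\<phi> u L2_scaleR)+
  have expr: "landau_expr B (\<phi> n) x = g n x *\<^sub>R landau_expr B u x
      - 2 * \<i> * pdiff 1 (g n) x * mom a 1 u x - 2 * \<i> * pdiff 2 (g n) x * mom b 2 u x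
      - pdiff 1 (pdiff 1 (g n)) x * u x - pdiff 2 (pdiff 2 (g n)) x * u x" for n x
    unfolding Lb \<phi>_def[abs_def] mom_mom_scaleR[OF ab(1) g_smooth u(1)] mom_mom_scaleR[OF ab(2) g_smooth u(1)]
    by (simp add: scaleR_add_right)
  define r where "r x = cmod (landau_expr B u x) + 2 * cmod (mom a 1 u x) + 2 * cmod (mom b 2 u x)
      + cmod (u x) + cmod (u x)" for x
  have r: "(\<lambda>x. complex_of_real (M * r x)) \<in> L2"
  proof -
    have "(\<lambda>x. complex_of_real (cmod (landau_expr B u x)) + (2 * complex_of_real (cmod (mom a 1 u x))
      + (2 * complex_of_real (cmod (mom b 2 u x))
        + (complex_of_real (cmod (u x)) + complex_of_real (cmod (u x)))))) \<in> L2"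
      using u by (intro L2_add L2_cmult L2_cmod) (simp_all add: m)
    from L2_cmult[OF this, of "complex_of_real M"] show ?thesis
      by (simp add: r_def add_ac)
  qed
  have 2: "(\<lambda>n. cls (landau_expr B (\<phi> n))) \<longlonglongrightarrow> cls (landau_expr B u)"
  proof (rule L2_dominated_convergence(3)[OF _ _ r])
    show "landau_expr B (\<phi> n) \<in> borel_measurable borel" for n
      by (intro meas test_fun_smooth test_fun_landau_expr t\<phi>)
    show "landau_expr B u \<in> borel_measurable borel"
      using u(5) by (rule L2_measurable)
    show "(\<lambda>n. landau_expr B (\<phi> n) x) \<longlonglongrightarrow> landau_expr B u x" for x
    proof -
      have "(\<lambda>n. landau_expr B (\<phi> n) x) \<longlonglongrightarrow> 1 *\<^sub>R landau_expr B u x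
        - 2 * \<i> * complex_of_real 0 * mom a 1 u x - 2 * \<i> * complex_of_real 0 * mom b 2 u x
        - complex_of_real 0 * u x - complex_of_real 0 * u x"
        unfolding expr by (intro tendsto_intros glim)
      then show ?thesis by simp
    qed
    show "cmod (landau_expr B (\<phi> n) x) \<le> cmod (complex_of_real (M * r x))" for n x
    proof -
      have tri: "cmod (a - b - c - d - e) \<le> cmod a + cmod b + cmod c + cmod d + cmod e" for a b c d e
        using norm_triangle_ineq4[of a b] norm_triangle_ineq4[of "a - b" c]
          norm_triangle_ineq4[of "a - b - c" d] norm_triangle_ineq4[of "a - b - c - d" e] by linarith
      have "cmod (landau_expr B (\<phi> n) x) \<le> \<bar>g n x\<bar> * cmod (landau_expr B u x)
        + 2 * \<bar>pdiff 1 (g n) x\<bar> * cmod (mom a 1 u x) + 2 * \<bar>pdiff 2 (g n) x\<bar> * cmod (mom b 2 u x)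
        + \<bar>pdiff 1 (pdiff 1 (g n)) x\<bar> * cmod (u x) + \<bar>pdiff 2 (pdiff 2 (g n)) x\<bar> * cmod (u x)"
        unfolding expr by (rule order_trans[OF tri]) (simp add: norm_mult)
      also have "\<dots> \<le> M * cmod (landau_expr B u x) + 2 * M * cmod (mom a 1 u x) + 2 * M * cmod (mom b 2 u x)
        + M * cmod (u x) + M * cmod (u x)"
        by (intro add_mono mult_right_mono gM mult_left_mono) simp_all
      also have "\<dots> = M * r x" by (simp add: r_def algebra_simps)
      also have "\<dots> \<le> cmod (complex_of_real (M * r x))" by (simp only: norm_of_real abs_ge_self)
      finally show ?thesis .
    qed
  qed
  have "(cls (\<phi> n), cls (landau_expr B (\<phi> n))) \<in> landau_core B" for n
    using t\<phi> by (auto simp: landau_core_def)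
  moreover have "(\<lambda>n. (cls (\<phi> n), cls (landau_expr B (\<phi> n)))) \<longlonglongrightarrow> (cls u, cls (landau_expr B u))"
    by (intro tendsto_Pair 1 2)
  ultimately show ?thesis
    unfolding landau_graph_def closure_sequential
    by (intro exI[of _ "\<lambda>n. (cls (\<phi> n), cls (landau_expr B (\<phi> n)))"]) blast
qed

subsection \<open>Explicit eigenfunctions\<close>

text \<open>Weigh the ball of radius \<open>n + 1\<close> by \<open>1 / (n + 1)^5\<close>. Its area
  is proportional to \<open>(n + 1)^2\<close>, so the integrals are summable like
  \<open>1 / (n + 1)^3\<close>.\<close>

lemma integrable_lborel_decay:
  fixes f :: "real^2 \<Rightarrow> real"
  assumes f [measurable]: "f \<in> borel_measurable borel" and bd: "\<And>x. \<bar>f x\<bar> * (2 + norm x) ^ 5 \<le> C"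
  shows "integrable lborel f"
proof (rule integrableI_bounded)
  show "f \<in> borel_measurable lborel" by simp
  have C: "0 \<le> C" using bd[of 0] by (rule order_trans[rotated]) simp
  define g :: "real^2 \<Rightarrow> ennreal" where
    "g x = (\<Sum>n. ennreal (1 / real (Suc n) ^ 5) * indicator (cball 0 (real (Suc n))) x)" for x
  have pt: "ennreal (norm (f x)) \<le> ennreal C * g x" for x
  proof -
    \<comment> \<open>Rounding up and the successor together cost at most 2, hence
      \<open>2 + norm x\<close> in the assumption.\<close>
    define n where "n = nat \<lceil>norm x\<rceil>"
    have n: "norm x \<le> real (Suc n)" "real (Suc n) \<le> 2 + norm x"
      unfolding n_def using norm_ge_zero[of x] by linarith+
    have "\<bar>f x\<bar> * real (Suc n) ^ 5 \<le> \<bar>f x\<bar> * (2 + norm x) ^ 5"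
      by (intro mult_left_mono power_mono n) simp_all
    with bd[of x] have "\<bar>f x\<bar> \<le> C * (1 / real (Suc n) ^ 5)"
      by (simp add: pos_le_divide_eq del: of_nat_Suc)
    then have "ennreal (norm (f x)) \<le> ennreal C * ennreal (1 / real (Suc n) ^ 5)"
      using C by (simp add: ennreal_mult'[symmetric] ennreal_leI)
    also have "ennreal (1 / real (Suc n) ^ 5) = (\<Sum>i\<in>{n}. ennreal (1 / real (Suc i) ^ 5) * indicator (cball 0 (real (Suc i))) x)"
      using n(1) by simp
    also have "\<dots> \<le> g x"
      unfolding g_def by (rule sum_le_suminf) auto
    finally show ?thesis by (simp add: mult_left_mono)
  qed
  have "(\<integral>\<^sup>+x. ennreal (norm (f x)) \<partial>lborel) \<le> (\<integral>\<^sup>+x. ennreal C * g x \<partial>lborel)"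
    by (intro nn_integral_mono pt)
  also have "\<dots> = ennreal C * (\<Sum>n. \<integral>\<^sup>+x. ennreal (1 / real (Suc n) ^ 5) * indicator (cball 0 (real (Suc n))) (x::real^2) \<partial>lborel)"
  proof -
    have m [measurable]: "(\<lambda>x::real^2. ennreal (1 / real (Suc n) ^ 5) * indicator (cball 0 (real (Suc n))) x)
        \<in> borel_measurable lborel" for n
      by (intro borel_measurable_times_ennreal borel_measurable_const borel_measurable_indicator) simp
    have "g \<in> borel_measurable lborel"
      unfolding g_def[abs_def] by measurable
    then show ?thesis
      by (simp only: nn_integral_cmult) (simp only: g_def nn_integral_suminf[OF m])
  qed
  also have "\<dots> = ennreal C * (\<Sum>n. ennreal (unit_ball_vol 2 * (1 / real (Suc n) ^ 3)))"
  proof -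
    have "(\<integral>\<^sup>+x. ennreal (1 / real (Suc n) ^ 5) * indicator (cball 0 (real (Suc n))) (x::real^2) \<partial>lborel)
        = ennreal (unit_ball_vol 2 * (1 / real (Suc n) ^ 3))" for n
    proof -
      have "(\<integral>\<^sup>+x. ennreal (1 / real (Suc n) ^ 5) * indicator (cball 0 (real (Suc n))) (x::real^2) \<partial>lborel)
        = ennreal (1 / real (Suc n) ^ 5) * ennreal (unit_ball_vol 2 * real (Suc n) ^ 2)"
        by (subst nn_integral_cmult_indicator) (auto simp: emeasure_cball)
      also have "\<dots> = ennreal (unit_ball_vol 2 * (1 / real (Suc n) ^ 3))"
        by (subst ennreal_mult'[symmetric]) (auto simp: power_def field_simps eval_nat_numeral simp del: of_nat_Suc)
      finally show ?thesis .
    qed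
    then show ?thesis by simp
  qed
  also have "\<dots> < \<infinity>"
  proof -
    have "summable (\<lambda>n. unit_ball_vol 2 * (1 / real (Suc n) ^ 3))"
      using inverse_power_summable[of 3, where 'a = real] summable_Suc_iff[of "\<lambda>n. inverse (real n ^ 3)"]
      by (intro summable_mult) (simp only: inverse_eq_divide)
    then have "(\<Sum>n. ennreal (unit_ball_vol 2 * (1 / real (Suc n) ^ 3))) < \<infinity>"
      by (subst suminf_ennreal2) auto
    then show ?thesis
      by (simp add: ennreal_mult_less_top)
  qed
  finally show "(\<integral>\<^sup>+x. ennreal (norm (f x)) \<partial>lborel) < \<infinity>" .
qed

lemma power_le_fact_exp:
  assumes "0 \<le> (x::real)" shows "x ^ n \<le> fact n * exp x"
proof -
  have "(\<Sum>i\<in>{n}. x ^ i /\<^sub>R fact i) \<le> (\<Sum>i. x ^ i /\<^sub>R fact i)"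
    using assms by (intro sum_le_suminf summable_exp_generic) auto
  then show ?thesis
    by (simp add: exp_def field_simps)
qed

lemma L2_gaussian_bound:
  assumes u: "u \<in> borel_measurable borel" and c: "0 < c" "0 \<le> M"
    and bd: "\<And>x. cmod (u x) \<le> M * exp (r * norm x) * exp (- c * (norm x)\<^sup>2)"
  shows "u \<in> L2"
proof -
  have "integrable lborel (\<lambda>x. (cmod (u x))\<^sup>2)"
  \<comment> \<open>The fifth power is traded for \<open>fact 5 * exp (2 + t)\<close>. The exponent
    becomes \<open>2 + (2 * r + 1) * t - 2 * c * t\<^sup>2\<close>, and completing the square gives
    its maximum.\<close>
  proof (rule integrable_lborel_decay[where C = "M\<^sup>2 * fact 5 * exp (2 + (2 * r + 1)\<^sup>2 / (8 * c))"])
    show "(\<lambda>x. (cmod (u x))\<^sup>2) \<in> borel_measurable borel" using u by simp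
    fix x :: "real^2"
    let ?t = "norm x"
    have "(cmod (u x))\<^sup>2 \<le> (M * exp (r * ?t) * exp (- c * ?t\<^sup>2))\<^sup>2"
      by (intro power_mono bd) simp
    then have "(cmod (u x))\<^sup>2 * (2 + ?t) ^ 5 \<le> (M * exp (r * ?t) * exp (- c * ?t\<^sup>2))\<^sup>2 * (fact 5 * exp (2 + ?t))"
      by (intro mult_mono power_le_fact_exp) auto
    also have "\<dots> = M\<^sup>2 * fact 5 * exp (2 * (r * ?t) + 2 * (- c * ?t\<^sup>2) + (2 + ?t))"
      unfolding power_mult_distrib exp_add exp_double[symmetric] by (simp only: mult_ac)
    also have "\<dots> \<le> M\<^sup>2 * fact 5 * exp (2 + (2 * r + 1)\<^sup>2 / (8 * c))"
    proof -
      have "0 \<le> (4 * c * ?t - (2 * r + 1))\<^sup>2" by simp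
      then have "8 * c * ((2 * r + 1) * ?t - 2 * c * ?t\<^sup>2) \<le> (2 * r + 1)\<^sup>2"
        by (simp add: power2_eq_square algebra_simps)
      then have "(2 * r + 1) * ?t - 2 * c * ?t\<^sup>2 \<le> (2 * r + 1)\<^sup>2 / (8 * c)"
        using c by (simp add: pos_le_divide_eq mult.commute)
      then have "2 * (r * ?t) + 2 * (- c * ?t\<^sup>2) + (2 + ?t) \<le> 2 + (2 * r + 1)\<^sup>2 / (8 * c)"
        by (simp add: algebra_simps)
      then show ?thesis
        by (intro mult_left_mono) auto
    qed
    finally show "\<bar>(cmod (u x))\<^sup>2\<bar> * (2 + ?t) ^ 5 \<le> M\<^sup>2 * fact 5 * exp (2 + (2 * r + 1)\<^sup>2 / (8 * c))"
      by simp
  qed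
  with u show ?thesis by (simp add: L2_def)
qed

section \<open>Monomials in z and its conjugate times the Gaussian\<close>

definition zeta :: "real^2 \<Rightarrow> complex" where
  "zeta x = complex_of_real (x $ 1) + \<i> * complex_of_real (x $ 2)"

definition gauss :: "real \<Rightarrow> real^2 \<Rightarrow> real" where
  "gauss B x = exp (- (B / 4) * (norm x)\<^sup>2)"

text \<open>The scalar \<open>c\<close> is built in because a momentum maps such a function to a sum
  of such functions with other scalars.\<close>

definition landau_fun :: "real \<Rightarrow> complex \<Rightarrow> nat \<Rightarrow> nat \<Rightarrow> real^2 \<Rightarrow> complex" where
  "landau_fun B c j k x = c * zeta x ^ j * cnj (zeta x) ^ k * complex_of_real (gauss B x)"

lemma norm2_eq: "(norm (x::real^2))\<^sup>2 = (x $ 1)\<^sup>2 + (x $ 2)\<^sup>2"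
  by (simp add: norm_vec_def L2_set_def sum_2)

lemma cmod_zeta: "cmod (zeta x) = norm x"
  by (simp add: zeta_def cmod_def norm_vec_def L2_set_def sum_2)

lemma smooth_zeta: "smooth zeta"
  unfolding zeta_def[abs_def] by (intro smooth_add smooth_mult smooth_of_real smooth_nth smooth_const)

lemma smooth_cnj_zeta: "smooth (\<lambda>x. cnj (zeta x))"
  by (rule smooth_linear[OF bounded_linear_cnj smooth_zeta])

lemma smooth_gauss: "smooth (gauss B)"
  unfolding gauss_def[abs_def] norm2_eq
  by (intro smooth_exp smooth_mult smooth_add smooth_power smooth_nth smooth_const)

lemma smooth_landau_fun: "smooth (landau_fun B c j k)"
  unfolding landau_fun_def[abs_def]
  by (intro smooth_mult smooth_power smooth_of_real smooth_const smooth_zeta smooth_cnj_zeta smooth_gauss)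

lemma landau_fun_L2:
  assumes "B > 0" shows "landau_fun B c j k \<in> L2"
proof (rule L2_gaussian_bound[of _ "B / 4" "cmod c * fact (j + k)" 1])
  show "landau_fun B c j k \<in> borel_measurable borel"
    by (intro borel_measurable_continuous_onI smooth_continuous smooth_landau_fun)
  fix x :: "real^2"
  have "cmod (landau_fun B c j k x) = cmod c * norm x ^ (j + k) * exp (- (B / 4) * (norm x)\<^sup>2)"
    by (simp add: landau_fun_def norm_mult norm_power cmod_zeta gauss_def power_add)
  also have "\<dots> \<le> cmod c * (fact (j + k) * exp (norm x)) * exp (- (B / 4) * (norm x)\<^sup>2)"
    by (intro mult_left_mono mult_right_mono power_le_fact_exp) auto
  finally show "cmod (landau_fun B c j k x) \<le> cmod c * fact (j + k) * exp (1 * norm x) * exp (- (B / 4) * (norm x)\<^sup>2)"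
    by (simp add: mult.assoc)
qed (use assms in auto)

lemma pdiff_power:
  fixes f :: "real^'n::finite \<Rightarrow> 'b::{real_normed_algebra_1, comm_ring_1}"
  assumes "smooth f"
  shows "pdiff j (\<lambda>x. f x ^ n) x = of_nat n * f x ^ (n - 1) * pdiff j f x"
proof (induction n)
  case (Suc n)
  have "pdiff j (\<lambda>x. f x * f x ^ n) x = f x * pdiff j (\<lambda>x. f x ^ n) x + pdiff j f x * f x ^ n"
    by (intro pdiff_mult smooth_power assms)
  with Suc show ?case by (cases n) (simp_all add: algebra_simps)
qed simp

definition dzeta :: "2 \<Rightarrow> complex" where "dzeta l = (if l = 1 then 1 else \<i>)"

definition vector_potential :: "real \<Rightarrow> 2 \<Rightarrow> real^2 \<Rightarrow> real" where
  "vector_potential B l x = (if l = 1 then B / 2 * x $ 2 else - (B / 2) * x $ 1)"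

lemma momentum_eq_vector_potential: "momentum1 B = mom (vector_potential B 1) 1" "momentum2 B = mom (vector_potential B 2) 2"
  by (simp_all add: momentum_eq_mom vector_potential_def[abs_def])

lemma pdiff_zeta: "pdiff l zeta x = dzeta l"
proof -
  have "pdiff l (\<lambda>x. complex_of_real (x $ i)) x = (if i = l then 1 else 0)" for i
    using pdiff_linear[OF bounded_linear_of_real smooth_differentiable[OF smooth_nth[of i]], of l x] by auto
  then show ?thesis
    using exhaust_2[of l] unfolding zeta_def[abs_def]
    by (auto simp: pdiff_add_smooth pdiff_mult smooth_mult smooth_of_real dzeta_def)
qed

lemma pdiff_cnj_zeta: "pdiff l (\<lambda>x. cnj (zeta x)) x = cnj (dzeta l)"
  using pdiff_linear[OF bounded_linear_cnj smooth_differentiable[OF smooth_zeta], of l x] by (simp add: pdiff_zeta)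

lemma pdiff_gauss: "pdiff l (\<lambda>x. complex_of_real (gauss B x)) x = complex_of_real (- (B / 2) * x $ l * gauss B x)"
proof -
  let ?q = "\<lambda>x::real^2. - (B / 4) * (norm x)\<^sup>2"
  have q: "smooth ?q"
    unfolding norm2_eq by (intro smooth_mult smooth_add smooth_power smooth_nth smooth_const)
  have s: "smooth (\<lambda>x::real^2. (x $ 1)\<^sup>2 + (x $ 2)\<^sup>2)"
    by (intro smooth_add smooth_power smooth_nth)
  have "pdiff l (\<lambda>x::real^2. (x $ 1)\<^sup>2 + (x $ 2)\<^sup>2) x = 2 * x $ l"
    using exhaust_2[of l] by (auto simp: pdiff_add_smooth pdiff_power2 smooth_power)
  then have "pdiff l ?q x = - (B / 2) * x $ l"
    unfolding norm2_eq pdiff_mult[OF smooth_const s] by simp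
  moreover have "pdiff l (\<lambda>x. exp (?q x)) x = pdiff l ?q x *\<^sub>R exp (?q x)"
    by (rule pdiff_compose_real[OF smooth_differentiable[OF q]])
      (simp add: has_real_derivative_iff_has_vector_derivative[symmetric])
  ultimately have "pdiff l (gauss B) x = - (B / 2) * x $ l * gauss B x"
    by (simp add: gauss_def[abs_def])
  then show ?thesis
    using pdiff_linear[OF bounded_linear_of_real smooth_differentiable[OF smooth_gauss], of l B x] by metis
qed

text \<open>The derivative of the Gaussian and the vector potential combine to a multiple of
  \<open>cnj (zeta x)\<close>, so the power of \<open>zeta x\<close> is never raised. The truncated
  exponents \<open>j - 1\<close> and \<open>k - 1\<close> carry the factors \<open>j\<close> and
  \<open>k\<close> and do no harm at 0.\<close>

lemma mom_landau_fun:
  "mom (vector_potential B l) l (landau_fun B c j k) = (\<lambda>x.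
      landau_fun B (- \<i> * dzeta l * of_nat j * c) (j - 1) k x
    + (landau_fun B (- \<i> * cnj (dzeta l) * of_nat k * c) j (k - 1) x
    + landau_fun B (\<i> * complex_of_real (B / 2) * dzeta l * c) j (k + 1) x))"
proof (rule ext)
  fix x
  let ?z = "zeta x" and ?g = "complex_of_real (gauss B x)"
  have pd: "pdiff l (landau_fun B c j k) x
    = (c * ?z ^ j * cnj ?z ^ k) * complex_of_real (- (B / 2) * x $ l * gauss B x)
      + (c * ?z ^ j * (of_nat k * cnj ?z ^ (k - 1) * cnj (dzeta l))
        + c * (of_nat j * ?z ^ (j - 1) * dzeta l) * cnj ?z ^ k) * ?g"
  proof -
    have s1: "smooth (\<lambda>x. c * zeta x ^ j)" "smooth (\<lambda>x. cnj (zeta x) ^ k)" "smooth (\<lambda>x. zeta x ^ j)"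
      "smooth (\<lambda>x. complex_of_real (gauss B x))" "smooth (\<lambda>x. c * zeta x ^ j * cnj (zeta x) ^ k)"
      by (intro smooth_mult smooth_power smooth_of_real smooth_const smooth_zeta smooth_cnj_zeta smooth_gauss)+
    show ?thesis
      unfolding landau_fun_def[abs_def]
      by (subst pdiff_mult[OF s1(5,4)], subst pdiff_mult[OF s1(1,2)], subst pdiff_mult[OF smooth_const s1(3)])
        (simp add: pdiff_power[OF smooth_zeta] pdiff_power[OF smooth_cnj_zeta] pdiff_zeta pdiff_cnj_zeta pdiff_gauss)
  qed
  have eq: "- \<i> * complex_of_real (- (B / 2) * x $ l) + complex_of_real (vector_potential B l x)
      = \<i> * complex_of_real (B / 2) * dzeta l * cnj ?z"
    using exhaust_2[of l] by (auto simp: vector_potential_def dzeta_def zeta_def complex_eq_iff algebra_simps)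
  have eq2: "- \<i> * ((c * ?z ^ j * cnj ?z ^ k) * complex_of_real (- (B / 2) * x $ l * gauss B x))
      + complex_of_real (vector_potential B l x) * (c * ?z ^ j * cnj ?z ^ k * ?g)
      = \<i> * complex_of_real (B / 2) * dzeta l * cnj ?z * (c * ?z ^ j * cnj ?z ^ k * ?g)"
    unfolding eq[symmetric] by (simp add: algebra_simps)
  have "mom (vector_potential B l) l (landau_fun B c j k) x
    = (- \<i> * ((c * ?z ^ j * cnj ?z ^ k) * complex_of_real (- (B / 2) * x $ l * gauss B x))
        + complex_of_real (vector_potential B l x) * (c * ?z ^ j * cnj ?z ^ k * ?g))
      + - \<i> * ((c * ?z ^ j * (of_nat k * cnj ?z ^ (k - 1) * cnj (dzeta l))
        + c * (of_nat j * ?z ^ (j - 1) * dzeta l) * cnj ?z ^ k) * ?g)"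
    unfolding mom_def pd distrib_left[of "- \<i>"] by (simp only: landau_fun_def add_ac)
  then show "mom (vector_potential B l) l (landau_fun B c j k) x =
      landau_fun B (- \<i> * dzeta l * of_nat j * c) (j - 1) k x
    + (landau_fun B (- \<i> * cnj (dzeta l) * of_nat k * c) j (k - 1) x
    + landau_fun B (\<i> * complex_of_real (B / 2) * dzeta l * c) j (k + 1) x)"
    unfolding eq2 by (simp add: landau_fun_def algebra_simps)
qed

text \<open>Over the two directions, \<open>dzeta l * dzeta l\<close> sums to 0 and
  \<open>dzeta l * cnj (dzeta l)\<close> to 2. What survives is lowering and raising
  \<open>k\<close> in either order, which gives the Landau level, and lowering both exponents, which
  gives the off-diagonal term.\<close>

lemma landau_expr_landau_fun:
  "landau_expr B (landau_fun B c j k) = (\<lambda>x. complex_of_real (landau_level B k) * landau_fun B c j k x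
    - complex_of_real (4 * real j * real k) * landau_fun B c (j - 1) (k - 1) x)"
proof (rule ext)
  fix x
  define e where "e j k = zeta x ^ j * cnj (zeta x) ^ k * complex_of_real (gauss B x)" for j k
  have e: "landau_fun B c j k x = c * e j k" for c j k
    by (simp add: landau_fun_def e_def)
  have m: "mom (vector_potential B l) l (mom (vector_potential B l) l (landau_fun B c j k)) x
    = mom (vector_potential B l) l (landau_fun B (- \<i> * dzeta l * of_nat j * c) (j - 1) k) x
    + (mom (vector_potential B l) l (landau_fun B (- \<i> * cnj (dzeta l) * of_nat k * c) j (k - 1)) x
    + mom (vector_potential B l) l (landau_fun B (\<i> * complex_of_real (B / 2) * dzeta l * c) j (k + 1)) x)" for l
    unfolding mom_landau_fun[of B l c j k]
    by (subst mom_add, (intro smooth_add smooth_landau_fun)+)+ (rule refl)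
  have "k = 0 \<or> (\<exists>k'. k = Suc k')" by (cases k) auto
  then show "landau_expr B (landau_fun B c j k) x = complex_of_real (landau_level B k) * landau_fun B c j k x
    - complex_of_real (4 * real j * real k) * landau_fun B c (j - 1) (k - 1) x"
    unfolding landau_expr_def momentum_eq_vector_potential m
    by (elim disjE exE) (simp_all add: mom_landau_fun e dzeta_def landau_level_def algebra_simps
        add_divide_distrib diff_divide_distrib)
qed

lemma landau_fun_graph:
  assumes "B > 0"
  shows "(cls (landau_fun B c j k), landau_level B k *\<^sub>R cls (landau_fun B c j k)
    - (4 * real j * real k) *\<^sub>R cls (landau_fun B c (j - 1) (k - 1))) \<in> landau_graph B"
proof -
  note L = landau_fun_L2[OF assms]
  have "landau_expr B (landau_fun B c j k) \<in> L2"
    unfolding landau_expr_landau_fun by (intro L2_diff L2_cmult L)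
  moreover have "mom (vector_potential B l) l (landau_fun B c j k) \<in> L2" for l
    unfolding mom_landau_fun by (intro L2_add L)
  ultimately have "(cls (landau_fun B c j k), cls (landau_expr B (landau_fun B c j k))) \<in> landau_graph B"
    by (intro landau_graph_cutoff smooth_landau_fun L) (simp_all add: momentum_eq_vector_potential)
  then show ?thesis
    unfolding landau_expr_landau_fun cls_diff[OF L2_cmult[OF L] L2_cmult[OF L]] cls_cmult_of_real[OF L] .
qed

subsection \<open>Resolvents from dense eigenvectors\<close>

text \<open>The bound makes the solutions for approximating right-hand sides a Cauchy sequence, and
  closedness of \<open>T\<close> admits the limit.\<close>

lemma closed_relation_solve:
  fixes T :: "('a::{real_inner, complete_space} \<times> 'a) set"
  assumes T: "subspace T" "closed T" and \<delta>: "0 < \<delta>"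
    and bd: "\<And>u f. (u, f) \<in> T \<Longrightarrow> \<delta> * norm u \<le> norm (f - E *\<^sub>R u)"
    and dense: "closure D = UNIV" and solve: "\<And>g. g \<in> D \<Longrightarrow> \<exists>u. (u, g + E *\<^sub>R u) \<in> T"
  shows "\<exists>u f. (u, f) \<in> T \<and> f - E *\<^sub>R u = g"
proof -
  obtain G where G: "\<And>n. G n \<in> D" "G \<longlonglongrightarrow> g"
    using dense closure_sequential[of g D] by auto
  obtain U where U: "\<And>n. (U n, G n + E *\<^sub>R U n) \<in> T"
    using solve[OF G(1)] by metis
  have diff: "\<delta> * norm (U m - U n) \<le> norm (G m - G n)" for m n
  proof -
    have "(U m - U n, (G m + E *\<^sub>R U m) - (G n + E *\<^sub>R U n)) \<in> T"
      using subspace_diff[OF T(1) U U, of m n] by simp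
    from bd[OF this] show ?thesis by (simp add: algebra_simps)
  qed
  have "Cauchy U"
  proof (rule metric_CauchyI)
    fix e :: real assume "0 < e"
    then have "0 < \<delta> * e" using \<delta> by simp
    then obtain M where M: "\<And>m n. m \<ge> M \<Longrightarrow> n \<ge> M \<Longrightarrow> dist (G m) (G n) < \<delta> * e"
      using metric_CauchyD[OF LIMSEQ_imp_Cauchy[OF G(2)]] by blast
    have "dist (U m) (U n) < e" if "m \<ge> M" "n \<ge> M" for m n
    proof -
      have "\<delta> * dist (U m) (U n) < \<delta> * e"
        using diff[of m n] M[OF that] by (simp add: dist_norm)
      then show ?thesis using \<delta> by simp
    qed
    then show "\<exists>M. \<forall>m\<ge>M. \<forall>n\<ge>M. dist (U m) (U n) < e" by blast
  qed
  then obtain u where u: "U \<longlonglongrightarrow> u"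
    using Cauchy_convergent convergent_def by blast
  have "(\<lambda>n. (U n, G n + E *\<^sub>R U n)) \<longlonglongrightarrow> (u, g + E *\<^sub>R u)"
    by (intro tendsto_intros u G)
  then have "(u, g + E *\<^sub>R u) \<in> T"
    by (rule closed_sequentially[OF T(2) U])
  then show ?thesis
    by (intro exI[of _ u] exI[of _ "g + E *\<^sub>R u"]) simp
qed

text \<open>Eigenvectors for different \<open>L m\<close> are orthogonal, so finite sums are solved
  componentwise and Pythagoras gives the bound. For an arbitrary element of \<open>T\<close> the
  bound follows by duality, pairing \<open>u\<close> with right-hand sides from the dense
  span.\<close>

lemma symmetric_resolvent_if_eigenvectors_dense:
  fixes T :: "('a::{real_inner, complete_space} \<times> 'a) set" and L :: "nat \<Rightarrow> real"
  defines "Eig \<equiv> \<lambda>m. {u. (u, L m *\<^sub>R u) \<in> T}"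
  assumes T: "subspace T" "closed T"
    and sym: "\<And>u f v g. (u, f) \<in> T \<Longrightarrow> (v, g) \<in> T \<Longrightarrow> f \<bullet> v = u \<bullet> g"
    and dense: "closure (span (\<Union>m. Eig m)) = UNIV" and L: "inj L"
    and \<delta>: "0 < \<delta>" "\<delta> \<le> 1" and gap: "\<And>m. \<delta> \<le> \<bar>L m - E\<bar>"
  shows "symmetric_resolvent T E \<delta>"
proof -
  have sub: "subspace (Eig m)" for m
    unfolding subspace_def Eig_def
  proof (intro conjI ballI allI; simp)
    show "(0, 0) \<in> T" using subspace_0[OF T(1)] by (simp add: zero_prod_def)
    show "(u + v, L m *\<^sub>R (u + v)) \<in> T" if "(u, L m *\<^sub>R u) \<in> T" "(v, L m *\<^sub>R v) \<in> T" for u v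
      using subspace_add[OF T(1) that] by (simp add: scaleR_add_right)
    show "(c *\<^sub>R u, (L m * c) *\<^sub>R u) \<in> T" if "(u, L m *\<^sub>R u) \<in> T" for c u
      using subspace_scale[OF T(1) that, of c] by (simp add: mult.commute)
  qed
  have orth: "u \<bullet> v = 0" if "u \<in> Eig m" "v \<in> Eig n" "m \<noteq> n" for u v m n
  proof -
    have "L m * (u \<bullet> v) = L n * (u \<bullet> v)"
      using sym[of u "L m *\<^sub>R u" v "L n *\<^sub>R v"] that by (simp add: Eig_def)
    moreover have "L m \<noteq> L n" using L that(3) by (simp add: inj_eq)
    ultimately show ?thesis by simp
  qed
  \<comment> \<open>Contributions to the same eigenvalue are collected in one \<open>w m\<close>, so
    that the summands are orthogonal.\<close>
  have decomp: "\<exists>M w. (\<forall>m. w m \<in> Eig m) \<and> g = (\<Sum>m<M. w m) \<and> (\<forall>m\<ge>M. w m = 0)"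
    if "g \<in> span (\<Union>m. Eig m)" for g
    using that
  proof (induction g rule: span_induct_alt)
    case base
    show ?case
      using subspace_0[OF sub] by (intro exI[of _ 0] exI[of _ "\<lambda>_. 0"]) auto
  next
    case (step c x y)
    then obtain M w where w: "\<And>m. w m \<in> Eig m" "y = (\<Sum>m<M. w m)" "\<And>m. m \<ge> M \<Longrightarrow> w m = 0"
      by blast
    obtain k where k: "x \<in> Eig k" using step by blast
    define M' where "M' = max M (Suc k)"
    have kM': "k < M'" by (simp add: M'_def)
    define w' where "w' = w(k := c *\<^sub>R x + w k)"
    have "w' m \<in> Eig m" for m
      using w(1) k subspace_add[OF sub] subspace_scale[OF sub] by (simp add: w'_def)
    moreover have "(\<Sum>m<M'. w m) = y"
      unfolding w(2) by (rule sum.mono_neutral_right) (auto simp: M'_def w(3))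
    moreover have "(\<Sum>m<M'. w' m) = (\<Sum>m<M'. (if m = k then c *\<^sub>R x else 0) + w m)"
      by (rule sum.cong) (auto simp: w'_def)
    then have "(\<Sum>m<M'. w' m) = c *\<^sub>R x + (\<Sum>m<M'. w m)"
      using kM' by (simp add: sum.distrib)
    moreover have "w' m = 0" if "m \<ge> M'" for m
      using that w(3) by (auto simp: w'_def M'_def)
    ultimately show ?case
      by (intro exI[of _ M'] exI[of _ w'] conjI allI impI) simp_all
  qed
  have solve: "\<exists>u. (u, g + E *\<^sub>R u) \<in> T \<and> \<delta> * norm u \<le> norm g" if g: "g \<in> span (\<Union>m. Eig m)" for g
  proof -
    obtain M w where w: "\<And>m. w m \<in> Eig m" "g = (\<Sum>m<M. w m)"
      using decomp[OF g] by blast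
    have nz: "L m - E \<noteq> 0" for m using gap[of m] \<delta> by auto
    define v where "v m = (1 / (L m - E)) *\<^sub>R w m" for m
    have v: "v m \<in> Eig m" for m
      unfolding v_def using w(1) subspace_scale[OF sub] by blast
    have "(\<Sum>m<M. (v m, L m *\<^sub>R v m)) \<in> T"
      using v by (intro subspace_sum[OF T(1)]) (simp add: Eig_def)
    moreover have "(\<Sum>m<M. (v m, L m *\<^sub>R v m)) = (\<Sum>m<M. v m, g + E *\<^sub>R (\<Sum>m<M. v m))"
    proof -
      have "L m *\<^sub>R v m = w m + E *\<^sub>R v m" for m
      proof -
        have "(L m - E) *\<^sub>R v m = w m" using nz by (simp add: v_def)
        then show ?thesis by (simp add: algebra_simps)
      qed
      then show ?thesis
        by (simp add: sum_prod w(2) sum.distrib scaleR_sum_right)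
    qed
    moreover have "\<delta> * norm (\<Sum>m<M. v m) \<le> norm g"
    proof -
      have "pairwise (\<lambda>i j. orthogonal (v i) (v j)) {..<M}" "pairwise (\<lambda>i j. orthogonal (w i) (w j)) {..<M}"
        unfolding pairwise_def orthogonal_def using orth[OF v v] orth[OF w(1) w(1)] by simp_all
      then have p: "(norm (\<Sum>m<M. v m))\<^sup>2 = (\<Sum>m<M. (norm (v m))\<^sup>2)" "(norm g)\<^sup>2 = (\<Sum>m<M. (norm (w m))\<^sup>2)"
        unfolding w(2) by (auto intro: norm_sum_Pythagorean)
      have "\<delta>\<^sup>2 * (norm (v m))\<^sup>2 \<le> (norm (w m))\<^sup>2" for m
      proof -
        have "w m = (L m - E) *\<^sub>R v m" using nz by (simp add: v_def)
        then have "norm (w m) = \<bar>L m - E\<bar> * norm (v m)" by simp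
        then have "\<delta> * norm (v m) \<le> norm (w m)"
          using gap[of m] by (simp add: mult_right_mono)
        then have "(\<delta> * norm (v m))\<^sup>2 \<le> (norm (w m))\<^sup>2"
          using \<delta> by (intro power_mono) auto
        then show ?thesis by (simp add: power_mult_distrib)
      qed
      then have "\<delta>\<^sup>2 * (norm (\<Sum>m<M. v m))\<^sup>2 \<le> (norm g)\<^sup>2"
        unfolding p by (simp add: sum_distrib_left sum_mono)
      then have "(\<delta> * norm (\<Sum>m<M. v m))\<^sup>2 \<le> (norm g)\<^sup>2"
        by (simp add: power_mult_distrib)
      then show ?thesis by (rule power2_le_imp_le) simp
    qed
    ultimately show ?thesis by auto
  qed
  have bound: "\<delta> * norm u \<le> norm (f - E *\<^sub>R u)" if uf: "(u, f) \<in> T" for u f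
  proof -
    \<comment> \<open>The aim is to insert \<open>h = u\<close>, which is possible only after
      passing to the closure.\<close>
    have "span (\<Union>m. Eig m) \<subseteq> {h. \<delta> * (u \<bullet> h) \<le> norm (f - E *\<^sub>R u) * norm h}"
    proof
      fix h assume "h \<in> span (\<Union>m. Eig m)"
      then obtain v where v: "(v, h + E *\<^sub>R v) \<in> T" "\<delta> * norm v \<le> norm h"
        using solve by blast
      have "u \<bullet> h = (f - E *\<^sub>R u) \<bullet> v"
        using sym[OF uf v(1)] by (simp add: inner_add_right inner_diff_left)
      also have "\<dots> \<le> norm (f - E *\<^sub>R u) * norm v" by (rule norm_cauchy_schwarz)
      finally have "\<delta> * (u \<bullet> h) \<le> \<delta> * (norm (f - E *\<^sub>R u) * norm v)"
        using \<delta> by (intro mult_left_mono) auto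
      also have "\<dots> = norm (f - E *\<^sub>R u) * (\<delta> * norm v)" by simp
      also have "\<dots> \<le> norm (f - E *\<^sub>R u) * norm h"
        using v(2) by (intro mult_left_mono) auto
      finally show "h \<in> {h. \<delta> * (u \<bullet> h) \<le> norm (f - E *\<^sub>R u) * norm h}" by simp
    qed
    then have "closure (span (\<Union>m. Eig m)) \<subseteq> {h. \<delta> * (u \<bullet> h) \<le> norm (f - E *\<^sub>R u) * norm h}"
      by (rule closure_minimal) (intro closed_Collect_le continuous_intros)
    then have "\<delta> * (u \<bullet> u) \<le> norm (f - E *\<^sub>R u) * norm u"
      unfolding dense by blast
    then have "(\<delta> * norm u) * norm u \<le> norm (f - E *\<^sub>R u) * norm u"
      by (simp add: dot_square_norm power2_eq_square)
    then show ?thesis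
      by (cases "norm u = 0") (simp_all add: mult_le_cancel_right)
  qed
  show ?thesis
  proof
    show "\<exists>u f. (u, f) \<in> T \<and> f - E *\<^sub>R u = g" for g
    proof (rule closed_relation_solve[OF T \<delta>(1) bound dense])
      show "\<exists>u. (u, h + E *\<^sub>R u) \<in> T" if "h \<in> span (\<Union>m. Eig m)" for h
        using solve[OF that] by (elim exE conjE exI)
    qed
  qed (use T sym \<delta> bound in auto)
qed

text \<open>The off-diagonal term is removed by inverting \<open>T - L (k + 1)\<close> on the span of the lower
  eigenvectors.\<close>

lemma triangular_in_span_eigenvectors:
  fixes T :: "('a::real_inner \<times> 'a) set" and L :: "nat \<Rightarrow> real"
  defines "Eig \<equiv> \<lambda>m. {u. (u, L m *\<^sub>R u) \<in> T}"
  assumes T: "subspace T" and L: "inj L"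
    and x: "\<And>j k. (x j k, L k *\<^sub>R x j k - (a j k) *\<^sub>R x (j - 1) (k - 1)) \<in> T" and a: "\<And>j. a j 0 = 0"
  shows "x j k \<in> span (\<Union>m\<le>k. Eig m)"
proof (induction k arbitrary: j)
  case 0
  have "x j 0 \<in> Eig 0"
    using x[of j 0] a by (simp add: Eig_def)
  then show ?case by (auto intro: span_base)
next
  case (Suc k)
  have sol: "\<exists>w\<in>span (\<Union>m\<le>k. Eig m). (w, L (Suc k) *\<^sub>R w + v) \<in> T" if "v \<in> span (\<Union>m\<le>k. Eig m)" for v
    using that
  proof (induction v rule: span_induct_alt)
    case base
    then show ?case
      using subspace_0[OF T] by (intro bexI[of _ 0]) (auto simp: zero_prod_def span_zero)
  next
    case (step c v y)
    then obtain w where w: "w \<in> span (\<Union>m\<le>k. Eig m)" "(w, L (Suc k) *\<^sub>R w + y) \<in> T" by blast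
    obtain m where m: "m \<le> k" "v \<in> Eig m" using step by blast
    have nz: "L m - L (Suc k) \<noteq> 0" using inj_eq[OF L, of m "Suc k"] m(1) by simp
    define d where "d = c / (L m - L (Suc k))"
    have "d *\<^sub>R (v, L m *\<^sub>R v) \<in> T"
      using m(2) subspace_scale[OF T] by (simp only: Eig_def mem_Collect_eq)
    from subspace_add[OF T this w(2)]
    have "(d *\<^sub>R v + w, d *\<^sub>R L m *\<^sub>R v + (L (Suc k) *\<^sub>R w + y)) \<in> T" by simp
    moreover have "d *\<^sub>R L m *\<^sub>R v = L (Suc k) *\<^sub>R d *\<^sub>R v + c *\<^sub>R v"
    proof -
      have "d * (L m - L (Suc k)) = c" using nz by (simp add: d_def)
      then have "d * L m = L (Suc k) * d + c" by (simp add: algebra_simps)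
      then show ?thesis by (simp flip: scaleR_add_left)
    qed
    ultimately have "(d *\<^sub>R v + w, L (Suc k) *\<^sub>R (d *\<^sub>R v + w) + (c *\<^sub>R v + y)) \<in> T"
      by (simp add: scaleR_add_right add_ac)
    moreover have "d *\<^sub>R v + w \<in> span (\<Union>m\<le>k. Eig m)"
      using m w(1) by (intro span_add span_scale) (auto intro: span_base)
    ultimately show ?case by blast
  qed
  \<comment> \<open>\<open>w\<close> reproduces the off-diagonal part of \<open>x j (Suc k)\<close>,
    so the difference is an eigenvector for \<open>L (Suc k)\<close>.\<close>
  obtain w where w: "w \<in> span (\<Union>m\<le>k. Eig m)"
    "(w, L (Suc k) *\<^sub>R w + (- a j (Suc k)) *\<^sub>R x (j - 1) k) \<in> T"
    using sol[OF span_scale[OF Suc.IH]] by blast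
  have "(x j (Suc k) - w, L (Suc k) *\<^sub>R (x j (Suc k) - w)) \<in> T"
    using subspace_diff[OF T x[of j "Suc k"] w(2)] by (simp add: scaleR_diff_right)
  then have "x j (Suc k) - w \<in> Eig (Suc k)" by (simp add: Eig_def)
  then have "x j (Suc k) - w \<in> span (\<Union>m\<le>Suc k. Eig m)"
    by (intro span_base) blast
  moreover have "w \<in> span (\<Union>m\<le>Suc k. Eig m)"
  proof -
    have "(\<Union>m\<le>k. Eig m) \<subseteq> (\<Union>m\<le>Suc k. Eig m)"
      by (intro UN_mono) auto
    from span_mono[OF this] w(1) show ?thesis by (rule subsetD)
  qed
  ultimately have "(x j (Suc k) - w) + w \<in> span (\<Union>m\<le>Suc k. Eig m)"
    by (rule span_add)
  then show ?case by simp
qed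

subsection \<open>Density of the explicit eigenfunctions\<close>

text \<open>The class of \<open>gauss_dense\<close> functions is enlarged step by step: polynomials, trigonometric
  polynomials, bounded continuous functions, indicators of open and of Borel sets, all functions.\<close>

definition landau_span :: "real \<Rightarrow> l2 set" where
  "landau_span B = span {cls (landau_fun B c j k) |c j k. True}"

text \<open>Against the Gaussian bounded measurable functions are square integrable, so the class is
  closed under bounded pointwise limits.\<close>

definition gauss_dense :: "real \<Rightarrow> (real^2 \<Rightarrow> complex) \<Rightarrow> bool" where
  "gauss_dense B h \<longleftrightarrow> (\<lambda>x. h x * complex_of_real (gauss B x)) \<in> L2 \<and>
    cls (\<lambda>x. h x * complex_of_real (gauss B x)) \<in> closure (landau_span B)"

lemma subspace_closure_landau_span: "subspace (closure (landau_span B))"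
  unfolding landau_span_def by (intro subspace_closure subspace_span)

lemma gauss_dense_add:
  assumes "gauss_dense B f" "gauss_dense B g" shows "gauss_dense B (\<lambda>x. f x + g x)"
  using assms subspace_add[OF subspace_closure_landau_span]
  unfolding gauss_dense_def by (simp add: distrib_right L2_add cls_add)

lemma gauss_dense_0: "gauss_dense B (\<lambda>x. 0)"
  using subspace_0[OF subspace_closure_landau_span] by (simp add: gauss_dense_def L2_zero cls_zero)

lemma gauss_dense_cmult:
  assumes "gauss_dense B f" shows "gauss_dense B (\<lambda>x. complex_of_real a * f x)"
  using assms subspace_scale[OF subspace_closure_landau_span, of _ B a]
  unfolding gauss_dense_def by (simp add: mult.assoc L2_cmult cls_cmult_of_real)

lemma gauss_dense_uminus: "gauss_dense B f \<Longrightarrow> gauss_dense B (\<lambda>x. - f x)"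
  using gauss_dense_cmult[of B f "- 1"] by simp

lemma gauss_dense_sum:
  assumes "\<And>i. i \<in> I \<Longrightarrow> gauss_dense B (f i)" shows "gauss_dense B (\<lambda>x. \<Sum>i\<in>I. f i x)"
  using assms by (induction I rule: infinite_finite_induct) (simp_all add: gauss_dense_0 gauss_dense_add)

lemma gauss_dense_limit:
  assumes f: "\<And>n. gauss_dense B (f n)" and w: "(\<lambda>x. w x * complex_of_real (gauss B x)) \<in> L2"
    and dom: "\<And>n x. cmod (f n x) \<le> cmod (w x)" and lim: "\<And>x. (\<lambda>n. f n x) \<longlonglongrightarrow> g x"
  shows "gauss_dense B g"
proof -
  let ?G = "\<lambda>h x. h x * complex_of_real (gauss B x)"
  have fL: "?G (f n) \<in> L2" and fS: "cls (?G (f n)) \<in> closure (landau_span B)" for n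
    using f by (simp_all add: gauss_dense_def)
  have l: "(\<lambda>n. ?G (f n) x) \<longlonglongrightarrow> ?G g x" for x
    by (intro tendsto_intros lim)
  have gm: "?G g \<in> borel_measurable borel"
    by (rule borel_measurable_LIMSEQ_metric[OF L2_measurable[OF fL] l])
  have d: "cmod (?G (f n) x) \<le> cmod (?G w x)" for n x
    by (simp add: norm_mult dom mult_right_mono)
  note D = L2_dominated_convergence[OF L2_measurable[OF fL] gm w d l]
  have "cls (?G g) \<in> closure (landau_span B)"
    by (rule closed_sequentially[OF closed_closure fS D(3)])
  with D(2) show ?thesis by (simp add: gauss_dense_def)
qed

context
  fixes B :: real
  assumes B: "B > 0"
begin

lemma gauss_bounded_L2: "(\<lambda>x. c * complex_of_real (gauss B x)) \<in> L2"
  using landau_fun_L2[OF B, of c 0 0] by (simp add: landau_fun_def[abs_def])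

lemma gauss_dense_bounded_limit:
  assumes f: "\<And>n. gauss_dense B (f n)" and dom: "\<And>n x. cmod (f n x) \<le> M" and lim: "\<And>x. (\<lambda>n. f n x) \<longlonglongrightarrow> g x"
  shows "gauss_dense B g"
proof (rule gauss_dense_limit[OF f gauss_bounded_L2 _ lim])
  show "cmod (f n x) \<le> cmod (complex_of_real M)" for n x
    unfolding norm_of_real using dom[of n x] by linarith
qed

text \<open>A real linear form is a combination of \<open>zeta x\<close> and its conjugate; expand
  by the binomial theorem.\<close>

lemma gauss_dense_power: "gauss_dense B (\<lambda>x. c * complex_of_real (\<xi> \<bullet> x) ^ n)"
proof -
  define p where "p = cnj (zeta \<xi>) / 2"
  define q where "q = zeta \<xi> / 2"
  have "complex_of_real (\<xi> \<bullet> x) = p * zeta x + q * cnj (zeta x)" for x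
    by (simp add: p_def q_def zeta_def inner_vec_def sum_2 complex_eq_iff algebra_simps
        add_divide_distrib diff_divide_distrib)
  then have eq: "(\<lambda>x. c * complex_of_real (\<xi> \<bullet> x) ^ n * complex_of_real (gauss B x))
    = (\<lambda>x. \<Sum>k\<le>n. landau_fun B (c * of_nat (n choose k) * p ^ k * q ^ (n - k)) k (n - k) x)"
    by (simp add: fun_eq_iff binomial_ring landau_fun_def sum_distrib_left sum_distrib_right power_mult_distrib mult_ac)
  have "(\<Sum>k\<le>n. cls (landau_fun B (c * of_nat (n choose k) * p ^ k * q ^ (n - k)) k (n - k))) \<in> landau_span B"
    unfolding landau_span_def by (intro span_sum span_base) blast
  then show ?thesis
    unfolding gauss_dense_def eq using closure_subset[of "landau_span B"]
    by (auto simp: cls_sum landau_fun_L2[OF B] L2_sum)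
qed

text \<open>The partial sums of the exponential series are dominated by a multiple of
  \<open>exp (norm \<xi> * norm x)\<close>, still square integrable against the Gaussian.\<close>

lemma gauss_dense_exp: "gauss_dense B (\<lambda>x. c * exp (\<i> * complex_of_real (\<xi> \<bullet> x)))"
proof (rule gauss_dense_limit)
  define f where "f N x = (\<Sum>n<N. c * \<i> ^ n / fact n * complex_of_real (\<xi> \<bullet> x) ^ n)" for N x
  define w where "w x = complex_of_real (cmod c * exp (norm \<xi> * norm x))" for x :: "real^2"
  have f_eq: "f N x = c * (\<Sum>n<N. (\<i> * complex_of_real (\<xi> \<bullet> x)) ^ n /\<^sub>R fact n)" for N x
    by (simp add: f_def sum_distrib_left power_mult_distrib scaleR_conv_of_real divide_inverse mult_ac)
  show "gauss_dense B (f N)" for N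
    unfolding f_def[abs_def] by (intro gauss_dense_sum gauss_dense_power)
  show "(\<lambda>x. w x * complex_of_real (gauss B x)) \<in> L2"
  proof (rule L2_gaussian_bound[of _ "B / 4" "cmod c" "norm \<xi>"])
    have "continuous_on UNIV (gauss B)" by (rule smooth_continuous[OF smooth_gauss])
    then show "(\<lambda>x. w x * complex_of_real (gauss B x)) \<in> borel_measurable borel"
      unfolding w_def by (intro borel_measurable_continuous_onI continuous_intros)
  qed (use B in \<open>auto simp: w_def gauss_def norm_mult\<close>)
  show "cmod (f N x) \<le> cmod (w x)" for N x
  proof -
    let ?y = "\<i> * complex_of_real (\<xi> \<bullet> x)"
    have y: "cmod ?y \<le> norm \<xi> * norm x"
      using Cauchy_Schwarz_ineq2[of \<xi> x] by (simp add: norm_mult)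
    have "cmod (\<Sum>n<N. ?y ^ n /\<^sub>R fact n) \<le> (\<Sum>n<N. cmod ?y ^ n /\<^sub>R fact n)"
      by (intro order_trans[OF norm_sum] sum_mono) (simp add: norm_power)
    also have "\<dots> \<le> exp (cmod ?y)"
      unfolding exp_def by (intro sum_le_suminf summable_exp_generic) auto
    also have "\<dots> \<le> exp (norm \<xi> * norm x)" using y by simp
    finally show ?thesis
      by (simp add: f_eq w_def norm_mult mult_left_mono)
  qed
  show "(\<lambda>N. f N x) \<longlonglongrightarrow> c * exp (\<i> * complex_of_real (\<xi> \<bullet> x))" for x
    unfolding f_eq using exp_converges[of "\<i> * complex_of_real (\<xi> \<bullet> x)"]
    by (intro tendsto_mult_left) (simp add: sums_def)
qed

lemma gauss_dense_cos: "gauss_dense B (\<lambda>x. c * complex_of_real (cos (\<xi> \<bullet> x + \<theta>)))"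
proof -
  have "(\<lambda>x. c * complex_of_real (cos (\<xi> \<bullet> x + \<theta>)))
    = (\<lambda>x. c / 2 * exp (\<i> * complex_of_real \<theta>) * exp (\<i> * complex_of_real (\<xi> \<bullet> x))
      + c / 2 * exp (- (\<i> * complex_of_real \<theta>)) * exp (\<i> * complex_of_real ((- \<xi>) \<bullet> x)))"
    unfolding cos_of_real[symmetric] cos_exp_eq mult.assoc mult_exp_exp
    by (rule ext) (simp add: algebra_simps add_divide_distrib)
  then show ?thesis
    by (simp only:) (intro gauss_dense_add gauss_dense_exp)
qed

end

text \<open>The phase \<open>\<theta>\<close> covers the sines, and with it the product-to-sum
  formula makes the class an algebra.\<close>

inductive trig :: "(real^2 \<Rightarrow> real) \<Rightarrow> bool" where
  trig_cos: "trig (\<lambda>x. a * cos (\<xi> \<bullet> x + \<theta>))"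
| trig_add: "trig f \<Longrightarrow> trig g \<Longrightarrow> trig (\<lambda>x. f x + g x)"

lemma trig_const: "trig (\<lambda>x. a)"
  using trig_cos[of a 0 0] by simp

lemma trig_mult:
  assumes "trig f" "trig g" shows "trig (\<lambda>x. f x * g x)"
  using assms(1)
proof induction
  case (trig_cos a \<xi> \<theta>)
  show ?case
    using assms(2)
  proof induction
    case (trig_cos b \<eta> \<tau>)
    have "(\<lambda>x. a * cos (\<xi> \<bullet> x + \<theta>) * (b * cos (\<eta> \<bullet> x + \<tau>)))
      = (\<lambda>x. a * b / 2 * cos ((\<xi> - \<eta>) \<bullet> x + (\<theta> - \<tau>)) + a * b / 2 * cos ((\<xi> + \<eta>) \<bullet> x + (\<theta> + \<tau>)))"
    proof
      fix x
      have "cos (\<xi> \<bullet> x + \<theta>) * cos (\<eta> \<bullet> x + \<tau>)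
        = (cos ((\<xi> - \<eta>) \<bullet> x + (\<theta> - \<tau>)) + cos ((\<xi> + \<eta>) \<bullet> x + (\<theta> + \<tau>))) / 2"
        unfolding cos_times_cos by (simp add: inner_diff_left inner_add_left algebra_simps)
      moreover have "a * cos (\<xi> \<bullet> x + \<theta>) * (b * cos (\<eta> \<bullet> x + \<tau>))
        = a * b * (cos (\<xi> \<bullet> x + \<theta>) * cos (\<eta> \<bullet> x + \<tau>))" by simp
      ultimately show "a * cos (\<xi> \<bullet> x + \<theta>) * (b * cos (\<eta> \<bullet> x + \<tau>))
        = a * b / 2 * cos ((\<xi> - \<eta>) \<bullet> x + (\<theta> - \<tau>)) + a * b / 2 * cos ((\<xi> + \<eta>) \<bullet> x + (\<theta> + \<tau>))"
        by (simp only: distrib_left times_divide_eq_right times_divide_eq_left add_divide_distrib)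
    qed
    then show ?case
      by (simp only:) (intro trig.intros)
  next
    case (trig_add f g)
    then show ?case by (simp only: distrib_left trig.trig_add)
  qed
next
  case (trig_add f g)
  then show ?case by (simp only: distrib_right trig.trig_add)
qed

lemma trig_continuous: "trig f \<Longrightarrow> continuous_on S f"
  by (induction rule: trig.induct) (intro continuous_intros | assumption)+

lemma trig_bounded: "trig f \<Longrightarrow> \<exists>C. \<forall>x. \<bar>f x\<bar> \<le> C"
proof (induction rule: trig.induct)
  case (trig_cos a \<xi> \<theta>)
  show ?case
    by (intro exI[of _ "\<bar>a\<bar>"] allI) (simp add: abs_mult mult_left_le)
next
  case (trig_add f g)
  then obtain C D where CD: "\<And>x. \<bar>f x\<bar> \<le> C" "\<And>x. \<bar>g x\<bar> \<le> D" by blast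
  have "\<bar>f x + g x\<bar> \<le> C + D" for x
    using CD(1)[of x] CD(2)[of x] abs_triangle_ineq[of "f x" "g x"] by linarith
  then show ?case by blast
qed

lemma trig_polynomial:
  assumes "real_polynomial_function q" "trig f" shows "trig (\<lambda>x. q (f x))"
  using assms(1)
proof induction
  case (linear q)
  have "q t = t * q 1" for t
    using linear_cmul[OF bounded_linear.linear[OF linear], of t 1] by simp
  then have "(\<lambda>x. q (f x)) = (\<lambda>x. f x * q 1)" by blast
  then show ?case
    using trig_mult[OF assms(2) trig_const[of "q 1"]] by (simp only:)
next
  case (const c)
  show ?case by (rule trig_const)
next
  case (add p q)
  show ?case by (rule trig_add[OF add.IH])
next
  case (mult p q)
  show ?case by (rule trig_mult[OF mult.IH])
qed

lemma trig_separates: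
  assumes "x \<noteq> y" shows "\<exists>f. trig f \<and> f x \<noteq> f y"
proof -
  \<comment> \<open>Scaled so that \<open>\<xi> \<bullet> (x - y) = pi\<close>: with phase
    \<open>- (\<xi> \<bullet> x)\<close> the cosine is 1 at \<open>x\<close> and -1 at
    \<open>y\<close>.\<close>
  define \<xi> where "\<xi> = (pi / (norm (x - y))\<^sup>2) *\<^sub>R (x - y)"
  have "\<xi> \<bullet> y + - (\<xi> \<bullet> x) = - (\<xi> \<bullet> (x - y))"
    by (simp add: inner_diff_right)
  also have "\<xi> \<bullet> (x - y) = pi"
    using assms by (simp add: \<xi>_def dot_square_norm)
  finally have "1 * cos (\<xi> \<bullet> x + - (\<xi> \<bullet> x)) \<noteq> 1 * cos (\<xi> \<bullet> y + - (\<xi> \<bullet> x))"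
    by simp
  then show ?thesis
    using trig_cos[of 1 \<xi> "- (\<xi> \<bullet> x)"] by blast
qed

context
  fixes B :: real
  assumes B: "B > 0"
begin

lemma gauss_dense_trig: "trig f \<Longrightarrow> gauss_dense B (\<lambda>x. c * complex_of_real (f x))"
proof (induction rule: trig.induct)
  case (trig_cos a \<xi> \<theta>)
  show ?case
    using gauss_dense_cos[OF B, of "c * complex_of_real a" \<xi> \<theta>] by (simp add: mult.assoc)
next
  case (trig_add f g)
  then show ?case
    using gauss_dense_add[OF trig_add.IH] by (simp add: distrib_left)
qed

text \<open>Stone-Weierstrass controls an approximant only on a ball, so it must be truncated before
  dominated convergence can be used. Polynomials that approximate the truncation on the range of
  \<open>f\<close> stay within \<open>trig\<close>.\<close>

lemma gauss_dense_clip: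
  assumes f: "trig f" and M: "0 \<le> M"
  shows "gauss_dense B (\<lambda>x. c * complex_of_real (max (- M) (min M (f x))))"
proof -
  define clip where "clip t = max (- M) (min M t)" for t :: real
  have clip_bd: "\<bar>clip t\<bar> \<le> M" for t using M by (auto simp: clip_def)
  have cont: "continuous_on S clip" for S
    unfolding clip_def by (intro continuous_intros)
  obtain C where C: "\<And>x. \<bar>f x\<bar> \<le> C" using trig_bounded[OF f] by blast
  have "\<exists>q. real_polynomial_function q \<and> (\<forall>t\<in>{-C..C}. \<bar>clip t - q t\<bar> < 1 / real (Suc n))" for n
    by (rule Stone_Weierstrass_real_polynomial_function[OF compact_Icc[of "- C" C] cont, of "1 / real (Suc n)"])
      (simp, blast)
  then obtain q where q: "\<And>n. real_polynomial_function (q n)"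
    "\<And>n t. t \<in> {-C..C} \<Longrightarrow> \<bar>clip t - q n t\<bar> < 1 / real (Suc n)" by metis
  have fC: "f x \<in> {-C..C}" for x using C[of x] by auto
  have "gauss_dense B (\<lambda>x. c * complex_of_real (clip (f x)))"
  proof (rule gauss_dense_bounded_limit[OF B])
    show "gauss_dense B (\<lambda>x. c * complex_of_real (q n (f x)))" for n
      by (rule gauss_dense_trig[OF trig_polynomial[OF q(1) f]])
    show "cmod (c * complex_of_real (q n (f x))) \<le> cmod c * (M + 1)" for n x
    proof -
      have "1 / real (Suc n) \<le> 1" by simp
      then have "\<bar>q n (f x)\<bar> \<le> M + 1"
        using q(2)[OF fC, of x n] clip_bd[of "f x"] by linarith
      then show ?thesis by (simp add: norm_mult mult_left_mono)
    qed
    show "(\<lambda>n. c * complex_of_real (q n (f x))) \<longlonglongrightarrow> c * complex_of_real (clip (f x))" for x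
    proof (intro tendsto_mult_left tendsto_of_real)
      have "(\<lambda>n. q n (f x) - clip (f x)) \<longlonglongrightarrow> 0"
      proof (rule Lim_null_comparison)
        show "\<forall>\<^sub>F n in sequentially. norm (q n (f x) - clip (f x)) \<le> 1 / real (Suc n)"
          using q(2)[OF fC, of x] by (intro always_eventually allI) (simp add: abs_minus_commute less_imp_le)
        show "(\<lambda>n. 1 / real (Suc n)) \<longlonglongrightarrow> 0"
          using LIMSEQ_inverse_real_of_nat by (simp add: divide_inverse)
      qed
      then show "(\<lambda>n. q n (f x)) \<longlonglongrightarrow> clip (f x)" by (simp add: LIM_zero_iff)
    qed
  qed
  then show ?thesis by (simp add: clip_def)
qed

text \<open>Trigonometric approximants on balls of radius \<open>n\<close> are truncated at
  \<open>M\<close>; since \<open>h\<close> has values in the same range, this does not enlarge the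
  error.\<close>

lemma gauss_dense_continuous:
  assumes h: "continuous_on UNIV h" and M: "\<And>x. \<bar>h x\<bar> \<le> M"
  shows "gauss_dense B (\<lambda>x. c * complex_of_real (h x))"
proof -
  have "\<exists>f. trig f \<and> (\<forall>x\<in>cball 0 (real n). \<bar>h x - f x\<bar> < 1 / real (Suc n))" for n
  proof (rule Stone_Weierstrass_HOL[where P = trig])
    show "trig (\<lambda>x. f x + g x)" "trig (\<lambda>x. f x * g x)" if "trig f \<and> trig g" for f g
      using that by (simp_all add: trig_add trig_mult)
    show "\<exists>f. trig f \<and> f x \<noteq> f y" if "x \<in> cball 0 (real n) \<and> y \<in> cball 0 (real n) \<and> x \<noteq> y" for x y
      using trig_separates that by blast
    show "continuous_on (cball 0 (real n)) h"
      by (rule continuous_on_subset[OF h]) simp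
  qed (simp_all add: trig_const trig_continuous)
  then obtain f where f: "\<And>n. trig (f n)"
    "\<And>n x. norm x \<le> real n \<Longrightarrow> \<bar>h x - f n x\<bar> < 1 / real (Suc n)"
    by (metis mem_cball_0)
  have M0: "0 \<le> M" using M[of 0] by linarith
  let ?f = "\<lambda>n x. max (- M) (min M (f n x))"
  show ?thesis
  proof (rule gauss_dense_bounded_limit[OF B])
    show "gauss_dense B (\<lambda>x. c * complex_of_real (?f n x))" for n
      by (intro gauss_dense_clip f M0)
    show "cmod (c * complex_of_real (?f n x)) \<le> cmod c * M" for n x
      using M0 by (auto simp: norm_mult intro!: mult_left_mono)
    show "(\<lambda>n. c * complex_of_real (?f n x)) \<longlonglongrightarrow> c * complex_of_real (h x)" for x
    proof (intro tendsto_mult_left tendsto_of_real)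
      obtain N where N: "norm x \<le> real N" using real_arch_simple by blast
      have "(\<lambda>n. ?f n x - h x) \<longlonglongrightarrow> 0"
      proof (rule Lim_null_comparison)
        show "\<forall>\<^sub>F n in sequentially. norm (?f n x - h x) \<le> 1 / real (Suc n)"
        proof (rule eventually_sequentiallyI[of N])
          fix n assume "N \<le> n"
          then have "\<bar>h x - f n x\<bar> < 1 / real (Suc n)" using N by (intro f) simp
          then show "norm (?f n x - h x) \<le> 1 / real (Suc n)"
            using M[of x] by (auto simp: max_def min_def)
        qed
        show "(\<lambda>n. 1 / real (Suc n)) \<longlonglongrightarrow> 0"
          using LIMSEQ_inverse_real_of_nat by (simp add: divide_inverse)
      qed
      then show "(\<lambda>n. ?f n x) \<longlonglongrightarrow> h x" by (simp add: LIM_zero_iff)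
    qed
  qed
qed

lemma gauss_dense_open:
  assumes U: "open U" shows "gauss_dense B (\<lambda>x. c * complex_of_real (indicator U x))"
proof (cases "U = UNIV")
  \<comment> \<open>Treated separately because \<open>infdist\<close> to the empty set is 0.\<close>
  case True
  then show ?thesis using gauss_dense_continuous[of "\<lambda>x. 1" 1 c] by simp
next
  case False
  then have ne: "- U \<noteq> {}" by blast
  have cl: "closed (- U)" using U by (simp add: closed_Compl)
  let ?f = "\<lambda>n x. min 1 (real n * infdist x (- U))"
  show ?thesis
  proof (rule gauss_dense_bounded_limit[OF B])
    show "gauss_dense B (\<lambda>x. c * complex_of_real (?f n x))" for n
      by (rule gauss_dense_continuous[where M = 1])
        (auto intro!: continuous_intros simp: infdist_nonneg)
    show "cmod (c * complex_of_real (?f n x)) \<le> cmod c * 1" for n x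
      unfolding norm_mult norm_of_real by (intro mult_left_mono) (auto simp: infdist_nonneg)
    show "(\<lambda>n. c * complex_of_real (?f n x)) \<longlonglongrightarrow> c * complex_of_real (indicator U x)" for x
    proof (intro tendsto_mult_left tendsto_of_real)
      show "(\<lambda>n. ?f n x) \<longlonglongrightarrow> indicator U x"
      proof (cases "x \<in> U")
        case True
        then have d: "0 < infdist x (- U)"
          using infdist_pos_not_in_closed[OF cl ne] by simp
        obtain N where N: "1 / infdist x (- U) \<le> real N" using real_arch_simple by blast
        have "?f n x = 1" if "N \<le> n" for n
        proof -
          have "1 / infdist x (- U) \<le> real n" using N that by linarith
          then show ?thesis using d by (simp add: pos_divide_le_eq)
        qed
        then have "\<forall>\<^sub>F n in sequentially. ?f n x = indicator U x"
          using True by (intro eventually_sequentiallyI[of N]) simp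
        then show ?thesis by (rule tendsto_eventually)
      next
        case False
        then have "infdist x (- U) = 0" by simp
        with False show ?thesis by simp
      qed
    qed
  qed
qed

text \<open>Dynkin induction from the open sets, an intersection-stable generator; finite disjoint
  unions add up, and countable ones are bounded limits of these.\<close>

lemma gauss_dense_borel:
  assumes "A \<in> sets borel" shows "gauss_dense B (\<lambda>x. c * complex_of_real (indicator A x))"
proof -
  have "Int_stable {S. open (S :: (real^2) set)}" "{S. open (S :: (real^2) set)} \<subseteq> Pow UNIV"
    "A \<in> sigma_sets UNIV {S. open S}"
    using assms by (auto simp: Int_stable_def sets_borel)
  then show ?thesis
  proof (induction rule: sigma_sets_induct_disjoint)
    case (basic A)
    then show ?case by (simp add: gauss_dense_open)
  next
    case empty
    then show ?case by (simp add: gauss_dense_0)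
  next
    case (compl A)
    have "gauss_dense B (\<lambda>x. c * complex_of_real (indicator UNIV x) + - (c * complex_of_real (indicator A x)))"
      using gauss_dense_add[OF gauss_dense_open[OF open_UNIV] gauss_dense_uminus[OF compl.IH]] .
    moreover have "c * complex_of_real (indicator UNIV x) + - (c * complex_of_real (indicator A x))
        = c * complex_of_real (indicator (UNIV - A) x)" for x
      by (simp add: indicator_def)
    ultimately show ?case by simp
  next
    case (union A)
    have fin: "gauss_dense B (\<lambda>x. c * complex_of_real (indicator (\<Union>i<n. A i) x))" for n
    proof (induction n)
      case 0
      show ?case by (simp add: gauss_dense_0)
    next
      case (Suc n)
      have "A n \<inter> (\<Union>i<n. A i) = {}"
      proof (rule equals0I)
        fix x assume "x \<in> A n \<inter> (\<Union>i<n. A i)"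
        then obtain i where "x \<in> A n" "x \<in> A i" "i < n" by blast
        with disjoint_family_onD[OF union.hyps(1), of n i] show False by auto
      qed
      then have "indicator (\<Union>i<Suc n. A i) x = indicator (\<Union>i<n. A i) x + (indicator (A n) x :: real)" for x
        by (auto simp: indicator_def lessThan_Suc)
      then show ?case
        using gauss_dense_add[OF Suc union.IH[of n]] by (simp add: distrib_left)
    qed
    show ?case
    proof (rule gauss_dense_bounded_limit[OF B fin])
      show "cmod (c * complex_of_real (indicator (\<Union>i<n. A i) x)) \<le> cmod c" for n x
        by (simp add: indicator_def)
      show "(\<lambda>n. c * complex_of_real (indicator (\<Union>i<n. A i) x)) \<longlonglongrightarrow> c * complex_of_real (indicator (\<Union>i. A i) x)" for x
        by (intro tendsto_mult_left tendsto_of_real LIMSEQ_indicator_UN)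
    qed
  qed
qed

text \<open>Induction over sums and monotone limits. By nonnegativity the parts are dominated by the
  whole and inherit its square integrability.\<close>

lemma gauss_dense_nonneg:
  assumes "f \<in> borel_measurable borel" "\<And>x. 0 \<le> f x" "(\<lambda>x. complex_of_real (f x) * complex_of_real (gauss B x)) \<in> L2"
  shows "gauss_dense B (\<lambda>x. c * complex_of_real (f x))"
  using assms
proof (induction rule: borel_measurable_induct_real)
  case (set A)
  then show ?case by (intro gauss_dense_borel)
next
  case (mult f a)
  show ?case
  proof (cases "a = 0")
    case False
    have "(\<lambda>x. complex_of_real (f x) * complex_of_real (gauss B x)) \<in> L2"
      using L2_cmult[OF mult.prems, of "complex_of_real (1 / a)"] False by (simp add: mult.assoc[symmetric])
    from gauss_dense_cmult[OF mult.IH[OF this], of a] show ?thesis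
      by (simp add: mult_ac)
  qed (simp add: gauss_dense_0)
next
  case (add f g)
  have gm [measurable]: "gauss B \<in> borel_measurable borel"
    by (intro borel_measurable_continuous_onI smooth_continuous smooth_gauss)
  note [measurable] = add.hyps(1,3)
  have "(\<lambda>x. complex_of_real (h x) * complex_of_real (gauss B x)) \<in> L2"
    if [measurable]: "h \<in> borel_measurable borel" and "\<And>x. 0 \<le> h x" "\<And>x. h x \<le> g x + f x" for h
    using that(2,3) add.hyps(2,4)
    by (intro L2_bound[OF add.prems, of _ 1])
      (auto simp: norm_mult simp flip: of_real_add intro!: mult_right_mono)
  then have "gauss_dense B (\<lambda>x. c * complex_of_real (f x))" "gauss_dense B (\<lambda>x. c * complex_of_real (g x))"
    using add.hyps by (auto intro!: add.IH)
  from gauss_dense_add[OF this(2,1)] show ?case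
    by (simp add: distrib_left)
next
  case (seq U)
  have le: "U i x \<le> f x" for i x
    using seq.hyps(3) seq.hyps(4)[of x] by (intro incseq_le) (auto simp: incseq_def le_fun_def)
  have gm [measurable]: "gauss B \<in> borel_measurable borel"
    by (intro borel_measurable_continuous_onI smooth_continuous smooth_gauss)
  note [measurable] = seq.hyps(1)
  have "(\<lambda>x. complex_of_real (U i x) * complex_of_real (gauss B x)) \<in> L2" for i
  proof (rule L2_bound[OF seq.prems, of _ 1])
    show "cmod (complex_of_real (U i x) * complex_of_real (gauss B x))
        \<le> 1 * cmod (complex_of_real (f x) * complex_of_real (gauss B x))" for x
      unfolding norm_mult norm_of_real mult_1
      using seq.hyps(2)[of i x] le[of i x] by (intro mult_right_mono) auto
  qed measurable
  then have U: "gauss_dense B (\<lambda>x. c * complex_of_real (U i x))" for i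
    by (rule seq.IH)
  show ?case
  proof (rule gauss_dense_limit[OF U])
    show "(\<lambda>x. c * complex_of_real (f x) * complex_of_real (gauss B x)) \<in> L2"
      using L2_cmult[OF seq.prems, of c] by (simp add: mult.assoc)
    show "cmod (c * complex_of_real (U n x)) \<le> cmod (c * complex_of_real (f x))" for n x
      unfolding norm_mult norm_of_real using le[of n x] seq.hyps(2)[of n x] by (intro mult_left_mono) auto
    show "(\<lambda>n. c * complex_of_real (U n x)) \<longlonglongrightarrow> c * complex_of_real (f x)" for x
      using seq.hyps(4)[of x] by (intro tendsto_mult_left tendsto_of_real) simp
  qed
qed

text \<open>Divide by the positive Gaussian and split real and imaginary parts by sign, the form in
  which \<open>gauss_dense_nonneg\<close> applies.\<close>

theorem closure_landau_span: "closure (landau_span B) = UNIV"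
proof -
  have "X \<in> closure (landau_span B)" for X
  proof (cases X)
    case (1 u)
    note [measurable] = L2_measurable[OF 1(1)]
    have gpos: "0 < gauss B x" for x by (simp add: gauss_def)
    have gm [measurable]: "gauss B \<in> borel_measurable borel"
      by (intro borel_measurable_continuous_onI smooth_continuous smooth_gauss)
    have part: "gauss_dense B (\<lambda>x. c * complex_of_real (max 0 (p (u x)) / gauss B x))"
      if [measurable]: "p \<in> borel_measurable borel" and p: "\<And>z. \<bar>p z\<bar> \<le> cmod z" for p c
    proof (rule gauss_dense_nonneg)
      show "(\<lambda>x. max 0 (p (u x)) / gauss B x) \<in> borel_measurable borel" by measurable
      show "0 \<le> max 0 (p (u x)) / gauss B x" for x using gpos[of x] by simp
      have "(\<lambda>x. complex_of_real (max 0 (p (u x)))) \<in> L2"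
      proof (rule L2_bound[OF 1(1), of _ 1])
        show "cmod (complex_of_real (max 0 (p (u x)))) \<le> 1 * cmod (u x)" for x
          using p[of "u x"] by simp
      qed measurable
      then show "(\<lambda>x. complex_of_real (max 0 (p (u x)) / gauss B x) * complex_of_real (gauss B x)) \<in> L2"
        using gpos by (simp add: less_imp_neq[symmetric])
    qed
    have "gauss_dense B (\<lambda>x. (1 * complex_of_real (max 0 (Re (u x)) / gauss B x)
        + (- 1) * complex_of_real (max 0 (- Re (u x)) / gauss B x))
      + (\<i> * complex_of_real (max 0 (Im (u x)) / gauss B x)
        + (- \<i>) * complex_of_real (max 0 (- Im (u x)) / gauss B x)))"
      using part[of Re 1] part[of "\<lambda>z. - Re z" "- 1"] part[of Im \<i>] part[of "\<lambda>z. - Im z" "- \<i>"]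
      by (intro gauss_dense_add) (simp_all add: abs_Re_le_cmod abs_Im_le_cmod)
    moreover have "((1 * complex_of_real (max 0 (Re (u x)) / gauss B x)
        + (- 1) * complex_of_real (max 0 (- Re (u x)) / gauss B x))
      + (\<i> * complex_of_real (max 0 (Im (u x)) / gauss B x)
        + (- \<i>) * complex_of_real (max 0 (- Im (u x)) / gauss B x))) * complex_of_real (gauss B x) = u x" for x
      using gpos[of x] by (simp add: complex_eq_iff max_def)
    ultimately show ?thesis
      unfolding 1(2) gauss_dense_def by simp
  qed
  then show ?thesis by blast
qed

end

subsection \<open>The resolvent set of the perturbed operator\<close>

lemma landau_resolvent:
  assumes "B > 0" "0 < \<delta>" "\<delta> \<le> 1" and gap: "\<And>m. \<delta> \<le> \<bar>landau_level B m - E\<bar>"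
  shows "symmetric_resolvent (landau_graph B) E \<delta>"
proof (rule symmetric_resolvent_if_eigenvectors_dense[OF subspace_landau_graph closed_landau_graph
      landau_graph_symmetric _ _ assms(2,3) gap])
  let ?Eig = "\<lambda>m. {u. (u, landau_level B m *\<^sub>R u) \<in> landau_graph B}"
  show inj: "inj (landau_level B)"
    using assms(1) by (auto simp: inj_def landau_level_def)
  have "cls (landau_fun B c j k) \<in> span (\<Union>m. ?Eig m)" for c j k
  proof -
    have "cls (landau_fun B c j k) \<in> span (\<Union>m\<le>k. ?Eig m)"
      by (rule triangular_in_span_eigenvectors[where x = "\<lambda>j k. cls (landau_fun B c j k)"
            and a = "\<lambda>j k. 4 * real j * real k", OF subspace_landau_graph inj landau_fun_graph[OF assms(1)]]) simp
    moreover have "(\<Union>m\<le>k. ?Eig m) \<subseteq> (\<Union>m. ?Eig m)" by blast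
    from span_mono[OF this] show ?thesis using calculation by (rule subsetD)
  qed
  then have "landau_span B \<subseteq> span (\<Union>m. ?Eig m)"
    unfolding landau_span_def by (intro span_minimal subspace_span) auto
  then have "closure (landau_span B) \<subseteq> closure (span (\<Union>m. ?Eig m))"
    by (rule closure_mono)
  then show "closure (span (\<Union>m. ?Eig m)) = UNIV"
    unfolding closure_landau_span[OF assms(1)] by blast
qed

text \<open>The constant \<open>K\<close> of \<open>localized_resolvent\<close> with
  \<open>A\<close> written out, for the values of \<open>k\<close> and \<open>c\<close> from
  \<open>landau_graph_estimate\<close>.\<close>

definition cluster_const :: "real \<Rightarrow> real \<Rightarrow> real" where
  "cluster_const B d = (let k = 1 + d\<^sup>2; c = 6 * B + 11 in k * c * (k + 1 + 3 * (k * c * (k + 4))))"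

lemma resolvent_set_add_potential:
  fixes V :: "real^2 \<Rightarrow> real"
  assumes B: "B > 0" and V: "V \<in> borel_measurable borel" "\<And>x. \<bar>V x\<bar> \<le> s" "\<And>x. V x \<noteq> 0 \<Longrightarrow> dist x p \<le> d"
    and E: "1 \<le> E" and \<delta>: "0 < \<delta>" "\<delta> \<le> 1" and gap: "\<And>m. \<delta> \<le> \<bar>landau_level B m - E\<bar>"
    and s: "0 < s" "4 * s\<^sup>2 * cluster_const B d \<le> E * \<delta>\<^sup>2"
  shows "complex_of_real E \<in> resolvent_set (add_potential (landau_hamiltonian B) V)"
proof -
  let ?K = "{x. V x \<noteq> 0}"
  have K: "?K \<in> sets borel"
    using V(1) by measurable
  have Kd: "dist x p \<le> d" if "x \<in> ?K" for x using V(3) that by simp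
  \<comment> \<open>With the set where \<open>V\<close> does not vanish,
    \<open>V Q = Q V = V\<close> holds exactly, and the set lies in the ball of radius
    \<open>d\<close> around \<open>p\<close>.\<close>
  define Q where "Q = mult_l2 (indicator ?K)"
  have mQ: "(indicator ?K :: real^2 \<Rightarrow> real) \<in> borel_measurable borel" "\<bar>indicator ?K x :: real\<bar> \<le> 1" for x
    using K by (auto simp: indicator_def)
  define W where "W = mult_l2 V"
  note Q_cls = mult_l2_cls[OF mQ, folded Q_def] and W_cls = mult_l2_cls[OF V(1,2), folded W_def]
  note QL = L2_bounded_mult[OF mQ] and WL = L2_bounded_mult[OF V(1,2)]
  interpret localized_resolvent "landau_graph B" E \<delta> Q "1 + d\<^sup>2" "6 * B + 11"
  proof (rule localized_resolvent.intro[OF landau_resolvent[OF B \<delta> gap] localized_resolvent_axioms.intro])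
    show "linear Q"
      unfolding Q_def by (rule bounded_linear.linear[OF bounded_linear_mult_l2[OF mQ]])
    show "Q (Q X) = Q X" for X
    proof (cases X)
      case (1 u)
      have "(\<lambda>x. indicator ?K x *\<^sub>R (indicator ?K x *\<^sub>R u x)) = (\<lambda>x. indicator ?K x *\<^sub>R u x)"
        by (auto simp: indicator_def)
      with 1 show ?thesis by (simp only: Q_cls QL)
    qed
    show "Q X \<bullet> Y = X \<bullet> Q Y" for X Y
      by (cases X, cases Y) (simp add: Q_cls inner_cls_scaleR QL)
    show "1 \<le> E" "1 \<le> 1 + d\<^sup>2" "1 \<le> 6 * B + 11" using E B by simp_all
    show "E * (norm (Q u))\<^sup>2 \<le> (1 + d\<^sup>2) * ((6 * B + 11) * ((1 + d\<^sup>2) * (norm (Q (f - E *\<^sub>R u)))\<^sup>2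
      + (norm (f - E *\<^sub>R u - Q (f - E *\<^sub>R u)) + norm u)
          * sqrt (E * (norm u)\<^sup>2 + norm (f - E *\<^sub>R u) * norm u)
      + norm (f - E *\<^sub>R u) * norm u))" if "(u, f) \<in> landau_graph B" for u f
      unfolding Q_def by (rule landau_graph_estimate[OF B _ K Kd that]) (use E in auto)
  qed
  have Ks: "4 * s\<^sup>2 * K \<le> E * \<delta>\<^sup>2"
    using s(2) by (simp only: K_def A_def cluster_const_def Let_def)
  have lW: "linear W"
    unfolding W_def by (rule bounded_linear.linear[OF bounded_linear_mult_l2[OF V(1,2)]])
  have WQ: "W (Q X) = W X" for X
  proof (cases X)
    case (1 u)
    have "(\<lambda>x. V x *\<^sub>R (indicator ?K x *\<^sub>R u x)) = (\<lambda>x. V x *\<^sub>R u x)"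
      by (auto simp: indicator_def)
    with 1 show ?thesis by (simp only: Q_cls W_cls QL)
  qed
  have QW: "Q (W X) = W X" for X
  proof (cases X)
    case (1 u)
    have "(\<lambda>x. indicator ?K x *\<^sub>R (V x *\<^sub>R u x)) = (\<lambda>x. V x *\<^sub>R u x)"
      by (auto simp: indicator_def)
    with 1 show ?thesis by (simp only: Q_cls W_cls WL)
  qed
  have Wb: "norm (W X) \<le> s * norm X" for X
    unfolding W_def by (rule norm_mult_l2_le[OF V(1,2)])
  note pert = perturbation[OF lW WQ QW Wb s(1) Ks]
  have L2_ham: "u \<in> L2" "f \<in> L2" if "(u, f) \<in> landau_hamiltonian B" for u f
    using that by (auto simp: landau_hamiltonian_def)
  have VuL: "(\<lambda>x. complex_of_real (V x) * u x) \<in> L2" and Vu_cls: "cls (\<lambda>x. complex_of_real (V x) * u x) = W (cls u)"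
    if "u \<in> L2" for u
    using WL[OF that] W_cls[OF that] by (simp_all add: scaleR_conv_of_real)
  have res: "(\<lambda>x. f x + complex_of_real (V x) * u x - complex_of_real E * u x) \<in> L2"
    "cls (\<lambda>x. f x + complex_of_real (V x) * u x - complex_of_real E * u x) = cls f + W (cls u) - E *\<^sub>R cls u"
    if "u \<in> L2" "f \<in> L2" for u f
    using that by (simp_all add: VuL L2_add L2_diff L2_cmult cls_add cls_diff Vu_cls cls_cmult_of_real)
  show ?thesis
    unfolding resolvent_set_def mem_Collect_eq
  proof (intro conjI ballI)
    fix g assume g: "g \<in> L2"
    obtain U F where UF: "(U, F) \<in> landau_graph B" "F + W U - E *\<^sub>R U = cls g"
      using pert(1) by blast
    obtain u where u: "u \<in> L2" "U = cls u" by (cases U)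
    obtain f where f: "f \<in> L2" "F = cls f" by (cases F)
    have "(u, f) \<in> landau_hamiltonian B"
      using UF(1) u f by (simp add: landau_graph_iff)
    then have "(u, \<lambda>x. f x + complex_of_real (V x) * u x) \<in> add_potential (landau_hamiltonian B) V"
      by (auto simp: add_potential_def)
    moreover have "AE x in lborel. f x + complex_of_real (V x) * u x - complex_of_real E * u x = g x"
      using UF(2) unfolding u(2) f(2) res(2)[OF u(1) f(1), symmetric] cls_eq_iff[OF res(1)[OF u(1) f(1)] g] .
    ultimately show "\<exists>(u, f)\<in>add_potential (landau_hamiltonian B) V. AE x in lborel. f x - complex_of_real E * u x = g x"
      by (intro bexI[of _ "(u, \<lambda>x. f x + complex_of_real (V x) * u x)"]) simp_all
  next
    obtain C where C: "\<And>U F. (U, F) \<in> landau_graph B \<Longrightarrow> norm U \<le> C * norm (F + W U - E *\<^sub>R U)"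
      using pert(2) by blast
    show "\<exists>c. \<forall>(u, f)\<in>add_potential (landau_hamiltonian B) V. L2norm u \<le> c * L2norm (\<lambda>x. f x - complex_of_real E * u x)"
    proof (intro exI[of _ C] ballI, clarify)
      fix u f' assume "(u, f') \<in> add_potential (landau_hamiltonian B) V"
      then obtain f where f: "(u, f) \<in> landau_hamiltonian B" "f' = (\<lambda>x. f x + complex_of_real (V x) * u x)"
        by (auto simp: add_potential_def)
      note uf = L2_ham[OF f(1)]
      have "norm (cls u) \<le> C * norm (cls f + W (cls u) - E *\<^sub>R cls u)"
        using f(1) uf by (intro C) (simp add: landau_graph_iff)
      then show "L2norm u \<le> C * L2norm (\<lambda>x. f' x - complex_of_real E * u x)"
        unfolding f(2) by (simp only: norm_cls uf res(1) flip: res(2)[OF uf])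
    qed
  qed
qed

theorem proposition1p1:
  fixes B :: real
  assumes "B > 0"
  shows "\<exists>(C :: real \<Rightarrow> real \<Rightarrow> real) (N :: real \<Rightarrow> real \<Rightarrow> nat).
    (\<forall>s d. C s d > 0 \<and> N s d \<ge> 1) \<and>
    (\<forall>V :: real^2 \<Rightarrow> real. test_fun V \<longrightarrow>
      (let c = C (SUP x. \<bar>V x\<bar>) (diameter (supp V));
           m = N (SUP x. \<bar>V x\<bar>) (diameter (supp V))
       in \<forall>n\<ge>m.
            spectrum (add_potential (landau_hamiltonian B) V) \<inter> complex_of_real ` level_interval B V n
            \<subseteq> complex_of_real ` {landau_level B n - c * real n powr (- 1 / 2) <..<
                                  landau_level B n + c * real n powr (- 1 / 2)}))"
proof -
  \<comment> \<open>Chosen so that \<open>2 * B * c\<^sup>2\<close>, a lower bound for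
    \<open>E * \<delta>\<^sup>2\<close>, is at least
    \<open>4 * (\<bar>s\<bar> + 1)\<^sup>2 * cluster_const B d\<close>. The inner \<open>+ 1\<close>
    keeps the bound for \<open>V\<close> positive also for \<open>V = 0\<close>; the outer one gives
    \<open>C \<ge> 1\<close>.\<close>
  define C where "C s d = sqrt (2 * (\<bar>s\<bar> + 1)\<^sup>2 * cluster_const B d / B) + 1" for s d
  \<comment> \<open>The summands ensure in turn \<open>\<delta> \<le> 1\<close>,
    \<open>\<delta> \<le> B\<close> and \<open>E \<ge> 1\<close>; the last \<open>+ 1\<close>
    excludes \<open>n = 0\<close>.\<close>
  define N where "N s d = nat \<lceil>(C s d)\<^sup>2 + (C s d)\<^sup>2 / B\<^sup>2 + 1 / (2 * B)\<rceil> + 1" for s d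
  have K: "0 \<le> cluster_const B d" for d
    using assms by (simp add: cluster_const_def Let_def)
  have C: "1 \<le> C s d" "2 * (\<bar>s\<bar> + 1)\<^sup>2 * cluster_const B d / B \<le> (C s d)\<^sup>2" for s d
  proof -
    let ?q = "2 * (\<bar>s\<bar> + 1)\<^sup>2 * cluster_const B d / B"
    have q: "0 \<le> ?q" using assms K by simp
    then show "1 \<le> C s d" by (simp add: C_def)
    have "(sqrt ?q)\<^sup>2 \<le> (C s d)\<^sup>2"
      unfolding C_def using q by (intro power_mono) auto
    with q show "?q \<le> (C s d)\<^sup>2" by simp
  qed
  have main: "complex_of_real E \<in> resolvent_set (add_potential (landau_hamiltonian B) V)"
    if V: "test_fun V" and n: "N (SUP x. \<bar>V x\<bar>) (diameter (supp V)) \<le> n"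
      and E: "landau_level B n - B \<le> E" "E < landau_level B n + B"
      and far: "C (SUP x. \<bar>V x\<bar>) (diameter (supp V)) * real n powr (- 1 / 2) \<le> \<bar>E - landau_level B n\<bar>"
    for V :: "real^2 \<Rightarrow> real" and n E
  proof -
    define s0 d where "s0 = (SUP x. \<bar>V x\<bar>)" and "d = diameter (supp V)"
    define c where "c = C s0 d"
    define \<delta> where "\<delta> = c * real n powr (- 1 / 2)"
    have c1: "1 \<le> c" by (simp add: c_def C)
    have "c\<^sup>2 + c\<^sup>2 / B\<^sup>2 + 1 / (2 * B) \<le> real n"
      using n unfolding N_def s0_def[symmetric] d_def[symmetric] c_def[symmetric] by linarith
    moreover have "0 \<le> c\<^sup>2" "0 \<le> c\<^sup>2 / B\<^sup>2" "0 < 1 / (2 * B)" using assms by simp_all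
    ultimately have n': "c\<^sup>2 \<le> real n" "c\<^sup>2 / B\<^sup>2 \<le> real n" "1 / (2 * B) \<le> real n" "0 < real n"
      by linarith+
    have powr: "real n powr (- 1 / 2) = 1 / sqrt (real n)"
      using powr_minus[of "real n" "1 / 2"] powr_half_sqrt[of "real n"] by (simp add: inverse_eq_divide)
    have \<delta>_eq: "\<delta> = c / sqrt (real n)" unfolding \<delta>_def powr by simp
    have \<delta>0: "0 < \<delta>" using c1 n'(4) by (simp add: \<delta>_eq)
    have "c \<le> sqrt (real n)" using n'(1) by (rule real_le_rsqrt)
    then have \<delta>1: "\<delta> \<le> 1" using n'(4) by (simp add: \<delta>_eq)
    have "(c / B)\<^sup>2 \<le> real n" using n'(2) by (simp add: power_divide)
    then have "c / B \<le> sqrt (real n)" by (rule real_le_rsqrt)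
    then have \<delta>B: "\<delta> \<le> B" using n'(4) assms by (simp add: \<delta>_eq field_simps)
    have E2: "2 * B * real n \<le> E"
      using E(1) by (simp add: landau_level_def algebra_simps)
    have E1: "1 \<le> E"
      using n'(3) E2 assms by (simp add: field_simps)
    \<comment> \<open>All other levels are at least \<open>2 * B\<close> away from level
      \<open>n\<close>, while \<open>E\<close> is within \<open>B\<close> of it, so
      \<open>\<delta> \<le> B\<close> suffices.\<close>
    have gap: "\<delta> \<le> \<bar>landau_level B m - E\<bar>" for m
    proof (cases "m = n")
      case True
      then show ?thesis using far by (simp add: \<delta>_def c_def s0_def d_def abs_minus_commute)
    next
      case False
      then have "1 \<le> \<bar>real m - real n\<bar>" by linarith
      then have "2 * B * 1 \<le> 2 * B * \<bar>real m - real n\<bar>"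
        using assms by (intro mult_left_mono) auto
      also have "\<dots> = \<bar>2 * B * (real m - real n)\<bar>"
        using assms by (simp add: abs_mult)
      also have "2 * B * (real m - real n) = landau_level B m - landau_level B n"
        by (simp add: landau_level_def algebra_simps)
      finally show ?thesis using E \<delta>B by linarith
    qed
    have Vb: "\<bar>V x\<bar> \<le> \<bar>s0\<bar> + 1" for x
    proof -
      obtain M where M: "\<And>x. \<bar>V x\<bar> \<le> M" using test_fun_bounded[OF V] by auto
      have "\<bar>V x\<bar> \<le> s0"
        unfolding s0_def by (rule cSUP_upper) (auto intro!: bdd_aboveI2[of _ _ M] M)
      then show ?thesis by linarith
    qed
    \<comment> \<open>Any point where \<open>V\<close> is nonzero can be the centre, with the
      diameter as radius; for \<open>V = 0\<close> there is nothing to show.\<close>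
    have "\<exists>p. \<forall>x. V x \<noteq> 0 \<longrightarrow> dist x p \<le> d"
    proof (cases "\<exists>p. V p \<noteq> 0")
      case True
      then obtain p where p: "V p \<noteq> 0" by blast
      have "dist x p \<le> d" if "V x \<noteq> 0" for x
        unfolding d_def using outside_supp[of x V] outside_supp[of p V] that p
        by (intro diameter_bounded_bound compact_imp_bounded test_fun_compact V) auto
      then show ?thesis by blast
    qed blast
    then obtain p where p: "\<And>x. V x \<noteq> 0 \<Longrightarrow> dist x p \<le> d" by blast
    have small: "4 * (\<bar>s0\<bar> + 1)\<^sup>2 * cluster_const B d \<le> E * \<delta>\<^sup>2"
    proof -
      have "2 * (\<bar>s0\<bar> + 1)\<^sup>2 * cluster_const B d \<le> c\<^sup>2 * B"
        using C(2)[of s0 d] assms by (simp add: c_def pos_divide_le_eq)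
      then have "4 * (\<bar>s0\<bar> + 1)\<^sup>2 * cluster_const B d \<le> 2 * (c\<^sup>2 * B)" by linarith
      also have "\<dots> = 2 * B * real n * \<delta>\<^sup>2"
        using n'(4) by (simp add: \<delta>_eq power_divide)
      also have "\<dots> \<le> E * \<delta>\<^sup>2"
        by (intro mult_right_mono E2) simp
      finally show ?thesis .
    qed
    have Vm: "V \<in> borel_measurable borel"
      by (intro borel_measurable_continuous_onI smooth_continuous test_fun_smooth V)
    show ?thesis
      by (rule resolvent_set_add_potential[OF assms Vm Vb p E1 \<delta>0 \<delta>1 gap _ small]) auto
  qed
  have "spectrum (add_potential (landau_hamiltonian B) V) \<inter> complex_of_real ` level_interval B V n
      \<subseteq> complex_of_real ` {landau_level B n - c * real n powr (- 1 / 2) <..< landau_level B n + c * real n powr (- 1 / 2)}"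
    if V: "test_fun V" and c: "c = C (SUP x. \<bar>V x\<bar>) (diameter (supp V))"
      and n: "N (SUP x. \<bar>V x\<bar>) (diameter (supp V)) \<le> n" for V n c
  proof
    fix z assume z: "z \<in> spectrum (add_potential (landau_hamiltonian B) V) \<inter> complex_of_real ` level_interval B V n"
    \<comment> \<open>This selects the second branch of \<open>level_interval\<close>.\<close>
    have "n \<noteq> 0" using n by (auto simp: N_def)
    then obtain E where E: "z = complex_of_real E" "landau_level B n - B \<le> E" "E < landau_level B n + B"
      using z by (auto simp: level_interval_def)
    have "\<not> c * real n powr (- 1 / 2) \<le> \<bar>E - landau_level B n\<bar>"
      using main[OF V n E(2,3)] z E(1) by (auto simp: spectrum_def c)
    then have "E \<in> {landau_level B n - c * real n powr (- 1 / 2) <..< landau_level B n + c * real n powr (- 1 / 2)}"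
      by (simp only: greaterThanLessThan_iff) linarith
    with E(1) show "z \<in> complex_of_real ` {landau_level B n - c * real n powr (- 1 / 2) <..< landau_level B n + c * real n powr (- 1 / 2)}"
      by blast
  qed
  note incl = this
  have CN: "0 < C s d" "1 \<le> N s d" for s d
    using C(1)[of s d] by (simp_all add: N_def)
  show ?thesis
    unfolding Let_def
    by (rule exI[of _ C], rule exI[of _ N], intro conjI allI impI CN) (erule incl[OF _ refl])
qed

end
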